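(* Let $\mathscr G$ be an ample groupoid, let $\mathcal O$ be a $\mathscr G$-sheaf of rings and let $\mathcal M$ be a $\mathscr G$-sheaf of $\mathcal O$-modules. Then $$\mathrm{Ann}(\Gamma_c(\mathscr G,\mathcal M))=\bigcap_{x\in\mathscr G^{(0)}}\mathrm{Ann}(\mathrm{Ind}_x(\mathcal M_x)),$$ where annihilators are taken in $\Gamma_c(\mathscr G,\mathcal O)$. Consequently, every (two-sided) ideal of $\Gamma_c(\mathscr G,\mathcal O)$ is an intersection of annihilators of induced modules, i.e. of modules of the form $\mathrm{Ind}_x(M)$ with $x\in\mathscr G^{(0)}$ and $M$ a left $B_x$-module.
   Context: "Compact" includes Hausdorff. A groupoid $\mathscr G$ (identified with its set of arrows) has unit space $\mathscr G^{(0)}$, $\boldsymbol d(\gamma)=\gamma^{-1}\gamma$, $\boldsymbol r(\gamma)=\gamma\gamma^{-1}$; $\gamma:y\to z$ means $\boldsymbol d(\gamma)=y$, $\boldsymbol r(\gamma)=z$. It is ample if it is a topological groupoid such that $\mathscr G^{(0)}$ is locally compact Hausdorff with a basis of compact open sets and $\boldsymbol r$ is a local homeomorphism. A bisection is a subset on which $\boldsymbol d$ and $\boldsymbol r$ are injective. $\mathscr G_x^x=\{g:\boldsymbol d(g)=\boldsymbol r(g)=x\}$. A $\mathscr G$-sheaf $(E,p,\alpha)$ is a space $E$, a local homeomorphism $p:E\to\mathscr G^{(0)}$ and a continuous map $\alpha:\mathscr G\times_{\boldsymbol d,p}E\to E$, $(\gamma,e)\mapsto\alpha_\gamma(e)$,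 with $\alpha_{p(e)}(e)=e$, $p(\alpha_\gamma(e))=\boldsymbol r(\gamma)$, and $\alpha_\beta(\alpha_\gamma(e))=\alpha_{\beta\gamma}(e)$ whenever defined. The stalk at $x$ is $p^{-1}(x)$. A $\mathscr G$-sheaf of rings $\mathcal O=(E,p,\alpha)$ is a $\mathscr G$-sheaf with a unital ring structure on each stalk $\mathcal O_x$ such that fiberwise addition and multiplication $E\times_{p,p}E\to E$ and the unit section $x\mapsto 1_x$ are continuous, and each $\alpha_\gamma:\mathcal O_{\boldsymbol d(\gamma)}\to\mathcal O_{\boldsymbol r(\gamma)}$ is a (unital) ring homomorphism. $\Gamma_c(\mathscr G,\mathcal O)$ is the additive group generated by all maps $f:\mathscr G\to E$ with $p\circ f=\boldsymbol r$ for which there is a compact open bisection $U$ with $f|_U$ continuous and $f=0$ off $U$. It is a ring under pointwise addition and convolution $(f*g)(\gamma)=\sum_{\beta\rho=\gamma}f(\beta)\alpha_\beta(g(\rho))$. A $\mathscr G$-sheaf of $\mathcal O$-modules $\mathcal M=(F,q,\beta)$ is a $\mathscr G$-sheaf with a unitary left $\mathcal O_x$-module structure on each stalk $\mathcal M_x$ such that fiberwise addition $F\times_{q,q}F\to F$ and the action $E\times_{p,q}F\to F$ are continuous and $\beta_\gamma(rm)=\alpha_\gamma(r)\beta_\gamma(m)$ and $\beta_\gamma$ is additive. $\Gamma_c(\mathscr G,\mathcal M)$ is the set of continuous sections $s:\mathscr G^{(0)}\to F$ of $q$ with compact support, a left $\Gamma_c(\mathscr G,\mathcal O)$-module via $(fs)(x)=\sum_{\gamma\in\boldsymbol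 r^{-1}(x)}f(\gamma)\beta_\gamma(s(\boldsymbol d(\gamma)))$. $B_x=\mathcal O_x\rtimes\mathscr G_x^x$ is the skew group ring, with product $(b\delta)(c\eta)=b\alpha_\delta(c)\,\delta\eta$ for $b,c\in\mathcal O_x$, $\delta,\eta\in\mathscr G_x^x$. The stalk $\mathcal M_x$ is a left $B_x$-module via $b\delta\cdot m=b\,\beta_\delta(m)$. Let $\mathcal L_x=\bigoplus_{\boldsymbol d(\gamma)=x}\mathcal O_{\boldsymbol r(\gamma)}$, writing $a1_\gamma$ for the element with entry $a$ at coordinate $\gamma$ and $0$ elsewhere. It is a $\Gamma_c(\mathscr G,\mathcal O)$-$B_x$-bimodule via $a1_\gamma\cdot b\delta=a\alpha_\gamma(b)1_{\gamma\delta}$ and $f\cdot a1_\gamma=\sum_{\boldsymbol d(\beta)=\boldsymbol r(\gamma)}f(\beta)\alpha_\beta(a)1_{\beta\gamma}$. For a left $B_x$-module $M$, $\mathrm{Ind}_x(M)=\mathcal L_x\otimes_{B_x}M$, a left $\Gamma_c(\mathscr G,\mathcal O)$-module. *)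

theory Defs
  imports "HOL-Analysis.Analysis" "HOL-Algebra.Module" "HOL-Algebra.Free_Abelian_Groups"
    "HOL-Algebra.Generated_Groups" "HOL-Algebra.AbelCoset"
begin

section \<open>Ample groupoids\<close>

text \<open>A groupoid is its set of arrows, the underlying set of a topology; the domain, the range and
  the units are derived from the partial product and the inverse. The record operations are total
  functions whose values matter only on arrows, resp. on composable pairs of arrows.\<close>

record 'g groupoid =
  gtop :: "'g topology"
  gmul :: "'g \<Rightarrow> 'g \<Rightarrow> 'g"
  ginv :: "'g \<Rightarrow> 'g"

definition arrows :: "'g groupoid \<Rightarrow> 'g set"
  where "arrows G = topspace (gtop G)"

definition gdom :: "'g groupoid \<Rightarrow> 'g \<Rightarrow> 'g"
  where "gdom G \<gamma> = gmul G (ginv G \<gamma>) \<gamma>"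

definition gran :: "'g groupoid \<Rightarrow> 'g \<Rightarrow> 'g"
  where "gran G \<gamma> = gmul G \<gamma> (ginv G \<gamma>)"

definition units :: "'g groupoid \<Rightarrow> 'g set"
  where "units G = gdom G ` arrows G"

definition unit_space :: "'g groupoid \<Rightarrow> 'g topology"
  where "unit_space G = subtopology (gtop G) (units G)"

definition isotropy :: "'g groupoid \<Rightarrow> 'g \<Rightarrow> 'g set"
  where "isotropy G x = {\<gamma> \<in> arrows G. gdom G \<gamma> = x \<and> gran G \<gamma> = x}"

definition source_fibre :: "'g groupoid \<Rightarrow> 'g \<Rightarrow> 'g set"
  where "source_fibre G x = {\<gamma> \<in> arrows G. gdom G \<gamma> = x}"

definition range_fibre :: "'g groupoid \<Rightarrow> 'g \<Rightarrow> 'g set"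
  where "range_fibre G x = {\<gamma> \<in> arrows G. gran G \<gamma> = x}"

definition composable :: "'g groupoid \<Rightarrow> ('g \<times> 'g) set"
  where "composable G = {(\<beta>, \<gamma>). \<beta> \<in> arrows G \<and> \<gamma> \<in> arrows G \<and> gdom G \<beta> = gran G \<gamma>}"

text \<open>A small category in which every arrow is invertible. That units are idempotent identities
  with themselves as domain and range follows.\<close>

locale groupoid =
  fixes G :: "'g groupoid"
  assumes inv_closed: "\<gamma> \<in> arrows G \<Longrightarrow> ginv G \<gamma> \<in> arrows G"
    and dom_inv: "\<gamma> \<in> arrows G \<Longrightarrow> gdom G (ginv G \<gamma>) = gran G \<gamma>"
    and ran_inv: "\<gamma> \<in> arrows G \<Longrightarrow> gran G (ginv G \<gamma>) = gdom G \<gamma>"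
    and mul_closed: "(\<beta>, \<gamma>) \<in> composable G \<Longrightarrow> gmul G \<beta> \<gamma> \<in> arrows G"
    and dom_mul: "(\<beta>, \<gamma>) \<in> composable G \<Longrightarrow> gdom G (gmul G \<beta> \<gamma>) = gdom G \<gamma>"
    and ran_mul: "(\<beta>, \<gamma>) \<in> composable G \<Longrightarrow> gran G (gmul G \<beta> \<gamma>) = gran G \<beta>"
    and mul_assoc: "(\<alpha>, \<beta>) \<in> composable G \<Longrightarrow> (\<beta>, \<gamma>) \<in> composable G \<Longrightarrow>
          gmul G (gmul G \<alpha> \<beta>) \<gamma> = gmul G \<alpha> (gmul G \<beta> \<gamma>)"
    and mul_dom: "\<gamma> \<in> arrows G \<Longrightarrow> gmul G \<gamma> (gdom G \<gamma>) = \<gamma>"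
    and ran_mul_self: "\<gamma> \<in> arrows G \<Longrightarrow> gmul G (gran G \<gamma>) \<gamma> = \<gamma>"

locale topological_groupoid = groupoid G for G :: "'g groupoid" +
  assumes continuous_mul:
      "continuous_map (subtopology (prod_topology (gtop G) (gtop G)) (composable G)) (gtop G)
         (\<lambda>(\<beta>, \<gamma>). gmul G \<beta> \<gamma>)"
    and continuous_inv: "continuous_map (gtop G) (gtop G) (ginv G)"

definition local_homeomorphism :: "'a topology \<Rightarrow> 'b topology \<Rightarrow> ('a \<Rightarrow> 'b) \<Rightarrow> bool"
  where "local_homeomorphism X Y f \<longleftrightarrow>
    (\<forall>x \<in> topspace X. \<exists>U. openin X U \<and> x \<in> U \<and> openin Y (f ` U) \<and>
       homeomorphic_map (subtopology X U) (subtopology Y (f ` U)) f)"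

text \<open>Compact sets are Hausdorff by convention, whereas arrow spaces and sheaf spaces need not be.\<close>

definition compact_Hausdorffin :: "'a topology \<Rightarrow> 'a set \<Rightarrow> bool"
  where "compact_Hausdorffin X K \<longleftrightarrow> compactin X K \<and> Hausdorff_space (subtopology X K)"

definition compact_open_basis :: "'a topology \<Rightarrow> bool"
  where "compact_open_basis X \<longleftrightarrow>
    (\<exists>\<B>. (\<forall>K \<in> \<B>. openin X K \<and> compact_Hausdorffin X K) \<and>
         (\<forall>U. openin X U \<longrightarrow> (\<exists>\<C> \<subseteq> \<B>. U = \<Union>\<C>)))"

locale ample_groupoid = topological_groupoid G for G :: "'g groupoid" +
  assumes Hausdorff_units: "Hausdorff_space (unit_space G)"
    and locally_compact_units: "locally_compact_space (unit_space G)"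
    and compact_open_basis_units: "compact_open_basis (unit_space G)"
    and local_homeomorphism_ran: "local_homeomorphism (gtop G) (unit_space G) (gran G)"

definition bisection :: "'g groupoid \<Rightarrow> 'g set \<Rightarrow> bool"
  where "bisection G U \<longleftrightarrow> U \<subseteq> arrows G \<and> inj_on (gdom G) U \<and> inj_on (gran G) U"


section \<open>Sheaves on an ample groupoid\<close>

text \<open>HOL-Algebra's \<open>module\<close> locale requires a commutative ring of scalars.\<close>

locale left_module = R?: ring R + M?: abelian_group M
  for R :: "('a, 'c) ring_scheme" and M :: "('a, 'b, 'd) module_scheme" (structure) +
  assumes smult_closed: "\<lbrakk>a \<in> carrier R; m \<in> carrier M\<rbrakk> \<Longrightarrow> a \<odot> m \<in> carrier M"
    and smult_l_distr: "\<lbrakk>a \<in> carrier R; b \<in> carrier R; m \<in> carrier M\<rbrakk> \<Longrightarrow>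
          (a \<oplus>\<^bsub>R\<^esub> b) \<odot> m = a \<odot> m \<oplus> b \<odot> m"
    and smult_r_distr: "\<lbrakk>a \<in> carrier R; m \<in> carrier M; n \<in> carrier M\<rbrakk> \<Longrightarrow>
          a \<odot> (m \<oplus> n) = a \<odot> m \<oplus> a \<odot> n"
    and smult_assoc: "\<lbrakk>a \<in> carrier R; b \<in> carrier R; m \<in> carrier M\<rbrakk> \<Longrightarrow>
          (a \<otimes>\<^bsub>R\<^esub> b) \<odot> m = a \<odot> (b \<odot> m)"
    and smult_one: "m \<in> carrier M \<Longrightarrow> \<one>\<^bsub>R\<^esub> \<odot> m = m"

record ('g, 'e) gsheaf =
  etop :: "'e topology"
  proj :: "'e \<Rightarrow> 'g"
  act :: "'g \<Rightarrow> 'e \<Rightarrow> 'e"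

record ('g, 'e) ring_sheaf = "('g, 'e) gsheaf" +
  ring_stalk :: "'g \<Rightarrow> 'e ring"

record ('g, 'e, 'f) module_sheaf = "('g, 'f) gsheaf" +
  module_stalk :: "'g \<Rightarrow> ('e, 'f) module"

definition stalk :: "('g, 'e, 'z) gsheaf_scheme \<Rightarrow> 'g \<Rightarrow> 'e set"
  where "stalk S x = {e \<in> topspace (etop S). proj S e = x}"

definition fibre_product ::
    "('g, 'e, 'z) gsheaf_scheme \<Rightarrow> ('g, 'f, 'w) gsheaf_scheme \<Rightarrow> ('e \<times> 'f) topology"
  where "fibre_product S T =
    subtopology (prod_topology (etop S) (etop T)) {(a, b). proj S a = proj T b}"

locale gsheaf = ample_groupoid G
  for G :: "'g groupoid" and S :: "('g, 'e, 'z) gsheaf_scheme" +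
  assumes local_homeomorphism_proj: "local_homeomorphism (etop S) (unit_space G) (proj S)"
    and continuous_act:
      "continuous_map
         (subtopology (prod_topology (gtop G) (etop S)) {(\<gamma>, e). gdom G \<gamma> = proj S e})
         (etop S) (\<lambda>(\<gamma>, e). act S \<gamma> e)"
    and act_unit: "e \<in> topspace (etop S) \<Longrightarrow> act S (proj S e) e = e"
    and proj_act: "\<lbrakk>\<gamma> \<in> arrows G; e \<in> stalk S (gdom G \<gamma>)\<rbrakk> \<Longrightarrow>
          proj S (act S \<gamma> e) = gran G \<gamma>"
    and act_act: "\<lbrakk>(\<beta>, \<gamma>) \<in> composable G; e \<in> stalk S (gdom G \<gamma>)\<rbrakk> \<Longrightarrow>
          act S \<beta> (act S \<gamma> e) = act S (gmul G \<beta> \<gamma>) e"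

locale ring_sheaf = gsheaf G \<O> for G :: "'g groupoid" and \<O> :: "('g, 'e) ring_sheaf" +
  assumes stalk_ring: "x \<in> units G \<Longrightarrow> ring (ring_stalk \<O> x)"
    and carrier_ring_stalk: "x \<in> units G \<Longrightarrow> carrier (ring_stalk \<O> x) = stalk \<O> x"
    and continuous_add: "continuous_map (fibre_product \<O> \<O>) (etop \<O>)
          (\<lambda>(a, b). a \<oplus>\<^bsub>ring_stalk \<O> (proj \<O> a)\<^esub> b)"
    and continuous_mult: "continuous_map (fibre_product \<O> \<O>) (etop \<O>)
          (\<lambda>(a, b). a \<otimes>\<^bsub>ring_stalk \<O> (proj \<O> a)\<^esub> b)"
    and continuous_one: "continuous_map (unit_space G) (etop \<O>) (\<lambda>x. \<one>\<^bsub>ring_stalk \<O> x\<^esub>)"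
    and act_ring_hom: "\<gamma> \<in> arrows G \<Longrightarrow>
          act \<O> \<gamma> \<in> ring_hom (ring_stalk \<O> (gdom G \<gamma>)) (ring_stalk \<O> (gran G \<gamma>))"

locale module_sheaf = \<O>: ring_sheaf G \<O> + \<M>: gsheaf G \<M>
  for G :: "'g groupoid" and \<O> :: "('g, 'e) ring_sheaf" and \<M> :: "('g, 'e, 'f) module_sheaf" +
  assumes stalk_module: "x \<in> units G \<Longrightarrow> left_module (ring_stalk \<O> x) (module_stalk \<M> x)"
    and carrier_module_stalk: "x \<in> units G \<Longrightarrow> carrier (module_stalk \<M> x) = stalk \<M> x"
    and continuous_add: "continuous_map (fibre_product \<M> \<M>) (etop \<M>)
          (\<lambda>(m, n). m \<oplus>\<^bsub>module_stalk \<M> (proj \<M> m)\<^esub> n)"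
    and continuous_smult: "continuous_map (fibre_product \<O> \<M>) (etop \<M>)
          (\<lambda>(a, m). a \<odot>\<^bsub>module_stalk \<M> (proj \<M> m)\<^esub> m)"
    and act_smult: "\<lbrakk>\<gamma> \<in> arrows G; a \<in> stalk \<O> (gdom G \<gamma>); m \<in> stalk \<M> (gdom G \<gamma>)\<rbrakk> \<Longrightarrow>
          act \<M> \<gamma> (a \<odot>\<^bsub>module_stalk \<M> (gdom G \<gamma>)\<^esub> m) =
          act \<O> \<gamma> a \<odot>\<^bsub>module_stalk \<M> (gran G \<gamma>)\<^esub> act \<M> \<gamma> m"
    and act_add: "\<lbrakk>\<gamma> \<in> arrows G; m \<in> stalk \<M> (gdom G \<gamma>); n \<in> stalk \<M> (gdom G \<gamma>)\<rbrakk> \<Longrightarrow>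
          act \<M> \<gamma> (m \<oplus>\<^bsub>module_stalk \<M> (gdom G \<gamma>)\<^esub> n) =
          act \<M> \<gamma> m \<oplus>\<^bsub>module_stalk \<M> (gran G \<gamma>)\<^esub> act \<M> \<gamma> n"


section \<open>The convolution ring and its modules of sections\<close>

text \<open>Sum of a family with finite support over a possibly infinite index set.\<close>

abbreviation gfinsum :: "('b, 'm) ring_scheme \<Rightarrow> ('a \<Rightarrow> 'b) \<Rightarrow> 'a set \<Rightarrow> 'b"
  where "gfinsum M \<equiv> gfinprod (add_monoid M)"

text \<open>The coefficient at \<open>\<zeta>\<close> of the product of \<open>\<Sum>\<^sub>\<beta> f(\<beta>)\<beta>\<close> (\<open>\<beta> \<in> A\<close>) and
  \<open>\<Sum>\<^sub>\<rho> g(\<rho>)\<rho>\<close> (\<open>\<rho> \<in> B\<close>) under \<open>(a\<beta>)(b\<rho>) = a \<alpha>\<^sub>\<beta>(b) \<beta>\<rho>\<close>. The product of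
  \<open>\<Gamma>\<^sub>c(G, \<O>)\<close>, that of the skew group rings \<open>B\<^sub>x\<close>, and both actions on the bimodules \<open>\<L>\<^sub>x\<close> are
  all instances.\<close>

definition convolution :: "'g groupoid \<Rightarrow> ('g, 'e) ring_sheaf \<Rightarrow> 'g set \<Rightarrow> 'g set \<Rightarrow>
    ('g \<Rightarrow> 'e) \<Rightarrow> ('g \<Rightarrow> 'e) \<Rightarrow> 'g \<Rightarrow> 'e"
  where "convolution G \<O> A B f g \<zeta> =
    gfinsum (ring_stalk \<O> (gran G \<zeta>))
      (\<lambda>(\<beta>, \<rho>). f \<beta> \<otimes>\<^bsub>ring_stalk \<O> (gran G \<zeta>)\<^esub> act \<O> \<beta> (g \<rho>))
      {(\<beta>, \<rho>) \<in> composable G. \<beta> \<in> A \<and> \<rho> \<in> B \<and> gmul G \<beta> \<rho> = \<zeta>}"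

definition section_group :: "'g groupoid \<Rightarrow> ('g, 'e) ring_sheaf \<Rightarrow> ('g \<Rightarrow> 'e) monoid"
  where "section_group G \<O> =
    product_group (arrows G) (\<lambda>\<gamma>. add_monoid (ring_stalk \<O> (gran G \<gamma>)))"

definition Gamma_generators :: "'g groupoid \<Rightarrow> ('g, 'e) ring_sheaf \<Rightarrow> ('g \<Rightarrow> 'e) set"
  where "Gamma_generators G \<O> = {f \<in> carrier (section_group G \<O>).
    \<exists>U. bisection G U \<and> openin (gtop G) U \<and> compact_Hausdorffin (gtop G) U \<and>
        continuous_map (subtopology (gtop G) U) (etop \<O>) f \<and>
        (\<forall>\<gamma> \<in> arrows G - U. f \<gamma> = \<zero>\<^bsub>ring_stalk \<O> (gran G \<gamma>)\<^esub>)}"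

text \<open>\<open>\<Gamma>\<^sub>c(G, \<O>)\<close> has no unit in general, so the field \<open>one\<close> carries no meaning.\<close>

definition Gamma_ring :: "'g groupoid \<Rightarrow> ('g, 'e) ring_sheaf \<Rightarrow> ('g \<Rightarrow> 'e) ring"
  where "Gamma_ring G \<O> =
    \<lparr>carrier = generate (section_group G \<O>) (Gamma_generators G \<O>),
     mult = (\<lambda>f g. \<lambda>\<gamma>\<in>arrows G. convolution G \<O> (arrows G) (arrows G) f g \<gamma>),
     one = undefined,
     ring.zero = \<one>\<^bsub>section_group G \<O>\<^esub>,
     ring.add = (\<lambda>f g. f \<otimes>\<^bsub>section_group G \<O>\<^esub> g)\<rparr>"

text \<open>The set where a continuous section is nonzero is already closed in \<open>G\<^sup>0\<close>, as the zero section
  has open image; so this is the support. In the records of modules below the inherited ring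
  fields \<open>mult\<close> and \<open>one\<close> carry no meaning.\<close>

definition Gamma_module ::
    "'g groupoid \<Rightarrow> ('g, 'e) ring_sheaf \<Rightarrow> ('g, 'e, 'f) module_sheaf \<Rightarrow> ('g \<Rightarrow> 'e, 'g \<Rightarrow> 'f) module"
  where "Gamma_module G \<O> \<M> =
    \<lparr>carrier = {s \<in> extensional (units G).
       continuous_map (unit_space G) (etop \<M>) s \<and> (\<forall>x \<in> units G. proj \<M> (s x) = x) \<and>
       compact_Hausdorffin (unit_space G) {x \<in> units G. s x \<noteq> \<zero>\<^bsub>module_stalk \<M> x\<^esub>}},
     mult = undefined,
     one = undefined,
     ring.zero = (\<lambda>x\<in>units G. \<zero>\<^bsub>module_stalk \<M> x\<^esub>),
     ring.add = (\<lambda>s t. \<lambda>x\<in>units G. s x \<oplus>\<^bsub>module_stalk \<M> x\<^esub> t x),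
     smult = (\<lambda>f s. \<lambda>x\<in>units G. gfinsum (module_stalk \<M> x)
       (\<lambda>\<gamma>. f \<gamma> \<odot>\<^bsub>module_stalk \<M> x\<^esub> act \<M> \<gamma> (s (gdom G \<gamma>))) (range_fibre G x))\<rparr>"

definition annihilator :: "('a, 'c) ring_scheme \<Rightarrow> ('a, 'b, 'd) module_scheme \<Rightarrow> 'a set"
  where "annihilator R M = {a \<in> carrier R. \<forall>m \<in> carrier M. a \<odot>\<^bsub>M\<^esub> m = \<zero>\<^bsub>M\<^esub>}"

text \<open>HOL-Algebra's \<open>ideal\<close> without its requirement that the ring be unital.\<close>

definition two_sided_ideal :: "'a set \<Rightarrow> ('a, 'c) ring_scheme \<Rightarrow> bool"
  where "two_sided_ideal I R \<longleftrightarrow> additive_subgroup I R \<and>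
    (\<forall>a \<in> I. \<forall>r \<in> carrier R. r \<otimes>\<^bsub>R\<^esub> a \<in> I \<and> a \<otimes>\<^bsub>R\<^esub> r \<in> I)"


section \<open>Induced modules\<close>

text \<open>\<open>B\<^sub>x\<close>: finitely supported families \<open>(b\<^sub>\<delta>)\<close> standing for \<open>\<Sum>\<^sub>\<delta> b\<^sub>\<delta> \<delta>\<close>.\<close>

definition skew_sum_group :: "'g groupoid \<Rightarrow> ('g, 'e) ring_sheaf \<Rightarrow> 'g \<Rightarrow> ('g \<Rightarrow> 'e) monoid"
  where "skew_sum_group G \<O> x = sum_group (isotropy G x) (\<lambda>\<delta>. add_monoid (ring_stalk \<O> x))"

definition skew_group_ring :: "'g groupoid \<Rightarrow> ('g, 'e) ring_sheaf \<Rightarrow> 'g \<Rightarrow> ('g \<Rightarrow> 'e) ring"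
  where "skew_group_ring G \<O> x =
    \<lparr>carrier = carrier (skew_sum_group G \<O> x),
     mult = (\<lambda>b c. \<lambda>\<delta>\<in>isotropy G x. convolution G \<O> (isotropy G x) (isotropy G x) b c \<delta>),
     one = (\<lambda>\<delta>\<in>isotropy G x. if \<delta> = x then \<one>\<^bsub>ring_stalk \<O> x\<^esub> else \<zero>\<^bsub>ring_stalk \<O> x\<^esub>),
     ring.zero = \<one>\<^bsub>skew_sum_group G \<O> x\<^esub>,
     ring.add = (\<lambda>b c. b \<otimes>\<^bsub>skew_sum_group G \<O> x\<^esub> c)\<rparr>"

definition stalk_skew_module ::
    "'g groupoid \<Rightarrow> ('g, 'e, 'f) module_sheaf \<Rightarrow> 'g \<Rightarrow> ('g \<Rightarrow> 'e, 'f) module"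
  where "stalk_skew_module G \<M> x =
    \<lparr>carrier = carrier (module_stalk \<M> x),
     mult = undefined,
     one = undefined,
     ring.zero = \<zero>\<^bsub>module_stalk \<M> x\<^esub>,
     ring.add = (\<lambda>m n. m \<oplus>\<^bsub>module_stalk \<M> x\<^esub> n),
     smult = (\<lambda>b m. gfinsum (module_stalk \<M> x)
       (\<lambda>\<delta>. b \<delta> \<odot>\<^bsub>module_stalk \<M> x\<^esub> act \<M> \<delta> m) (isotropy G x))\<rparr>"

text \<open>\<open>\<L>\<^sub>x\<close>, its additive group being written multiplicatively as a \<open>monoid\<close> record. A family
  \<open>l\<close> stands for \<open>\<Sum>\<^sub>\<gamma> l(\<gamma>) 1\<^sub>\<gamma>\<close>.\<close>

definition L_group :: "'g groupoid \<Rightarrow> ('g, 'e) ring_sheaf \<Rightarrow> 'g \<Rightarrow> ('g \<Rightarrow> 'e) monoid"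
  where "L_group G \<O> x =
    sum_group (source_fibre G x) (\<lambda>\<gamma>. add_monoid (ring_stalk \<O> (gran G \<gamma>)))"

definition L_right :: "'g groupoid \<Rightarrow> ('g, 'e) ring_sheaf \<Rightarrow> 'g \<Rightarrow> ('g \<Rightarrow> 'e) \<Rightarrow> ('g \<Rightarrow> 'e) \<Rightarrow> 'g \<Rightarrow> 'e"
  where "L_right G \<O> x l b =
    (\<lambda>\<gamma>\<in>source_fibre G x. convolution G \<O> (source_fibre G x) (isotropy G x) l b \<gamma>)"

definition L_left :: "'g groupoid \<Rightarrow> ('g, 'e) ring_sheaf \<Rightarrow> 'g \<Rightarrow> ('g \<Rightarrow> 'e) \<Rightarrow> ('g \<Rightarrow> 'e) \<Rightarrow> 'g \<Rightarrow> 'e"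
  where "L_left G \<O> x f l =
    (\<lambda>\<gamma>\<in>source_fibre G x. convolution G \<O> (arrows G) (source_fibre G x) f l \<gamma>)"

text \<open>The tensor product over a noncommutative ring \<open>B\<close> of a right module, given by an abelian
  group \<open>L\<close> (written multiplicatively) with right action \<open>ract\<close>, and a left module \<open>M\<close>: the free
  abelian group on the pairs \<open>(l, m)\<close> modulo additivity in both arguments and \<open>(lb, m) = (l, bm)\<close>.\<close>

definition tensor_free ::
    "('l, 'y) monoid_scheme \<Rightarrow> ('b, 'm, 'z) module_scheme \<Rightarrow> ('l \<times> 'm \<Rightarrow>\<^sub>0 int) monoid"
  where "tensor_free L M = free_Abelian_group (carrier L \<times> carrier M)"

definition tensor_relators :: "('b, 'x) ring_scheme \<Rightarrow> ('l, 'y) monoid_scheme \<Rightarrow>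
    ('l \<Rightarrow> 'b \<Rightarrow> 'l) \<Rightarrow> ('b, 'm, 'z) module_scheme \<Rightarrow> ('l \<times> 'm \<Rightarrow>\<^sub>0 int) set"
  where "tensor_relators B L ract M =
    {frag_of (l \<otimes>\<^bsub>L\<^esub> l', m) - frag_of (l, m) - frag_of (l', m) | l l' m.
       l \<in> carrier L \<and> l' \<in> carrier L \<and> m \<in> carrier M} \<union>
    {frag_of (l, m \<oplus>\<^bsub>M\<^esub> m') - frag_of (l, m) - frag_of (l, m') | l m m'.
       l \<in> carrier L \<and> m \<in> carrier M \<and> m' \<in> carrier M} \<union>
    {frag_of (ract l b, m) - frag_of (l, b \<odot>\<^bsub>M\<^esub> m) | l b m.
       l \<in> carrier L \<and> b \<in> carrier B \<and> m \<in> carrier M}"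

definition tensor_kernel :: "('b, 'x) ring_scheme \<Rightarrow> ('l, 'y) monoid_scheme \<Rightarrow>
    ('l \<Rightarrow> 'b \<Rightarrow> 'l) \<Rightarrow> ('b, 'm, 'z) module_scheme \<Rightarrow> ('l \<times> 'm \<Rightarrow>\<^sub>0 int) set"
  where "tensor_kernel B L ract M = generate (tensor_free L M) (tensor_relators B L ract M)"

definition tensor_product :: "('b, 'x) ring_scheme \<Rightarrow> ('l, 'y) monoid_scheme \<Rightarrow>
    ('l \<Rightarrow> 'b \<Rightarrow> 'l) \<Rightarrow> ('b, 'm, 'z) module_scheme \<Rightarrow> ('l \<times> 'm \<Rightarrow>\<^sub>0 int) set monoid"
  where "tensor_product B L ract M = tensor_free L M Mod tensor_kernel B L ract M"

text \<open>The endomorphism of the tensor product induced by \<open>l \<otimes> m \<mapsto> \<phi>(l) \<otimes> m\<close>.\<close>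

definition tensor_map :: "('b, 'x) ring_scheme \<Rightarrow> ('l, 'y) monoid_scheme \<Rightarrow>
    ('l \<Rightarrow> 'b \<Rightarrow> 'l) \<Rightarrow> ('b, 'm, 'z) module_scheme \<Rightarrow> ('l \<Rightarrow> 'l) \<Rightarrow>
    ('l \<times> 'm \<Rightarrow>\<^sub>0 int) set \<Rightarrow> ('l \<times> 'm \<Rightarrow>\<^sub>0 int) set"
  where "tensor_map B L ract M \<phi> X =
    the_elem ((\<lambda>t. tensor_kernel B L ract M #>\<^bsub>tensor_free L M\<^esub>
                     frag_extend (\<lambda>(l, m). frag_of (\<phi> l, m)) t) ` X)"

definition Ind :: "'g groupoid \<Rightarrow> ('g, 'e) ring_sheaf \<Rightarrow> 'g \<Rightarrow> ('g \<Rightarrow> 'e, 'm) module \<Rightarrow>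
    ('g \<Rightarrow> 'e, (('g \<Rightarrow> 'e) \<times> 'm \<Rightarrow>\<^sub>0 int) set) module"
  where "Ind G \<O> x M =
    (let B = skew_group_ring G \<O> x; L = L_group G \<O> x; T = tensor_product B L (L_right G \<O> x) M in
    \<lparr>carrier = carrier T,
     mult = undefined,
     one = undefined,
     ring.zero = \<one>\<^bsub>T\<^esub>,
     ring.add = (\<lambda>X Y. X \<otimes>\<^bsub>T\<^esub> Y),
     smult = (\<lambda>f. tensor_map B L (L_right G \<O> x) M (L_left G \<O> x f))\<rparr>)"

text \<open>\<open>Ann(Ind\<^sub>x(M))\<close> depends on \<open>M\<close> only through its annihilator \<open>J\<close> in \<open>B\<^sub>x\<close>, so it is also
  attained by \<open>B\<^sub>x / J\<close>, whose elements are sets of functions. Hence a statement asserting the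
  existence of modules \<open>M\<close> loses no generality by placing them on the type \<open>('g \<Rightarrow> 'e) set\<close>.\<close>

end

theory Submission
  imports Defs "HOL-Algebra.QuotRing"
begin

text \<open>As a right \<open>B\<^sub>x\<close>-module, \<open>\<L>\<^sub>x\<close> is free on one \<open>1\<^sub>\<eta>\<close> for each point of the orbit of \<open>x\<close>, so
  \<open>f\<close> annihilates \<open>Ind\<^sub>x(M)\<close> iff all its matrix entries
  \<open>\<Sum>\<^sub>\<delta> \<alpha>\<^sub>\<eta>\<^sup>-\<^sup>1(f(\<eta>\<delta>\<gamma>\<^sup>-\<^sup>1)) \<delta>\<close>, for \<open>\<eta>\<close> and \<open>\<gamma>\<close> with domain \<open>x\<close>, annihilate \<open>M\<close>. For
  \<open>M = \<M>\<^sub>x\<close> this says that for all \<open>y\<close>, \<open>z\<close> and \<open>m \<in> \<M>\<^sub>y\<close> the sum of the \<open>f(\<beta>) \<beta>\<cdot>m\<close> over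
  \<open>\<beta> : y \<rightarrow> z\<close> vanishes, and that is also what annihilating \<open>\<Gamma>\<^sub>c(G, \<M>)\<close> means, as there are sections
  through \<open>m\<close> supported near \<open>y\<close>. For an ideal \<open>I\<close>, no disintegration theorem is needed: the
  restrictions to the isotropy group at \<open>x\<close> of the elements of \<open>I\<close> form an ideal \<open>J\<^sub>x\<close> of \<open>B\<^sub>x\<close>, and
  \<open>I\<close> is the intersection of the annihilators of the \<open>Ind\<^sub>x(B\<^sub>x / J\<^sub>x)\<close>. If \<open>f\<close> annihilates all of
  these, then for all \<open>y\<close> and \<open>z\<close> it agrees with some \<open>g \<in> I\<close> on the arrows \<open>y \<rightarrow> z\<close>, hence on all
  arrows from a neighbourhood of \<open>y\<close> to one of \<open>z\<close>; cutting down by units and compactness give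
  \<open>f \<in> I\<close>.\<close>

section \<open>Sums of finite support\<close>

text \<open>The delicate step is from the arrows y \<rightarrow> z to neighbourhoods. Multiplying by
  units restricts only the range and the domain of an arrow, so f and g have to agree on all arrows
  from some B around y to some A around z, including arrows far from every arrow y \<rightarrow> z.
  There may be infinitely many arrows y \<rightarrow> z, and f - g may be discontinuous. What helps
  is that, near (y, z), an element of \<open>\<Gamma>\<^sub>c\<close> is a sum of germs, one for
  each of the finitely many arrows y \<rightarrow> z where it is nonzero; for f - g no germ is left.
  Matrix entries are formed for every pair of arrows out of x rather than for a basis, so no orbit
  representatives have to be fixed. The quotient by \<open>J\<^sub>x\<close> serves because
  \<open>J\<^sub>x\<close> is two-sided: its left annihilator in \<open>B\<^sub>x\<close> is then
  \<open>J\<^sub>x\<close> itself. The product of \<open>B\<^sub>x\<close> and both actions on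
  \<open>\<L>\<^sub>x\<close> are one operation on families, so that identities are checked on
  families with a single nonzero entry and extended by additivity.\<close>

lemma (in comm_monoid) gfinprod_reindex:
  assumes "inj_on h A" and "f \<in> h ` A \<rightarrow> carrier G"
  shows "gfinprod G f (h ` A) = gfinprod G (\<lambda>i. f (h i)) A"
proof -
  have eq: "{y \<in> h ` A. f y \<noteq> \<one>} = h ` {i \<in> A. f (h i) \<noteq> \<one>}" by auto
  have inj: "inj_on h {i \<in> A. f (h i) \<noteq> \<one>}" using assms(1) by (auto simp: inj_on_def)
  have "f \<in> h ` {i \<in> A. f (h i) \<noteq> \<one>} \<rightarrow> carrier G" using assms(2) by auto
  with inj show ?thesis
    unfolding gfinprod_def eq by (simp add: finite_image_iff finprod_reindex)
qed

lemma (in comm_monoid) gfinprod_singleton: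
  assumes "i \<in> A" and "f i \<in> carrier G" and "\<And>j. j \<in> A \<Longrightarrow> j \<noteq> i \<Longrightarrow> f j = \<one>"
  shows "gfinprod G f A = f i"
proof -
  have "gfinprod G f A = gfinprod G f {i}"
    by (rule gfinprod_mono_neutral_cong_right) (use assms in auto, metis assms(2) assms(3) one_closed)
  then show ?thesis using assms by simp
qed

lemma (in comm_monoid) gfinprod_one:
  assumes "\<And>j. j \<in> A \<Longrightarrow> f j = \<one>"
  shows "gfinprod G f A = \<one>"
  unfolding gfinprod_def using assms by (simp cong: conj_cong)

text \<open>A sum of infinite support is 1 by convention, so the source family must have finite
  support. The image family can only have a smaller one: terms that h kills drop out in the last
  step.\<close>

lemma gfinprod_hom:
  assumes "comm_group G" "comm_group H" "h \<in> hom G H"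
    and fin: "finite {i \<in> A. f i \<noteq> \<one>\<^bsub>G\<^esub>}" and f: "f \<in> A \<rightarrow> carrier G"
  shows "h (gfinprod G f A) = gfinprod H (\<lambda>i. h (f i)) A"
proof -
  interpret G: comm_group G by fact
  interpret H: comm_group H by fact
  interpret group_hom G H h using assms(3) by unfold_locales
  let ?F = "{i \<in> A. f i \<noteq> \<one>\<^bsub>G\<^esub>}"
  have f': "f \<in> ?F \<rightarrow> carrier G" using f by auto
  have "h (finprod G f S) = finprod H (\<lambda>i. h (f i)) S" if "finite S" "f \<in> S \<rightarrow> carrier G" for S
    using that
  proof (induction S)
    case (insert i S)
    then have "f \<in> S \<rightarrow> carrier G" "f i \<in> carrier G" "(\<lambda>i. h (f i)) \<in> S \<rightarrow> carrier H"
      by (auto simp: Pi_iff)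
    with insert show ?case by simp
  qed simp
  then have "h (gfinprod G f A) = finprod H (\<lambda>i. h (f i)) ?F"
    using fin f' unfolding gfinprod_def by simp
  also have "\<dots> = gfinprod H (\<lambda>i. h (f i)) ?F"
    using fin f' by (intro H.gfinprod_eq_finprod[symmetric]) (auto simp: Pi_iff)
  also have "\<dots> = gfinprod H (\<lambda>i. h (f i)) A"
    by (rule H.gfinprod_mono_neutral_cong_left) (use f in \<open>auto simp: Pi_iff\<close>)
  finally show ?thesis .
qed

lemma ring_add_comm_group: "ring R \<Longrightarrow> comm_group (add_monoid R)"
  using ring.is_abelian_group abelian_group.a_comm_group by blast

section \<open>Groupoids\<close>

context groupoid
begin

lemma mul_in_arrows [simp]:
  "\<beta> \<in> arrows G \<Longrightarrow> \<gamma> \<in> arrows G \<Longrightarrow> gdom G \<beta> = gran G \<gamma> \<Longrightarrow> gmul G \<beta> \<gamma> \<in> arrows G"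
  and gdom_mul [simp]:
  "\<beta> \<in> arrows G \<Longrightarrow> \<gamma> \<in> arrows G \<Longrightarrow> gdom G \<beta> = gran G \<gamma> \<Longrightarrow> gdom G (gmul G \<beta> \<gamma>) = gdom G \<gamma>"
  and gran_mul [simp]:
  "\<beta> \<in> arrows G \<Longrightarrow> \<gamma> \<in> arrows G \<Longrightarrow> gdom G \<beta> = gran G \<gamma> \<Longrightarrow> gran G (gmul G \<beta> \<gamma>) = gran G \<beta>"
  by (auto simp: composable_def mul_closed dom_mul ran_mul)

lemma gmul_assoc:
  "\<alpha> \<in> arrows G \<Longrightarrow> \<beta> \<in> arrows G \<Longrightarrow> \<gamma> \<in> arrows G \<Longrightarrow> gdom G \<alpha> = gran G \<beta> \<Longrightarrow>
    gdom G \<beta> = gran G \<gamma> \<Longrightarrow> gmul G (gmul G \<alpha> \<beta>) \<gamma> = gmul G \<alpha> (gmul G \<beta> \<gamma>)"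
  by (auto simp: composable_def mul_assoc)

lemmas inv_simps [simp] = inv_closed dom_inv ran_inv mul_dom ran_mul_self

lemma dom_in_units [simp]: "\<gamma> \<in> arrows G \<Longrightarrow> gdom G \<gamma> \<in> units G"
  by (simp add: units_def)

lemma ran_in_units [simp]: "\<gamma> \<in> arrows G \<Longrightarrow> gran G \<gamma> \<in> units G"
  by (metis dom_in_units dom_inv inv_closed)

lemma unit_in_arrows: "x \<in> units G \<Longrightarrow> x \<in> arrows G"
  unfolding units_def gdom_def by auto

text \<open>A unit is by definition the product of some \<open>\<gamma>\<^sup>-\<^sup>1\<close> with
  \<gamma>, so both of its ends follow from the rules for ends of products.\<close>

lemma dom_unit [simp]: "x \<in> units G \<Longrightarrow> gdom G x = x"
  and ran_unit [simp]: "x \<in> units G \<Longrightarrow> gran G x = x"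
proof -
  assume "x \<in> units G"
  then obtain \<gamma> where \<gamma>: "\<gamma> \<in> arrows G" "x = gdom G \<gamma>" by (auto simp: units_def)
  then have x: "x = gmul G (ginv G \<gamma>) \<gamma>" by (simp add: gdom_def)
  show "gdom G x = x" "gran G x = x"
    using \<gamma> gdom_mul[of "ginv G \<gamma>" \<gamma>] gran_mul[of "ginv G \<gamma>" \<gamma>] x by simp_all
qed

lemma mul_inv [simp]: "gmul G \<gamma> (ginv G \<gamma>) = gran G \<gamma>" and inv_mul [simp]: "gmul G (ginv G \<gamma>) \<gamma> = gdom G \<gamma>"
  by (simp_all add: gdom_def gran_def)

text \<open>The two bracketings of the product of the double inverse, the inverse and \<gamma>
  itself evaluate to \<gamma> and to the double inverse.\<close>

lemma inv_inv [simp]: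
  assumes "\<gamma> \<in> arrows G" shows "ginv G (ginv G \<gamma>) = \<gamma>"
proof -
  have "gmul G (gmul G (ginv G (ginv G \<gamma>)) (ginv G \<gamma>)) \<gamma> = gmul G (ginv G (ginv G \<gamma>)) (gmul G (ginv G \<gamma>) \<gamma>)"
    using assms by (intro gmul_assoc) auto
  moreover have "gmul G (ginv G (ginv G \<gamma>)) (gdom G \<gamma>) = ginv G (ginv G \<gamma>)"
    using mul_dom[of "ginv G (ginv G \<gamma>)"] assms by simp
  ultimately show ?thesis using assms by simp
qed

lemma inv_unit [simp]:
  assumes "x \<in> units G" shows "ginv G x = x"
  using mul_dom[of "ginv G x"] assms unit_in_arrows[OF assms] by simp

lemma mul_unit [simp]: "\<gamma> \<in> arrows G \<Longrightarrow> gdom G \<gamma> = x \<Longrightarrow> gmul G \<gamma> x = \<gamma>"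
  and unit_mul [simp]: "\<gamma> \<in> arrows G \<Longrightarrow> gran G \<gamma> = x \<Longrightarrow> gmul G x \<gamma> = \<gamma>"
  by auto

text \<open>As rewrite rules these take over most uses of associativity, which has two composability
  conditions and is invoked by hand.\<close>

lemma cancel [simp]:
  assumes "\<beta> \<in> arrows G" "\<gamma> \<in> arrows G"
  shows "gdom G \<beta> = gran G \<gamma> \<Longrightarrow> gmul G (ginv G \<beta>) (gmul G \<beta> \<gamma>) = \<gamma>"
    and "gran G \<beta> = gran G \<gamma> \<Longrightarrow> gmul G \<beta> (gmul G (ginv G \<beta>) \<gamma>) = \<gamma>"
    and "gdom G \<gamma> = gran G \<beta> \<Longrightarrow> gmul G (gmul G \<gamma> \<beta>) (ginv G \<beta>) = \<gamma>"
    and "gdom G \<gamma> = gdom G \<beta> \<Longrightarrow> gmul G (gmul G \<gamma> (ginv G \<beta>)) \<beta> = \<gamma>"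
proof -
  show "gmul G (ginv G \<beta>) (gmul G \<beta> \<gamma>) = \<gamma>" if "gdom G \<beta> = gran G \<gamma>"
    using gmul_assoc[of "ginv G \<beta>" \<beta> \<gamma>] assms that by simp
  show "gmul G \<beta> (gmul G (ginv G \<beta>) \<gamma>) = \<gamma>" if "gran G \<beta> = gran G \<gamma>"
    using gmul_assoc[of \<beta> "ginv G \<beta>" \<gamma>] assms that by simp
  show "gmul G (gmul G \<gamma> \<beta>) (ginv G \<beta>) = \<gamma>" if "gdom G \<gamma> = gran G \<beta>"
    using gmul_assoc[of \<gamma> \<beta> "ginv G \<beta>"] assms that by simp
  show "gmul G (gmul G \<gamma> (ginv G \<beta>)) \<beta> = \<gamma>" if "gdom G \<gamma> = gdom G \<beta>"
    using gmul_assoc[of \<gamma> "ginv G \<beta>" \<beta>] assms that by simp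
qed

lemma inv_gmul:
  assumes "\<beta> \<in> arrows G" "\<gamma> \<in> arrows G" "gdom G \<beta> = gran G \<gamma>"
  shows "ginv G (gmul G \<beta> \<gamma>) = gmul G (ginv G \<gamma>) (ginv G \<beta>)"
proof -
  have "gmul G (gmul G \<beta> \<gamma>) (gmul G (ginv G \<gamma>) (ginv G \<beta>)) = gran G \<beta>"
    using assms gmul_assoc[of "gmul G \<beta> \<gamma>" "ginv G \<gamma>" "ginv G \<beta>"] by simp
  then show ?thesis
    using cancel(1)[of "gmul G \<beta> \<gamma>" "gmul G (ginv G \<gamma>) (ginv G \<beta>)"] assms
      mul_unit[of "ginv G (gmul G \<beta> \<gamma>)" "gran G \<beta>"] by simp
qed

text \<open>Solving for the left factor turns a sum over factorizations of \<zeta> into a sum over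
  the right factor alone.\<close>

lemma right_translate_eq_iff:
  assumes "\<gamma> \<in> arrows G" "\<beta> \<in> arrows G" "\<zeta> \<in> arrows G" "gdom G \<gamma> = gran G \<beta>" "gdom G \<zeta> = gdom G \<beta>"
  shows "gmul G \<gamma> \<beta> = \<zeta> \<longleftrightarrow> \<gamma> = gmul G \<zeta> (ginv G \<beta>)"
  using assms by auto

lemma isotropy_iff: "\<delta> \<in> isotropy G x \<longleftrightarrow> \<delta> \<in> arrows G \<and> gdom G \<delta> = x \<and> gran G \<delta> = x"
  by (auto simp: isotropy_def)

lemma source_fibre_iff: "\<gamma> \<in> source_fibre G x \<longleftrightarrow> \<gamma> \<in> arrows G \<and> gdom G \<gamma> = x"
  by (auto simp: source_fibre_def)

end

section \<open>Convolution of finitely supported sections\<close>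

text \<open>The axiom \<open>proj_act\<close> gives only the base point of the image. That the image
  lies in the sheaf space comes from continuity, as a continuous map sends the whole space into its
  target.\<close>

lemma (in gsheaf) act_closed:
  assumes "\<gamma> \<in> arrows G" "e \<in> stalk S (gdom G \<gamma>)"
  shows "act S \<gamma> e \<in> stalk S (gran G \<gamma>)"
proof -
  have "(\<gamma>, e) \<in> topspace (subtopology (prod_topology (gtop G) (etop S)) {(\<gamma>, e). gdom G \<gamma> = proj S e})"
    using assms by (auto simp: stalk_def arrows_def)
  then have "act S \<gamma> e \<in> topspace (etop S)"
    using continuous_map_image_subset_topspace[OF continuous_act] by auto
  then show ?thesis using proj_act[OF assms] by (simp add: stalk_def)
qed

lemma (in gsheaf) act_gmul:
  assumes "\<beta> \<in> arrows G" "\<gamma> \<in> arrows G" "gdom G \<beta> = gran G \<gamma>" "e \<in> stalk S (gdom G \<gamma>)"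
  shows "act S (gmul G \<beta> \<gamma>) e = act S \<beta> (act S \<gamma> e)"
  using act_act[of \<beta> \<gamma> e] assms by (simp add: composable_def)

lemma (in gsheaf) act_unit_stalk: "e \<in> stalk S x \<Longrightarrow> act S x e = e"
  using act_unit by (auto simp: stalk_def)

context ring_sheaf
begin

abbreviation R :: "'g \<Rightarrow> 'e ring" where "R \<equiv> ring_stalk \<O>"

lemma R_add_comm_group: "x \<in> units G \<Longrightarrow> comm_group (add_monoid (R x))"
  using ring_add_comm_group stalk_ring by blast

lemma R_comm_monoid: "x \<in> units G \<Longrightarrow> comm_monoid (add_monoid (R x))"
  using R_add_comm_group comm_group.axioms(1) by blast

lemma R_group: "x \<in> units G \<Longrightarrow> group (add_monoid (R x))"
  using R_add_comm_group comm_group.axioms(2) by blast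

context
  fixes x assumes x: "x \<in> units G"
begin

interpretation ring "R x" using stalk_ring[OF x] .

lemmas R_simps [simp] =
  zero_closed one_closed a_closed m_closed l_null r_null l_one r_one l_zero r_zero
lemmas R_laws = a_assoc a_comm m_assoc l_distr r_distr

end

lemma
  assumes "\<gamma> \<in> arrows G"
  shows act_in_carrier [simp]: "a \<in> carrier (R (gdom G \<gamma>)) \<Longrightarrow> act \<O> \<gamma> a \<in> carrier (R (gran G \<gamma>))"
    and act_add: "a \<in> carrier (R (gdom G \<gamma>)) \<Longrightarrow> b \<in> carrier (R (gdom G \<gamma>)) \<Longrightarrow>
      act \<O> \<gamma> (a \<oplus>\<^bsub>R (gdom G \<gamma>)\<^esub> b) = act \<O> \<gamma> a \<oplus>\<^bsub>R (gran G \<gamma>)\<^esub> act \<O> \<gamma> b"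
    and act_mult: "a \<in> carrier (R (gdom G \<gamma>)) \<Longrightarrow> b \<in> carrier (R (gdom G \<gamma>)) \<Longrightarrow>
      act \<O> \<gamma> (a \<otimes>\<^bsub>R (gdom G \<gamma>)\<^esub> b) = act \<O> \<gamma> a \<otimes>\<^bsub>R (gran G \<gamma>)\<^esub> act \<O> \<gamma> b"
    and act_one [simp]: "act \<O> \<gamma> \<one>\<^bsub>R (gdom G \<gamma>)\<^esub> = \<one>\<^bsub>R (gran G \<gamma>)\<^esub>"
    and act_hom: "act \<O> \<gamma> \<in> hom (add_monoid (R (gdom G \<gamma>))) (add_monoid (R (gran G \<gamma>)))"
  using act_ring_hom[OF assms] by (auto simp: ring_hom_def hom_def)

lemma act_zero [simp]:
  "\<gamma> \<in> arrows G \<Longrightarrow> act \<O> \<gamma> \<zero>\<^bsub>R (gdom G \<gamma>)\<^esub> = \<zero>\<^bsub>R (gran G \<gamma>)\<^esub>"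
  using hom_one[OF act_hom[of \<gamma>]] R_group by simp

lemma act_mul:
  "\<beta> \<in> arrows G \<Longrightarrow> \<gamma> \<in> arrows G \<Longrightarrow> gdom G \<beta> = gran G \<gamma> \<Longrightarrow> a \<in> carrier (R (gdom G \<gamma>)) \<Longrightarrow>
    act \<O> (gmul G \<beta> \<gamma>) a = act \<O> \<beta> (act \<O> \<gamma> a)"
  by (rule act_gmul) (simp_all add: carrier_ring_stalk)

lemma act_unit_id [simp]: "x \<in> units G \<Longrightarrow> a \<in> carrier (R x) \<Longrightarrow> act \<O> x a = a"
  by (simp add: carrier_ring_stalk act_unit_stalk)

lemma act_inv_cancel:
  assumes "\<gamma> \<in> arrows G"
  shows "a \<in> carrier (R (gdom G \<gamma>)) \<Longrightarrow> act \<O> (ginv G \<gamma>) (act \<O> \<gamma> a) = a"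
    and "a \<in> carrier (R (gran G \<gamma>)) \<Longrightarrow> act \<O> \<gamma> (act \<O> (ginv G \<gamma>) a) = a"
  using act_mul[of "ginv G \<gamma>" \<gamma> a] act_mul[of \<gamma> "ginv G \<gamma>" a] assms by auto

section \<open>Families of stalk elements over a set of arrows\<close>

abbreviation sections_on :: "'g set \<Rightarrow> ('g \<Rightarrow> 'e) set"
  where "sections_on A \<equiv> \<Pi> \<gamma>\<in>A. carrier (R (gran G \<gamma>))"

text \<open>With A the isotropy group at x this is the carrier of \<open>B\<^sub>x\<close>, with A
  the source fibre that of \<open>\<L>\<^sub>x\<close>. Extensionality reduces equality to equality
  of values on A.\<close>

definition fin_sections :: "'g set \<Rightarrow> ('g \<Rightarrow> 'e) set"
  where "fin_sections A = {l \<in> \<Pi>\<^sub>E \<gamma>\<in>A. carrier (R (gran G \<gamma>)). finite {\<gamma> \<in> A. l \<gamma> \<noteq> \<zero>\<^bsub>R (gran G \<gamma>)\<^esub>}}"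

definition sec_zero :: "'g set \<Rightarrow> 'g \<Rightarrow> 'e"
  where "sec_zero A = (\<lambda>\<zeta>\<in>A. \<zero>\<^bsub>R (gran G \<zeta>)\<^esub>)"

definition sec_add :: "'g set \<Rightarrow> ('g \<Rightarrow> 'e) \<Rightarrow> ('g \<Rightarrow> 'e) \<Rightarrow> 'g \<Rightarrow> 'e"
  where "sec_add A f g = (\<lambda>\<zeta>\<in>A. f \<zeta> \<oplus>\<^bsub>R (gran G \<zeta>)\<^esub> g \<zeta>)"

definition single :: "'g set \<Rightarrow> 'g \<Rightarrow> 'e \<Rightarrow> 'g \<Rightarrow> 'e"
  where "single A \<gamma> a = (\<lambda>\<zeta>\<in>A. if \<zeta> = \<gamma> then a else \<zero>\<^bsub>R (gran G \<zeta>)\<^esub>)"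

lemma fin_sections_value [simp]:
  "l \<in> fin_sections A \<Longrightarrow> \<gamma> \<in> A \<Longrightarrow> l \<gamma> \<in> carrier (R (gran G \<gamma>))"
  by (auto simp: fin_sections_def)

lemma fin_sections_sections: "l \<in> fin_sections A \<Longrightarrow> l \<in> sections_on A"
  by auto

lemma fin_sections_finite: "l \<in> fin_sections A \<Longrightarrow> finite {\<gamma> \<in> A. l \<gamma> \<noteq> \<zero>\<^bsub>R (gran G \<gamma>)\<^esub>}"
  by (auto simp: fin_sections_def)

lemma fin_sections_ext:
  "l \<in> fin_sections A \<Longrightarrow> l' \<in> fin_sections A \<Longrightarrow> (\<And>\<gamma>. \<gamma> \<in> A \<Longrightarrow> l \<gamma> = l' \<gamma>) \<Longrightarrow> l = l'"
  by (auto simp: fin_sections_def intro: PiE_ext)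

lemma sum_group_fin_sections:
  assumes "A \<subseteq> arrows G"
  shows "carrier (sum_group A (\<lambda>\<gamma>. add_monoid (R (gran G \<gamma>)))) = fin_sections A"
  using assms R_group by (auto simp: carrier_sum_group fin_sections_def subset_iff)

lemma sec_zero_fin [simp]: "A \<subseteq> arrows G \<Longrightarrow> sec_zero A \<in> fin_sections A"
  by (auto simp: fin_sections_def sec_zero_def)

lemma sec_add_fin [simp]:
  assumes "A \<subseteq> arrows G" "f \<in> fin_sections A" "g \<in> fin_sections A"
  shows "sec_add A f g \<in> fin_sections A"
proof -
  have "{\<gamma> \<in> A. sec_add A f g \<gamma> \<noteq> \<zero>\<^bsub>R (gran G \<gamma>)\<^esub>} \<subseteq>
    {\<gamma> \<in> A. f \<gamma> \<noteq> \<zero>\<^bsub>R (gran G \<gamma>)\<^esub>} \<union> {\<gamma> \<in> A. g \<gamma> \<noteq> \<zero>\<^bsub>R (gran G \<gamma>)\<^esub>}"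
    using assms by (auto simp: sec_add_def subset_iff)
  then have "finite {\<gamma> \<in> A. sec_add A f g \<gamma> \<noteq> \<zero>\<^bsub>R (gran G \<gamma>)\<^esub>}"
    by (rule finite_subset) (use assms fin_sections_finite in auto)
  moreover have "sec_add A f g \<in> (\<Pi>\<^sub>E \<gamma>\<in>A. carrier (R (gran G \<gamma>)))"
    using assms by (auto simp: sec_add_def subset_iff)
  ultimately show ?thesis by (simp add: fin_sections_def)
qed

lemma single_fin [simp]:
  assumes "A \<subseteq> arrows G" "\<gamma> \<in> A" "a \<in> carrier (R (gran G \<gamma>))"
  shows "single A \<gamma> a \<in> fin_sections A"
proof -
  have "{\<zeta> \<in> A. single A \<gamma> a \<zeta> \<noteq> \<zero>\<^bsub>R (gran G \<zeta>)\<^esub>} \<subseteq> {\<gamma>}" by (auto simp: single_def)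
  then have "finite {\<zeta> \<in> A. single A \<gamma> a \<zeta> \<noteq> \<zero>\<^bsub>R (gran G \<zeta>)\<^esub>}" by (rule finite_subset) simp
  then show ?thesis using assms by (auto simp: fin_sections_def single_def)
qed

text \<open>A point of the support is split off at each step. The induction runs over a finite set
  containing the support, so that the remainder needs to satisfy only an inclusion. Statements
  additive in l thereby reduce to a single nonzero entry.\<close>

lemma fin_sections_induct [consumes 2, case_names zero single add]:
  assumes A: "A \<subseteq> arrows G" and l: "l \<in> fin_sections A"
    and zero: "P (sec_zero A)"
    and single: "\<And>\<gamma> a. \<gamma> \<in> A \<Longrightarrow> a \<in> carrier (R (gran G \<gamma>)) \<Longrightarrow> P (single A \<gamma> a)"
    and add: "\<And>f g. f \<in> fin_sections A \<Longrightarrow> g \<in> fin_sections A \<Longrightarrow> P f \<Longrightarrow> P g \<Longrightarrow> P (sec_add A f g)"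
  shows "P l"
proof -
  have "P l" if "finite F" "{\<gamma> \<in> A. l \<gamma> \<noteq> \<zero>\<^bsub>R (gran G \<gamma>)\<^esub>} \<subseteq> F" "l \<in> fin_sections A" for F l
    using that
  proof (induction F arbitrary: l)
    case empty
    then have "l = sec_zero A"
      using sec_zero_fin[OF A] by (intro fin_sections_ext) (auto simp: sec_zero_def)
    with zero show ?case by simp
  next
    case (insert \<gamma> F)
    show ?case
    proof (cases "\<gamma> \<in> A")
      case True
      \<comment> \<open>The family l with its entry at \<gamma> erased.\<close>
      define l' where "l' = (\<lambda>\<zeta>\<in>A. if \<zeta> = \<gamma> then \<zero>\<^bsub>R (gran G \<zeta>)\<^esub> else l \<zeta>)"
      have sub: "{\<zeta> \<in> A. l' \<zeta> \<noteq> \<zero>\<^bsub>R (gran G \<zeta>)\<^esub>} \<subseteq> F"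
        using insert.prems by (auto simp: l'_def)
      have l': "l' \<in> fin_sections A"
        using insert.prems(2) A finite_subset[OF sub insert.hyps(1)]
        by (auto simp: fin_sections_def l'_def)
      have "l = sec_add A (single A \<gamma> (l \<gamma>)) l'"
        using insert.prems(2) A True
        by (intro fin_sections_ext[OF _ sec_add_fin[OF A single_fin[OF A True] l']])
          (auto simp: sec_add_def single_def l'_def subset_iff)
      moreover have "P (sec_add A (single A \<gamma> (l \<gamma>)) l')"
        using insert.prems(2) A True l' insert.IH[OF sub l'] single by (intro add) auto
      ultimately show ?thesis by simp
    next
      case False
      with insert show ?thesis by auto
    qed
  qed
  with l fin_sections_finite show ?thesis by blast
qed

section \<open>Convolution as a sum over the right factor\<close>

definition conv_term :: "('g \<Rightarrow> 'e) \<Rightarrow> ('g \<Rightarrow> 'e) \<Rightarrow> 'g \<Rightarrow> 'g \<Rightarrow> 'e"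
  where "conv_term f g \<zeta> \<rho> =
    f (gmul G \<zeta> (ginv G \<rho>)) \<otimes>\<^bsub>R (gran G \<zeta>)\<^esub> act \<O> (gmul G \<zeta> (ginv G \<rho>)) (g \<rho>)"

lemma conv_term_closed:
  assumes "\<zeta> \<in> arrows G" "\<rho> \<in> arrows G" "gdom G \<rho> = gdom G \<zeta>"
    "gmul G \<zeta> (ginv G \<rho>) \<in> A" "f \<in> sections_on A" "g \<rho> \<in> carrier (R (gran G \<rho>))"
  shows "conv_term f g \<zeta> \<rho> \<in> carrier (R (gran G \<zeta>))"
proof -
  have "f (gmul G \<zeta> (ginv G \<rho>)) \<in> carrier (R (gran G \<zeta>))"
    using PiE_mem assms funcset_mem[of f A] by (force simp: Pi_iff)
  moreover have "act \<O> (gmul G \<zeta> (ginv G \<rho>)) (g \<rho>) \<in> carrier (R (gran G \<zeta>))"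
    using act_in_carrier[of "gmul G \<zeta> (ginv G \<rho>)" "g \<rho>"] assms by simp
  ultimately show ?thesis using assms by (simp add: conv_term_def)
qed

text \<open>Sending \<rho> to the pair of \<open>\<zeta>\<rho>\<^sup>-\<^sup>1\<close> and \<rho> is
  a bijection onto the factorizations of \<zeta>; the fourth assumption keeps the left factor in
  A.\<close>

lemma convolution_eq:
  assumes \<zeta>: "\<zeta> \<in> arrows G" and AB: "A \<subseteq> arrows G" "B \<subseteq> arrows G"
    and "\<And>\<rho>. \<rho> \<in> B \<Longrightarrow> gdom G \<rho> = gdom G \<zeta> \<Longrightarrow> gmul G \<zeta> (ginv G \<rho>) \<in> A"
    and "f \<in> sections_on A" "g \<in> sections_on B"
  shows "convolution G \<O> A B f g \<zeta> =
    gfinsum (R (gran G \<zeta>)) (conv_term f g \<zeta>) {\<rho> \<in> B. gdom G \<rho> = gdom G \<zeta>}"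
proof -
  interpret C: comm_monoid "add_monoid (R (gran G \<zeta>))" using R_comm_monoid \<zeta> by simp
  let ?h = "\<lambda>\<rho>. (gmul G \<zeta> (ginv G \<rho>), \<rho>)" and ?B = "{\<rho> \<in> B. gdom G \<rho> = gdom G \<zeta>}"
  have eq: "{(\<beta>, \<rho>) \<in> composable G. \<beta> \<in> A \<and> \<rho> \<in> B \<and> gmul G \<beta> \<rho> = \<zeta>} = ?h ` ?B"
    using assms by (auto simp: composable_def image_iff subset_iff right_translate_eq_iff)
  have "conv_term f g \<zeta> \<in> ?B \<rightarrow> carrier (R (gran G \<zeta>))"
    using assms by (auto intro!: conv_term_closed[where A = A])
  then show ?thesis
    unfolding convolution_def eq
    by (subst C.gfinprod_reindex) (auto simp: inj_on_def conv_term_def[abs_def])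
qed

text \<open>Under this condition each \<rho> in B is the right factor of exactly one factorization
  of each \<zeta> in D, and the left factor lies in A, so the sum at \<zeta> runs over all of B. The
  product of \<open>B\<^sub>x\<close> and the two actions on \<open>\<L>\<^sub>x\<close> fit; that
  of \<open>\<Gamma>\<^sub>c\<close>, whose arrows have varying domains, is treated
  separately.\<close>

definition translates :: "'g set \<Rightarrow> 'g set \<Rightarrow> 'g set \<Rightarrow> bool"
  where "translates A B D \<longleftrightarrow> A \<subseteq> arrows G \<and> B \<subseteq> arrows G \<and> D \<subseteq> arrows G \<and>
    (\<forall>\<zeta>\<in>D. \<forall>\<rho>\<in>B. gdom G \<rho> = gdom G \<zeta> \<and> gmul G \<zeta> (ginv G \<rho>) \<in> A)"

lemma translates_left: "translates (arrows G) (source_fibre G x) (source_fibre G x)"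
  and translates_right: "translates (source_fibre G x) (isotropy G x) (source_fibre G x)"
  and translates_isotropy: "translates (isotropy G x) (isotropy G x) (isotropy G x)"
  by (auto simp: translates_def source_fibre_iff isotropy_iff)

definition conv :: "'g set \<Rightarrow> 'g set \<Rightarrow> 'g set \<Rightarrow> ('g \<Rightarrow> 'e) \<Rightarrow> ('g \<Rightarrow> 'e) \<Rightarrow> 'g \<Rightarrow> 'e"
  where "conv A B D f g = (\<lambda>\<zeta>\<in>D. convolution G \<O> A B f g \<zeta>)"

context
  fixes A B D assumes ABD: "translates A B D"
begin

lemma translatesD:
  "\<rho> \<in> B \<Longrightarrow> \<rho> \<in> arrows G"
  "\<zeta> \<in> D \<Longrightarrow> \<zeta> \<in> arrows G"
  "\<zeta> \<in> D \<Longrightarrow> \<rho> \<in> B \<Longrightarrow> gmul G \<zeta> (ginv G \<rho>) \<in> A"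
  "\<zeta> \<in> D \<Longrightarrow> \<rho> \<in> B \<Longrightarrow> gdom G \<rho> = gdom G \<zeta>"
  "A \<subseteq> arrows G" "B \<subseteq> arrows G" "D \<subseteq> arrows G"
  using ABD by (auto simp: translates_def)

lemma conv_value:
  assumes "\<zeta> \<in> D" "f \<in> sections_on A" "g \<in> sections_on B"
  shows "conv A B D f g \<zeta> = gfinsum (R (gran G \<zeta>)) (conv_term f g \<zeta>) B"
proof -
  have "{\<rho> \<in> B. gdom G \<rho> = gdom G \<zeta>} = B" using translatesD(4) assms(1) by auto
  with assms translatesD show ?thesis by (simp add: conv_def convolution_eq)
qed

lemma conv_term_funcset:
  assumes "\<zeta> \<in> D" "f \<in> sections_on A" "g \<in> sections_on B"
  shows "conv_term f g \<zeta> \<in> B \<rightarrow> carrier (R (gran G \<zeta>))"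
  using assms translatesD by (auto intro!: conv_term_closed[where A = A])

text \<open>Sheaf maps send zero to zero, so a summand is nonzero only where g is. The left factor
  may thus have infinite support, as elements of \<open>\<Gamma>\<^sub>c\<close> do.\<close>

lemma conv_term_finite:
  assumes "\<zeta> \<in> D" "f \<in> sections_on A" "g \<in> fin_sections B"
  shows "finite {\<rho> \<in> B. conv_term f g \<zeta> \<rho> \<noteq> \<zero>\<^bsub>R (gran G \<zeta>)\<^esub>}"
proof (rule finite_subset[OF _ fin_sections_finite[OF assms(3)]])
  have "conv_term f g \<zeta> \<rho> = \<zero>\<^bsub>R (gran G \<zeta>)\<^esub>" if "\<rho> \<in> B" "g \<rho> = \<zero>\<^bsub>R (gran G \<rho>)\<^esub>" for \<rho>
  proof -
    have "f (gmul G \<zeta> (ginv G \<rho>)) \<in> carrier (R (gran G \<zeta>))"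
      using \<open>\<rho> \<in> B\<close> translatesD assms by (force simp: Pi_iff)
    moreover have "act \<O> (gmul G \<zeta> (ginv G \<rho>)) \<zero>\<^bsub>R (gran G \<rho>)\<^esub> = \<zero>\<^bsub>R (gran G \<zeta>)\<^esub>"
      using act_zero[of "gmul G \<zeta> (ginv G \<rho>)"] \<open>\<rho> \<in> B\<close> translatesD assms(1) by simp
    ultimately show ?thesis using that translatesD assms(1) by (simp add: conv_term_def)
  qed
  then show "{\<rho> \<in> B. conv_term f g \<zeta> \<rho> \<noteq> \<zero>\<^bsub>R (gran G \<zeta>)\<^esub>} \<subseteq> {\<rho> \<in> B. g \<rho> \<noteq> \<zero>\<^bsub>R (gran G \<rho>)\<^esub>}"
    by auto
qed

lemma conv_closed:
  assumes "\<zeta> \<in> D" "f \<in> sections_on A" "g \<in> sections_on B"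
  shows "conv A B D f g \<zeta> \<in> carrier (R (gran G \<zeta>))"
proof -
  interpret C: comm_monoid "add_monoid (R (gran G \<zeta>))" using R_comm_monoid translatesD assms by simp
  show ?thesis using conv_value[OF assms] C.gfinprod_closed[of "conv_term f g \<zeta>" B] conv_term_funcset[OF assms]
    by simp
qed

lemma conv_sections: "f \<in> sections_on A \<Longrightarrow> g \<in> sections_on B \<Longrightarrow> conv A B D f g \<in> sections_on D"
  using conv_closed by auto

lemma conv_add_right:
  assumes "f \<in> sections_on A" "g \<in> fin_sections B" "g' \<in> fin_sections B"
  shows "conv A B D f (sec_add B g g') = sec_add D (conv A B D f g) (conv A B D f g')"
proof -
  have "conv A B D f (sec_add B g g') \<zeta> = conv A B D f g \<zeta> \<oplus>\<^bsub>R (gran G \<zeta>)\<^esub> conv A B D f g' \<zeta>"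
    if \<zeta>: "\<zeta> \<in> D" for \<zeta>
  proof -
    interpret C: comm_monoid "add_monoid (R (gran G \<zeta>))" using R_comm_monoid translatesD \<zeta> by simp
    have t: "conv_term f (sec_add B g g') \<zeta> \<rho> = conv_term f g \<zeta> \<rho> \<oplus>\<^bsub>R (gran G \<zeta>)\<^esub> conv_term f g' \<zeta> \<rho>"
      if \<rho>: "\<rho> \<in> B" for \<rho>
    proof -
      have *: "f (gmul G \<zeta> (ginv G \<rho>)) \<in> carrier (R (gran G \<zeta>))"
        using \<rho> \<zeta> translatesD assms by (force simp: Pi_iff)
      show ?thesis
        using \<rho> \<zeta> translatesD assms * act_add[of "gmul G \<zeta> (ginv G \<rho>)" "g \<rho>" "g' \<rho>"]
          act_in_carrier[of "gmul G \<zeta> (ginv G \<rho>)"]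
        by (simp add: conv_term_def sec_add_def R_laws)
    qed
    have "gfinsum (R (gran G \<zeta>)) (conv_term f (sec_add B g g') \<zeta>) B =
      gfinsum (R (gran G \<zeta>)) (\<lambda>\<rho>. conv_term f g \<zeta> \<rho> \<oplus>\<^bsub>R (gran G \<zeta>)\<^esub> conv_term f g' \<zeta> \<rho>) B"
      using t conv_term_funcset[OF \<zeta>] assms translatesD \<zeta>
      by (intro C.gfinprod_cong) (auto simp: Pi_iff)
    also have "\<dots> = gfinsum (R (gran G \<zeta>)) (conv_term f g \<zeta>) B \<oplus>\<^bsub>R (gran G \<zeta>)\<^esub> gfinsum (R (gran G \<zeta>)) (conv_term f g' \<zeta>) B"
      using C.gfinprod_distrib[of B "conv_term f g \<zeta>" "conv_term f g' \<zeta>"]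
        conv_term_funcset[OF \<zeta>] conv_term_finite[OF \<zeta>] assms by (simp add: fin_sections_sections)
    finally show ?thesis using \<zeta> assms translatesD by (simp add: conv_value fin_sections_sections)
  qed
  then show ?thesis by (auto simp: sec_add_def conv_def)
qed

lemma conv_add_left:
  assumes "f \<in> sections_on A" "f' \<in> sections_on A" "g \<in> fin_sections B"
  shows "conv A B D (sec_add A f f') g = sec_add D (conv A B D f g) (conv A B D f' g)"
proof -
  have ff: "sec_add A f f' \<in> sections_on A"
    using assms translatesD by (auto simp: sec_add_def Pi_iff subset_iff)
  have "conv A B D (sec_add A f f') g \<zeta> = conv A B D f g \<zeta> \<oplus>\<^bsub>R (gran G \<zeta>)\<^esub> conv A B D f' g \<zeta>"
    if \<zeta>: "\<zeta> \<in> D" for \<zeta>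
  proof -
    interpret C: comm_monoid "add_monoid (R (gran G \<zeta>))" using R_comm_monoid translatesD \<zeta> by simp
    have t: "conv_term (sec_add A f f') g \<zeta> \<rho> = conv_term f g \<zeta> \<rho> \<oplus>\<^bsub>R (gran G \<zeta>)\<^esub> conv_term f' g \<zeta> \<rho>"
      if \<rho>: "\<rho> \<in> B" for \<rho>
    proof -
      have *: "f (gmul G \<zeta> (ginv G \<rho>)) \<in> carrier (R (gran G \<zeta>))" "f' (gmul G \<zeta> (ginv G \<rho>)) \<in> carrier (R (gran G \<zeta>))"
        using \<rho> \<zeta> translatesD assms by (force simp: Pi_iff)+
      show ?thesis
        using \<rho> \<zeta> translatesD assms *
          act_in_carrier[of "gmul G \<zeta> (ginv G \<rho>)"]
        by (simp add: conv_term_def sec_add_def R_laws)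
    qed
    have "gfinsum (R (gran G \<zeta>)) (conv_term (sec_add A f f') g \<zeta>) B =
      gfinsum (R (gran G \<zeta>)) (\<lambda>\<rho>. conv_term f g \<zeta> \<rho> \<oplus>\<^bsub>R (gran G \<zeta>)\<^esub> conv_term f' g \<zeta> \<rho>) B"
      using t conv_term_funcset[OF \<zeta>] assms translatesD \<zeta>
      by (intro C.gfinprod_cong) (auto simp: Pi_iff)
    also have "\<dots> = gfinsum (R (gran G \<zeta>)) (conv_term f g \<zeta>) B \<oplus>\<^bsub>R (gran G \<zeta>)\<^esub> gfinsum (R (gran G \<zeta>)) (conv_term f' g \<zeta>) B"
      using C.gfinprod_distrib[of B "conv_term f g \<zeta>" "conv_term f' g \<zeta>"]
        conv_term_funcset[OF \<zeta>] conv_term_finite[OF \<zeta>] assms by (simp add: fin_sections_sections)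
    finally show ?thesis using \<zeta> assms translatesD ff by (simp add: conv_value fin_sections_sections)
  qed
  then show ?thesis by (auto simp: sec_add_def conv_def)
qed

lemma conv_eq_term:
  assumes "\<zeta> \<in> D" "f \<in> sections_on A" "g \<in> sections_on B" "\<gamma> \<in> B"
    and "\<And>\<rho>. \<rho> \<in> B \<Longrightarrow> \<rho> \<noteq> \<gamma> \<Longrightarrow> conv_term f g \<zeta> \<rho> = \<zero>\<^bsub>R (gran G \<zeta>)\<^esub>"
  shows "conv A B D f g \<zeta> = conv_term f g \<zeta> \<gamma>"
proof -
  interpret C: comm_monoid "add_monoid (R (gran G \<zeta>))" using R_comm_monoid translatesD assms by simp
  show ?thesis
    using C.gfinprod_singleton[of \<gamma> B "conv_term f g \<zeta>"] conv_value[OF assms(1-3)]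
      conv_term_funcset[OF assms(1-3)] assms by auto
qed

lemma conv_single:
  assumes "\<zeta> \<in> D" "f \<in> sections_on A" "\<gamma> \<in> B" "a \<in> carrier (R (gran G \<gamma>))"
  shows "conv A B D f (single B \<gamma> a) \<zeta> =
    f (gmul G \<zeta> (ginv G \<gamma>)) \<otimes>\<^bsub>R (gran G \<zeta>)\<^esub> act \<O> (gmul G \<zeta> (ginv G \<gamma>)) a"
proof -
  have "conv_term f (single B \<gamma> a) \<zeta> \<rho> = \<zero>\<^bsub>R (gran G \<zeta>)\<^esub>" if "\<rho> \<in> B" "\<rho> \<noteq> \<gamma>" for \<rho>
  proof -
    have "f (gmul G \<zeta> (ginv G \<rho>)) \<in> carrier (R (gran G \<zeta>))"
      using that translatesD assms by (force simp: Pi_iff)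
    moreover have "act \<O> (gmul G \<zeta> (ginv G \<rho>)) \<zero>\<^bsub>R (gran G \<rho>)\<^esub> = \<zero>\<^bsub>R (gran G \<zeta>)\<^esub>"
      using act_zero[of "gmul G \<zeta> (ginv G \<rho>)"] that translatesD assms(1) by simp
    ultimately show ?thesis
      using that translatesD assms(1) by (simp add: conv_term_def single_def)
  qed
  then have "conv A B D f (single B \<gamma> a) \<zeta> = conv_term f (single B \<gamma> a) \<zeta> \<gamma>"
    using assms translatesD by (intro conv_eq_term) (auto simp: single_def)
  also have "\<dots> = f (gmul G \<zeta> (ginv G \<gamma>)) \<otimes>\<^bsub>R (gran G \<zeta>)\<^esub> act \<O> (gmul G \<zeta> (ginv G \<gamma>)) a"
    using assms(3) by (simp add: conv_term_def single_def)
  finally show ?thesis .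
qed

lemma conv_zero_right:
  assumes "f \<in> sections_on A"
  shows "conv A B D f (sec_zero B) = sec_zero D"
proof -
  have "conv A B D f (sec_zero B) \<zeta> = \<zero>\<^bsub>R (gran G \<zeta>)\<^esub>" if \<zeta>: "\<zeta> \<in> D" for \<zeta>
  proof -
    interpret C: comm_monoid "add_monoid (R (gran G \<zeta>))" using R_comm_monoid translatesD \<zeta> by simp
    have "conv_term f (sec_zero B) \<zeta> \<rho> = \<zero>\<^bsub>R (gran G \<zeta>)\<^esub>" if "\<rho> \<in> B" for \<rho>
    proof -
      have "f (gmul G \<zeta> (ginv G \<rho>)) \<in> carrier (R (gran G \<zeta>))"
        using that \<zeta> translatesD assms by (force simp: Pi_iff)
      moreover have "act \<O> (gmul G \<zeta> (ginv G \<rho>)) \<zero>\<^bsub>R (gran G \<rho>)\<^esub> = \<zero>\<^bsub>R (gran G \<zeta>)\<^esub>"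
        using act_zero[of "gmul G \<zeta> (ginv G \<rho>)"] that translatesD \<zeta> by simp
      ultimately show ?thesis
        using that translatesD \<zeta> by (simp add: conv_term_def sec_zero_def)
    qed
    then show ?thesis
      using C.gfinprod_one[of B "conv_term f (sec_zero B) \<zeta>"] \<zeta> assms translatesD
      by (subst conv_value) (auto simp: sec_zero_def)
  qed
  then show ?thesis by (auto simp: sec_zero_def conv_def)
qed

lemma conv_zero_left:
  assumes "g \<in> sections_on B"
  shows "conv A B D (sec_zero A) g = sec_zero D"
proof -
  have "conv A B D (sec_zero A) g \<zeta> = \<zero>\<^bsub>R (gran G \<zeta>)\<^esub>" if \<zeta>: "\<zeta> \<in> D" for \<zeta>
  proof -
    interpret C: comm_monoid "add_monoid (R (gran G \<zeta>))" using R_comm_monoid translatesD \<zeta> by simp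
    have "conv_term (sec_zero A) g \<zeta> \<rho> = \<zero>\<^bsub>R (gran G \<zeta>)\<^esub>" if "\<rho> \<in> B" for \<rho>
      using that translatesD \<zeta> assms act_in_carrier[of "gmul G \<zeta> (ginv G \<rho>)" "g \<rho>"]
      by (auto simp add: conv_term_def sec_zero_def Pi_iff)
    then show ?thesis
      using C.gfinprod_one[of B "conv_term (sec_zero A) g \<zeta>"] \<zeta> assms translatesD
      by (subst conv_value) (auto simp: sec_zero_def)
  qed
  then show ?thesis by (auto simp: sec_zero_def conv_def)
qed

text \<open>By additivity g may be taken with one entry, at \<gamma>. The product is then nonzero
  only at arrows \<beta>\<gamma> with f nonzero at \<beta> and the domain of \<beta> equal to the
  range of \<gamma>, and the last assumption leaves finitely many. This makes
  \<open>\<L>\<^sub>x\<close> stable under \<open>\<Gamma>\<^sub>c\<close>.\<close>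

lemma conv_fin:
  assumes f: "f \<in> sections_on A" and g: "g \<in> fin_sections B"
    and fin: "\<And>y. y \<in> units G \<Longrightarrow> finite {\<beta> \<in> A. gdom G \<beta> = y \<and> f \<beta> \<noteq> \<zero>\<^bsub>R (gran G \<beta>)\<^esub>}"
  shows "conv A B D f g \<in> fin_sections D"
  using translatesD(6) g
proof (induction rule: fin_sections_induct)
  case zero
  then show ?case using f translatesD by (simp add: conv_zero_right)
next
  case (single \<gamma> a)
  let ?F = "{\<beta> \<in> A. gdom G \<beta> = gran G \<gamma> \<and> f \<beta> \<noteq> \<zero>\<^bsub>R (gran G \<beta>)\<^esub>}"
  have "{\<zeta> \<in> D. conv A B D f (single B \<gamma> a) \<zeta> \<noteq> \<zero>\<^bsub>R (gran G \<zeta>)\<^esub>} \<subseteq> (\<lambda>\<beta>. gmul G \<beta> \<gamma>) ` ?F"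
  proof safe
    fix \<zeta> assume \<zeta>: "\<zeta> \<in> D" "conv A B D f (single B \<gamma> a) \<zeta> \<noteq> \<zero>\<^bsub>R (gran G \<zeta>)\<^esub>"
    then have "f (gmul G \<zeta> (ginv G \<gamma>)) \<noteq> \<zero>\<^bsub>R (gran G \<zeta>)\<^esub>"
      using single f translatesD act_in_carrier[of "gmul G \<zeta> (ginv G \<gamma>)" a] by (auto simp: conv_single)
    then show "\<zeta> \<in> (\<lambda>\<beta>. gmul G \<beta> \<gamma>) ` ?F"
      using \<zeta> single translatesD by (intro image_eqI[where x = "gmul G \<zeta> (ginv G \<gamma>)"]) auto
  qed
  then have "finite {\<zeta> \<in> D. conv A B D f (single B \<gamma> a) \<zeta> \<noteq> \<zero>\<^bsub>R (gran G \<zeta>)\<^esub>}"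
    by (rule finite_subset) (use single translatesD fin in auto)
  moreover have "conv A B D f (single B \<gamma> a) \<in> (\<Pi>\<^sub>E \<zeta>\<in>D. carrier (R (gran G \<zeta>)))"
    using conv_closed[OF _ f] single translatesD by (auto simp: conv_def single_def)
  ultimately show ?case by (simp add: fin_sections_def)
next
  case (add g g')
  then show ?case using f translatesD by (simp add: conv_add_right)
qed

end

end

section \<open>Skew group rings and the bimodules \<open>\<L>\<^sub>x\<close>\<close>

context ring_sheaf
begin

lemma conv_all_zero:
  assumes "translates A B D" "\<zeta> \<in> D" "f \<in> sections_on A" "g \<in> sections_on B"
    and "\<And>\<rho>. \<rho> \<in> B \<Longrightarrow> conv_term f g \<zeta> \<rho> = \<zero>\<^bsub>R (gran G \<zeta>)\<^esub>"
  shows "conv A B D f g \<zeta> = \<zero>\<^bsub>R (gran G \<zeta>)\<^esub>"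
proof -
  interpret C: comm_monoid "add_monoid (R (gran G \<zeta>))" using R_comm_monoid translatesD(2)[OF assms(1,2)] by simp
  show ?thesis
    using C.gfinprod_one[of B "conv_term f g \<zeta>"] conv_value[OF assms(1-4)] assms by simp
qed

lemma conv_fin_fin:
  assumes t: "translates A B D" and f: "f \<in> fin_sections A" and g: "g \<in> fin_sections B"
  shows "conv A B D f g \<in> fin_sections D"
  using t fin_sections_sections[OF f] g
  by (rule conv_fin) (rule finite_subset[OF _ fin_sections_finite[OF f]], auto)

context
  fixes x assumes x: "x \<in> units G"
begin

abbreviation "Iso \<equiv> isotropy G x"
abbreviation "SF \<equiv> source_fibre G x"

lemma Iso_arrows: "Iso \<subseteq> arrows G" and SF_arrows: "SF \<subseteq> arrows G"
  and unit_Iso: "x \<in> Iso" and unit_SF: "x \<in> SF"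
  using x unit_in_arrows by (auto simp: isotropy_iff source_fibre_iff)

lemma conv_single_single:
  assumes t: "translates B Iso B" and B: "\<gamma> \<in> B" "gdom G \<gamma> = x" "\<delta> \<in> Iso" "gmul G \<gamma> \<delta> \<in> B"
    and ab: "a \<in> carrier (R (gran G \<gamma>))" "b \<in> carrier (R x)"
  shows "conv B Iso B (single B \<gamma> a) (single Iso \<delta> b) =
    single B (gmul G \<gamma> \<delta>) (a \<otimes>\<^bsub>R (gran G \<gamma>)\<^esub> act \<O> \<gamma> b)" (is "?l = ?r")
proof (rule fin_sections_ext[of _ B])
  note tD = translatesD(1,2,3,5,6,7)[OF t]
  have \<gamma>: "\<gamma> \<in> arrows G" "\<delta> \<in> arrows G" "gran G \<delta> = x" "gdom G \<delta> = x"
    using B tD by (auto simp: isotropy_iff)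
  have act: "act \<O> \<gamma> b \<in> carrier (R (gran G \<gamma>))" using act_in_carrier[of \<gamma> b] \<gamma> ab B by simp
  show "?l \<in> fin_sections B"
    using t by (rule conv_fin_fin) (use \<gamma> B ab tD in auto)
  show "?r \<in> fin_sections B"
    using \<gamma> B ab tD act by (intro single_fin) auto
  fix \<zeta> assume \<zeta>: "\<zeta> \<in> B"
  then have \<zeta>': "\<zeta> \<in> arrows G" "gdom G \<zeta> = x" "gmul G \<zeta> (ginv G \<delta>) \<in> B"
    using tD(2)[OF \<zeta>] tD(3)[OF \<zeta> B(3)] translatesD(4)[OF t \<zeta> B(3)] \<gamma> by simp_all
  have "?l \<zeta> = single B \<gamma> a (gmul G \<zeta> (ginv G \<delta>)) \<otimes>\<^bsub>R (gran G \<zeta>)\<^esub> act \<O> (gmul G \<zeta> (ginv G \<delta>)) b"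
    using conv_single[OF t \<zeta> _ B(3), of "single B \<gamma> a" b] B ab \<gamma> tD by (auto simp: single_def)
  also have "\<dots> = ?r \<zeta>"
    using \<zeta> \<zeta>' \<gamma> B ab act right_translate_eq_iff[of \<gamma> \<delta> \<zeta>] act_in_carrier[of "gmul G \<zeta> (ginv G \<delta>)" b]
    by (auto simp: single_def)
  finally show "?l \<zeta> = ?r \<zeta>" .
qed

text \<open>Both sides are additive in g and in h, so each of these may be taken with one entry; f
  stays arbitrary, since at each \<zeta> just one of its values then enters. Taking B to be the
  isotropy group gives associativity of \<open>B\<^sub>x\<close>; the source fibre, with A all
  arrows, gives the bimodule law of \<open>\<L>\<^sub>x\<close>.\<close>

lemma conv_assoc:
  assumes tA: "translates A B B" and tB: "translates B Iso B"
    and B: "\<And>\<gamma>. \<gamma> \<in> B \<Longrightarrow> gdom G \<gamma> = x" "\<And>\<gamma> \<delta>. \<gamma> \<in> B \<Longrightarrow> \<delta> \<in> Iso \<Longrightarrow> gmul G \<gamma> \<delta> \<in> B"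
    and f: "f \<in> sections_on A" and g: "g \<in> fin_sections B" and h: "h \<in> fin_sections Iso"
  shows "conv A B B f (conv B Iso B g h) = conv B Iso B (conv A B B f g) h"
proof -
  note tD = translatesD(1,2,3,5,6,7)[OF tB]
  note [simp] = conv_zero_left conv_zero_right conv_add_left conv_add_right conv_fin_fin tA tB f
    fin_sections_sections tD(5,6)
  have fg: "conv A B B f g \<in> sections_on B" if "g \<in> fin_sections B" for g
    using conv_sections[OF tA f fin_sections_sections[OF that]] .
  note [simp] = fg
  show ?thesis
    using tD(5) h
  proof (induction rule: fin_sections_induct)
    case (single \<delta> b)
    then have \<delta>: "\<delta> \<in> arrows G" "gran G \<delta> = x" "gdom G \<delta> = x" "b \<in> carrier (R x)" by (auto simp: isotropy_iff)
    note hs = single_fin[OF Iso_arrows single]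
    show ?case using tD(6) g
    proof (induction rule: fin_sections_induct)
      case zero then show ?case using hs by simp
    next
      case s: (single \<gamma> a)
      then have \<gamma>: "\<gamma> \<in> arrows G" "gdom G \<gamma> = x" "gmul G \<gamma> \<delta> \<in> B" using B tD single by auto
      have c: "a \<otimes>\<^bsub>R (gran G \<gamma>)\<^esub> act \<O> \<gamma> b \<in> carrier (R (gran G \<gamma>))"
        using s \<delta> \<gamma> act_in_carrier[of \<gamma> b] by simp
      note gs = single_fin[OF tD(6) s]
      show ?case
      proof
        fix \<zeta>
        show "conv A B B f (conv B Iso B (single B \<gamma> a) (single Iso \<delta> b)) \<zeta> =
          conv B Iso B (conv A B B f (single B \<gamma> a)) (single Iso \<delta> b) \<zeta>"
        proof (cases "\<zeta> \<in> B")
          case True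
          then have \<zeta>: "\<zeta> \<in> arrows G" "gdom G \<zeta> = x" "gmul G \<zeta> (ginv G \<delta>) \<in> B"
            using tD(2,3)[OF True] single B by auto
          \<comment> \<open>The solution \<beta> of \<beta>\<gamma>\<delta> = \<zeta>, the only
            arrow at which f is evaluated. Both sides become
            \<open>f(\<beta>) \<alpha>\<^sub>\<beta>(a)\<close> times the image of b under the arrow
            \<beta>\<gamma>.\<close>
          let ?\<beta> = "gmul G (gmul G \<zeta> (ginv G \<delta>)) (ginv G \<gamma>)"
          have \<beta>: "?\<beta> \<in> A" using translatesD(3)[OF tA \<zeta>(3) s(1)] .
          have \<beta>': "?\<beta> \<in> arrows G" "gran G ?\<beta> = gran G \<zeta>" "gdom G ?\<beta> = gran G \<gamma>"
            using \<zeta> \<gamma> \<delta> by auto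
          have eq: "gmul G \<zeta> (ginv G (gmul G \<gamma> \<delta>)) = ?\<beta>"
            using \<zeta> \<gamma> \<delta> gmul_assoc[of \<zeta> "ginv G \<delta>" "ginv G \<gamma>"] by (simp add: inv_gmul)
          have eq': "gmul G ?\<beta> \<gamma> = gmul G \<zeta> (ginv G \<delta>)"
            using \<zeta> \<gamma> \<delta> by simp
          have fb: "f ?\<beta> \<in> carrier (R (gran G \<zeta>))" using f \<beta> \<beta>' by (force simp: Pi_iff)
          have ab: "act \<O> \<gamma> b \<in> carrier (R (gran G \<gamma>))" using \<delta> \<gamma> act_in_carrier[of \<gamma> b] by simp
          have "conv A B B f (conv B Iso B (single B \<gamma> a) (single Iso \<delta> b)) \<zeta> =
            conv A B B f (single B (gmul G \<gamma> \<delta>) (a \<otimes>\<^bsub>R (gran G \<gamma>)\<^esub> act \<O> \<gamma> b)) \<zeta>"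
            using conv_single_single[OF tB s(1) \<gamma>(2) single(1) \<gamma>(3) s(2)] \<delta> by simp
          also have "\<dots> = f ?\<beta> \<otimes>\<^bsub>R (gran G \<zeta>)\<^esub> act \<O> ?\<beta> (a \<otimes>\<^bsub>R (gran G \<gamma>)\<^esub> act \<O> \<gamma> b)"
            using conv_single[OF tA True f \<gamma>(3)] c eq \<gamma> \<delta> by simp
          also have "\<dots> = (f ?\<beta> \<otimes>\<^bsub>R (gran G \<zeta>)\<^esub> act \<O> ?\<beta> a) \<otimes>\<^bsub>R (gran G \<zeta>)\<^esub> act \<O> (gmul G \<zeta> (ginv G \<delta>)) b"
            using act_mult[OF \<beta>'(1), of a "act \<O> \<gamma> b"] act_mul[of ?\<beta> \<gamma> b] \<beta>' eq' ab fb s(2) \<gamma> \<delta> \<zeta>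
              act_in_carrier[OF \<beta>'(1), of a] act_in_carrier[OF \<beta>'(1), of "act \<O> \<gamma> b"]
            by (simp add: R_laws)
          also have "\<dots> = conv B Iso B (conv A B B f (single B \<gamma> a)) (single Iso \<delta> b) \<zeta>"
            using conv_single[OF tA \<zeta>(3) f s(1,2)]
              conv_single[OF tB True fg[OF gs] single] \<zeta> \<delta> \<gamma> by simp
          finally show ?thesis .
        qed (simp add: conv_def)
      qed
    next
      case (add g g') then show ?case using hs by simp
    qed
  qed (use g in simp_all)
qed

section \<open>The skew group ring\<close>

lemma skew_sum_group_eq:
  "skew_sum_group G \<O> x = sum_group Iso (\<lambda>\<delta>. add_monoid (R (gran G \<delta>)))"
proof -
  have "product_group Iso (\<lambda>\<delta>. add_monoid (R x)) = product_group Iso (\<lambda>\<delta>. add_monoid (R (gran G \<delta>)))"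
    unfolding product_group_def
    by (auto simp: isotropy_iff fun_eq_iff restrict_def intro!: PiE_cong)
  moreover have "{l \<in> \<Pi>\<^sub>E \<delta>\<in>Iso. carrier (add_monoid (R x)). finite {\<delta> \<in> Iso. l \<delta> \<noteq> \<one>\<^bsub>add_monoid (R x)\<^esub>}} =
    {l \<in> \<Pi>\<^sub>E \<delta>\<in>Iso. carrier (add_monoid (R (gran G \<delta>))). finite {\<delta> \<in> Iso. l \<delta> \<noteq> \<one>\<^bsub>add_monoid (R (gran G \<delta>))\<^esub>}}"
    by (intro Collect_cong conj_cong arg_cong[where f = finite])
      (auto simp: isotropy_iff PiE_iff)
  ultimately show ?thesis unfolding skew_sum_group_def sum_group_def by simp
qed

abbreviation "Bx \<equiv> skew_group_ring G \<O> x"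

lemma Bx_simps:
  "carrier Bx = fin_sections Iso" "\<zero>\<^bsub>Bx\<^esub> = sec_zero Iso" "b \<oplus>\<^bsub>Bx\<^esub> c = sec_add Iso b c"
  "b \<otimes>\<^bsub>Bx\<^esub> c = conv Iso Iso Iso b c" "\<one>\<^bsub>Bx\<^esub> = single Iso x \<one>\<^bsub>R x\<^esub>"
  unfolding skew_group_ring_def skew_sum_group_eq
  by (simp_all add: sum_group_fin_sections[OF Iso_arrows, simplified] sec_zero_def sec_add_def conv_def)
    (auto simp: single_def isotropy_iff fun_eq_iff restrict_def)

lemma Bx_ring: "ring Bx"
proof (rule ringI)
  interpret S: group "sum_group Iso (\<lambda>\<delta>. add_monoid (R (gran G \<delta>)))"
    using Iso_arrows R_group by (intro sum_group) auto
  note S.m_assoc[simp] S.l_inv_ex[simp]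
  show "abelian_group Bx"
  proof (rule abelian_groupI)
    fix b assume b: "b \<in> carrier Bx"
    then obtain c where "c \<in> carrier (sum_group Iso (\<lambda>\<delta>. add_monoid (R (gran G \<delta>))))"
      "c \<otimes>\<^bsub>sum_group Iso (\<lambda>\<delta>. add_monoid (R (gran G \<delta>)))\<^esub> b = \<one>\<^bsub>sum_group Iso (\<lambda>\<delta>. add_monoid (R (gran G \<delta>)))\<^esub>"
      using S.l_inv_ex[of b] by (auto simp: Bx_simps sum_group_fin_sections[OF Iso_arrows, simplified])
    then show "\<exists>c\<in>carrier Bx. c \<oplus>\<^bsub>Bx\<^esub> b = \<zero>\<^bsub>Bx\<^esub>"
      by (auto simp: Bx_simps sum_group_fin_sections[OF Iso_arrows, simplified] sec_zero_def sec_add_def)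
  next
    fix b c d assume bcd: "b \<in> carrier Bx" "c \<in> carrier Bx" "d \<in> carrier Bx"
    show "b \<oplus>\<^bsub>Bx\<^esub> c \<oplus>\<^bsub>Bx\<^esub> d = b \<oplus>\<^bsub>Bx\<^esub> (c \<oplus>\<^bsub>Bx\<^esub> d)"
      using bcd Iso_arrows by (auto simp: Bx_simps sec_add_def R_laws(1) subset_iff fun_eq_iff restrict_def)
  next
    fix b c assume bc: "b \<in> carrier Bx" "c \<in> carrier Bx"
    show "b \<oplus>\<^bsub>Bx\<^esub> c = c \<oplus>\<^bsub>Bx\<^esub> b"
      using bc Iso_arrows by (auto simp: Bx_simps sec_add_def R_laws(2) subset_iff fun_eq_iff restrict_def)
  next
    fix b assume b: "b \<in> carrier Bx"
    show "\<zero>\<^bsub>Bx\<^esub> \<oplus>\<^bsub>Bx\<^esub> b = b"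
      using b Iso_arrows sec_add_fin[OF Iso_arrows sec_zero_fin[OF Iso_arrows], of b] 
      unfolding Bx_simps
      by (intro fin_sections_ext[of _ Iso]) (auto simp: sec_add_def sec_zero_def subset_iff)
  qed (simp_all add: Bx_simps Iso_arrows)
  note t = translates_isotropy[of x]
  have one: "single Iso x \<one>\<^bsub>R x\<^esub> \<in> fin_sections Iso"
    using single_fin[OF Iso_arrows unit_Iso] x by simp
  show "monoid Bx"
  proof (rule monoidI)
    fix b c d assume "b \<in> carrier Bx" "c \<in> carrier Bx" "d \<in> carrier Bx"
    then show "b \<otimes>\<^bsub>Bx\<^esub> c \<otimes>\<^bsub>Bx\<^esub> d = b \<otimes>\<^bsub>Bx\<^esub> (c \<otimes>\<^bsub>Bx\<^esub> d)"
      unfolding Bx_simps by (intro conv_assoc[symmetric] t fin_sections_sections) (auto simp: isotropy_iff)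
  next
    fix b assume "b \<in> carrier Bx"
    then have b: "b \<in> fin_sections Iso" by (simp add: Bx_simps)
    show "\<one>\<^bsub>Bx\<^esub> \<otimes>\<^bsub>Bx\<^esub> b = b"
      unfolding Bx_simps using Iso_arrows b
    proof (induction rule: fin_sections_induct)
      case zero then show ?case using conv_zero_right[OF t fin_sections_sections[OF one]] .
    next
      case (single \<delta> b)
      then show ?case
        using conv_single_single[OF t unit_Iso _ single(1), of "\<one>\<^bsub>R x\<^esub>" b] x by (auto simp: isotropy_iff)
    next
      case (add f g) then show ?case using conv_add_right[OF t fin_sections_sections[OF one]] by simp
    qed
    show "b \<otimes>\<^bsub>Bx\<^esub> \<one>\<^bsub>Bx\<^esub> = b"
      unfolding Bx_simps using Iso_arrows b
    proof (induction rule: fin_sections_induct)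
      case zero then show ?case using conv_zero_left[OF t fin_sections_sections[OF one]] .
    next
      case (single \<delta> b)
      then show ?case
        using conv_single_single[OF t single(1) _ unit_Iso, of b "\<one>\<^bsub>R x\<^esub>"] x act_one[of \<delta>] by (auto simp: isotropy_iff)
    next
      case (add f g) then show ?case using conv_add_left[OF t _ _ one, of f g] by (simp add: fin_sections_sections)
    qed
  qed (simp_all add: Bx_simps conv_fin_fin[OF t] one)
  show "(a \<oplus>\<^bsub>Bx\<^esub> b) \<otimes>\<^bsub>Bx\<^esub> c = a \<otimes>\<^bsub>Bx\<^esub> c \<oplus>\<^bsub>Bx\<^esub> b \<otimes>\<^bsub>Bx\<^esub> c"
    "c \<otimes>\<^bsub>Bx\<^esub> (a \<oplus>\<^bsub>Bx\<^esub> b) = c \<otimes>\<^bsub>Bx\<^esub> a \<oplus>\<^bsub>Bx\<^esub> c \<otimes>\<^bsub>Bx\<^esub> b"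
    if "a \<in> carrier Bx" "b \<in> carrier Bx" "c \<in> carrier Bx" for a b c
    using that by (simp_all add: Bx_simps conv_add_left[OF t] conv_add_right[OF t] fin_sections_sections)
qed

section \<open>The bimodule and its coordinates\<close>

lemma L_group_simps:
  "carrier (L_group G \<O> x) = fin_sections SF" "\<one>\<^bsub>L_group G \<O> x\<^esub> = sec_zero SF"
  "l \<otimes>\<^bsub>L_group G \<O> x\<^esub> l' = sec_add SF l l'"
  unfolding L_group_def
  by (simp_all add: sum_group_fin_sections[OF SF_arrows, simplified] sec_zero_def sec_add_def)

lemma L_group_comm: "comm_group (L_group G \<O> x)"
proof (rule group.group_comm_groupI)
  show "group (L_group G \<O> x)"
    unfolding L_group_def using SF_arrows R_group by (intro sum_group) auto
  fix b c assume "b \<in> carrier (L_group G \<O> x)" "c \<in> carrier (L_group G \<O> x)"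
  then show "b \<otimes>\<^bsub>L_group G \<O> x\<^esub> c = c \<otimes>\<^bsub>L_group G \<O> x\<^esub> b"
    using SF_arrows by (auto simp: L_group_simps sec_add_def R_laws subset_iff fun_eq_iff restrict_def)
qed

lemma L_left_eq: "L_left G \<O> x f l = conv (arrows G) SF SF f l"
  and L_right_eq: "L_right G \<O> x l b = conv SF Iso SF l b"
  by (simp_all add: L_left_def L_right_def conv_def)

text \<open>This bimodule law is what lets the action of f on \<open>\<L>\<^sub>x\<close> descend to
  the tensor product over \<open>B\<^sub>x\<close>.\<close>

lemma L_left_L_right:
  assumes "f \<in> sections_on (arrows G)" "l \<in> fin_sections SF" "b \<in> fin_sections Iso"
  shows "L_left G \<O> x f (L_right G \<O> x l b) = L_right G \<O> x (L_left G \<O> x f l) b"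
  unfolding L_left_eq L_right_eq
  using translates_left translates_right _ _ assms
  by (rule conv_assoc) (auto simp: source_fibre_iff isotropy_iff)

text \<open>The coordinate at \<open>1\<^sub>\<eta>\<close> in the free right \<open>B\<^sub>x\<close>-module \<open>\<L>\<^sub>x\<close>, for any basis of the form
  \<open>(1\<^sub>\<eta>)\<close> with one \<open>\<eta> : x \<rightarrow> z\<close> for each \<open>z\<close> in the orbit of \<open>x\<close>.\<close>

definition coord :: "'g \<Rightarrow> ('g \<Rightarrow> 'e) \<Rightarrow> 'g \<Rightarrow> 'e"
  where "coord \<eta> l = (\<lambda>\<delta>\<in>Iso. act \<O> (ginv G \<eta>) (l (gmul G \<eta> \<delta>)))"

context
  fixes \<eta> assumes \<eta>: "\<eta> \<in> SF"
begin

lemma coord_value: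
  assumes "\<delta> \<in> Iso" "l \<in> sections_on SF"
  shows "coord \<eta> l \<delta> \<in> carrier (R x)" "l (gmul G \<eta> \<delta>) \<in> carrier (R (gran G \<eta>))"
proof -
  have "gmul G \<eta> \<delta> \<in> SF" "gran G (gmul G \<eta> \<delta>) = gran G \<eta>"
    using \<eta> assms(1) by (auto simp: isotropy_iff source_fibre_iff)
  then show l: "l (gmul G \<eta> \<delta>) \<in> carrier (R (gran G \<eta>))"
    using assms(2) by (force simp: Pi_iff)
  then show "coord \<eta> l \<delta> \<in> carrier (R x)"
    using \<eta> assms(1) act_in_carrier[of "ginv G \<eta>"] by (simp add: coord_def source_fibre_iff)
qed

text \<open>Left translation by \<eta> embeds the support of the coordinate into the support of
  l.\<close>

lemma coord_fin:
  assumes "l \<in> fin_sections SF"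
  shows "coord \<eta> l \<in> fin_sections Iso"
proof -
  have "finite {\<delta> \<in> Iso. coord \<eta> l \<delta> \<noteq> \<zero>\<^bsub>R (gran G \<delta>)\<^esub>}"
  proof (rule inj_on_finite[OF _ _ fin_sections_finite[OF assms]])
    show "inj_on (gmul G \<eta>) {\<delta> \<in> Iso. coord \<eta> l \<delta> \<noteq> \<zero>\<^bsub>R (gran G \<delta>)\<^esub>}"
      by (rule inj_on_inverseI[where g = "gmul G (ginv G \<eta>)"])
        (use \<eta> in \<open>auto simp: isotropy_iff source_fibre_iff\<close>)
    show "gmul G \<eta> ` {\<delta> \<in> Iso. coord \<eta> l \<delta> \<noteq> \<zero>\<^bsub>R (gran G \<delta>)\<^esub>} \<subseteq> {\<gamma> \<in> SF. l \<gamma> \<noteq> \<zero>\<^bsub>R (gran G \<gamma>)\<^esub>}"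
      using \<eta> act_zero[of "ginv G \<eta>"] by (auto simp: isotropy_iff source_fibre_iff coord_def)
  qed
  moreover have "coord \<eta> l \<in> (\<Pi>\<^sub>E \<delta>\<in>Iso. carrier (R (gran G \<delta>)))"
    using coord_value[OF _ fin_sections_sections[OF assms]] by (auto simp: isotropy_iff coord_def)
  ultimately show ?thesis by (simp add: fin_sections_def)
qed

lemma coord_add:
  assumes "l \<in> fin_sections SF" "l' \<in> fin_sections SF"
  shows "coord \<eta> (sec_add SF l l') = sec_add Iso (coord \<eta> l) (coord \<eta> l')"
proof
  fix \<delta>
  show "coord \<eta> (sec_add SF l l') \<delta> = sec_add Iso (coord \<eta> l) (coord \<eta> l') \<delta>"
  proof (cases "\<delta> \<in> Iso")
    case True
    then have "gmul G \<eta> \<delta> \<in> SF" "gran G (gmul G \<eta> \<delta>) = gran G \<eta>" "\<eta> \<in> arrows G" "gdom G \<eta> = x" "gran G \<delta> = x"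
      using \<eta> by (auto simp: isotropy_iff source_fibre_iff)
    then show ?thesis
      using True coord_value[OF True] assms act_add[of "ginv G \<eta>" "l (gmul G \<eta> \<delta>)" "l' (gmul G \<eta> \<delta>)"]
      by (simp add: coord_def sec_add_def fin_sections_sections)
  qed (simp_all add: coord_def sec_add_def)
qed

text \<open>Coordinates are right linear: the sheaf map of \<open>\<eta>\<^sup>-\<^sup>1\<close> is
  a ring homomorphism, so it passes into the sum, and it cancels \<eta> against the twist of b by
  the arrow \<open>\<eta>\<epsilon>\<rho>\<^sup>-\<^sup>1\<close>.\<close>

lemma coord_L_right:
  assumes l: "l \<in> fin_sections SF" and b: "b \<in> fin_sections Iso"
  shows "coord \<eta> (L_right G \<O> x l b) = conv Iso Iso Iso (coord \<eta> l) b"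
proof
  fix \<epsilon>
  show "coord \<eta> (L_right G \<O> x l b) \<epsilon> = conv Iso Iso Iso (coord \<eta> l) b \<epsilon>"
  proof (cases "\<epsilon> \<in> Iso")
    case True
    have \<eta>': "\<eta> \<in> arrows G" "gdom G \<eta> = x" using \<eta> by (auto simp: source_fibre_iff)
    have \<epsilon>: "gmul G \<eta> \<epsilon> \<in> SF" "gran G (gmul G \<eta> \<epsilon>) = gran G \<eta>" "\<epsilon> \<in> arrows G" "gdom G \<epsilon> = x" "gran G \<epsilon> = x"
      using \<eta> True by (auto simp: isotropy_iff source_fibre_iff)
    note tr = translates_right[of x] and ti = translates_isotropy[of x]
    have ls: "l \<in> sections_on SF" and bs: "b \<in> sections_on Iso" using l b by auto
    have cs: "coord \<eta> l \<in> sections_on Iso" using coord_fin[OF l] fin_sections_sections by blast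
    have h: "act \<O> (ginv G \<eta>) \<in> hom (add_monoid (R (gran G \<eta>))) (add_monoid (R x))"
      using act_hom[of "ginv G \<eta>"] \<eta>' by simp
    have cg: "comm_group (add_monoid (R (gran G \<eta>)))" "comm_group (add_monoid (R x))"
      using R_add_comm_group \<eta>' x by auto
    interpret C: comm_group "add_monoid (R x)" by fact
    have "act \<O> (ginv G \<eta>) (conv SF Iso SF l b (gmul G \<eta> \<epsilon>)) =
      act \<O> (ginv G \<eta>) (gfinsum (R (gran G \<eta>)) (conv_term l b (gmul G \<eta> \<epsilon>)) Iso)"
      using conv_value[OF tr \<epsilon>(1) ls bs] \<epsilon> by simp
    also have "\<dots> = gfinsum (R x) (\<lambda>\<rho>. act \<O> (ginv G \<eta>) (conv_term l b (gmul G \<eta> \<epsilon>) \<rho>)) Iso"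
      by (rule gfinprod_hom[OF cg h])
        (use conv_term_funcset[OF tr \<epsilon>(1) ls bs] conv_term_finite[OF tr \<epsilon>(1) ls b] \<epsilon> in simp_all)
    also have "\<dots> = gfinsum (R x) (conv_term (coord \<eta> l) b \<epsilon>) Iso"
    proof -
      have "act \<O> (ginv G \<eta>) (conv_term l b (gmul G \<eta> \<epsilon>) \<rho>) = conv_term (coord \<eta> l) b \<epsilon> \<rho>"
        if \<rho>: "\<rho> \<in> Iso" for \<rho>
      proof -
        have \<rho>': "\<rho> \<in> arrows G" "gdom G \<rho> = x" "gran G \<rho> = x" "gmul G \<epsilon> (ginv G \<rho>) \<in> Iso"
          using True \<rho> by (auto simp: isotropy_iff)
        have m: "gmul G (gmul G \<eta> \<epsilon>) (ginv G \<rho>) = gmul G \<eta> (gmul G \<epsilon> (ginv G \<rho>))"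
          using gmul_assoc[of \<eta> \<epsilon> "ginv G \<rho>"] \<eta>' \<epsilon> \<rho>' by simp
        have b\<rho>: "b \<rho> \<in> carrier (R x)" using fin_sections_value[OF b \<rho>] \<rho>' by simp
        have lc: "l (gmul G \<eta> (gmul G \<epsilon> (ginv G \<rho>))) \<in> carrier (R (gran G \<eta>))"
          using coord_value(2)[OF \<rho>'(4) ls] .
        have ab: "act \<O> (gmul G \<epsilon> (ginv G \<rho>)) (b \<rho>) \<in> carrier (R x)"
          using act_in_carrier[of "gmul G \<epsilon> (ginv G \<rho>)" "b \<rho>"] \<epsilon> \<rho>' b\<rho> by simp
        have a2: "act \<O> (gmul G \<eta> (gmul G \<epsilon> (ginv G \<rho>))) (b \<rho>) = act \<O> \<eta> (act \<O> (gmul G \<epsilon> (ginv G \<rho>)) (b \<rho>))"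
          using act_mul[of \<eta> "gmul G \<epsilon> (ginv G \<rho>)" "b \<rho>"] \<eta>' \<epsilon> \<rho>' b\<rho> by simp
        show ?thesis
          using act_mult[of "ginv G \<eta>" "l (gmul G \<eta> (gmul G \<epsilon> (ginv G \<rho>)))" "act \<O> \<eta> (act \<O> (gmul G \<epsilon> (ginv G \<rho>)) (b \<rho>))"]
            act_in_carrier[of \<eta> "act \<O> (gmul G \<epsilon> (ginv G \<rho>)) (b \<rho>)"] act_inv_cancel(1)[of \<eta> "act \<O> (gmul G \<epsilon> (ginv G \<rho>)) (b \<rho>)"]
            \<eta>' \<epsilon> \<rho>' m lc ab
          by (simp add: conv_term_def coord_def a2)
      qed
      then show ?thesis
        using conv_term_funcset[OF ti True cs bs] \<epsilon>
        by (intro C.gfinprod_cong) (auto simp: simp_implies_def Pi_iff)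
    qed
    also have "\<dots> = conv Iso Iso Iso (coord \<eta> l) b \<epsilon>"
      using conv_value[OF ti True cs bs] \<epsilon> by simp
    finally show ?thesis using True by (simp add: coord_def L_right_eq)
  qed (simp_all add: coord_def conv_def)
qed

text \<open>The arrows of the source fibre that share the range of \<eta> are exactly the products
  \<eta>\<delta> with \<delta> in the isotropy group. Hence \<open>1\<^sub>\<eta>\<close> spans the
  summand of \<open>\<L>\<^sub>x\<close> over that range, and multiplying it by the coordinate at
  \<eta> is the projection onto this summand.\<close>

lemma L_right_coord:
  assumes l: "l \<in> fin_sections SF" and \<zeta>: "\<zeta> \<in> SF"
  shows "L_right G \<O> x (single SF \<eta> \<one>\<^bsub>R (gran G \<eta>)\<^esub>) (coord \<eta> l) \<zeta> =
    (if gran G \<zeta> = gran G \<eta> then l \<zeta> else \<zero>\<^bsub>R (gran G \<zeta>)\<^esub>)"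
proof -
  note tr = translates_right[of x]
  have \<eta>': "\<eta> \<in> arrows G" "gdom G \<eta> = x" and \<zeta>': "\<zeta> \<in> arrows G" "gdom G \<zeta> = x"
    using \<eta> \<zeta> by (auto simp: source_fibre_iff)
  let ?s = "single SF \<eta> \<one>\<^bsub>R (gran G \<eta>)\<^esub>"
  have ss: "?s \<in> sections_on SF" using single_fin[OF SF_arrows \<eta>, of "\<one>\<^bsub>R (gran G \<eta>)\<^esub>"] \<eta>'
    by (intro fin_sections_sections) simp
  have cs: "coord \<eta> l \<in> sections_on Iso" using coord_fin[OF l] fin_sections_sections by blast
  have t0: "conv_term ?s (coord \<eta> l) \<zeta> \<rho> = \<zero>\<^bsub>R (gran G \<zeta>)\<^esub>"
    if "\<rho> \<in> Iso" "gmul G \<zeta> (ginv G \<rho>) \<noteq> \<eta>" for \<rho>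
  proof -
    have "gmul G \<zeta> (ginv G \<rho>) \<in> SF" "coord \<eta> l \<rho> \<in> carrier (R x)" "\<rho> \<in> arrows G" "gdom G \<rho> = x" "gran G \<rho> = x"
      using that \<zeta>' coord_value(1)[OF that(1)] l by (auto simp: isotropy_iff source_fibre_iff)
    then show ?thesis
      using that \<zeta>' act_in_carrier[of "gmul G \<zeta> (ginv G \<rho>)" "coord \<eta> l \<rho>"]
      by (simp add: conv_term_def single_def)
  qed
  show ?thesis
  proof (cases "gran G \<zeta> = gran G \<eta>")
    case True
    \<comment> \<open>The only isotropy element carrying \<eta> to \<zeta>, hence the only index
      with a nonzero summand.\<close>
    let ?\<rho> = "gmul G (ginv G \<eta>) \<zeta>"
    have \<rho>: "?\<rho> \<in> Iso" "gmul G \<eta> ?\<rho> = \<zeta>" using True \<eta>' \<zeta>' by (auto simp: isotropy_iff)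
    have inv: "gmul G \<zeta> (ginv G ?\<rho>) = \<eta>"
      using True \<eta>' \<zeta>' by (simp add: inv_gmul)
    have "conv SF Iso SF ?s (coord \<eta> l) \<zeta> = conv_term ?s (coord \<eta> l) \<zeta> ?\<rho>"
    proof (rule conv_eq_term[OF tr \<zeta> ss cs \<rho>(1)])
      fix \<rho> assume r: "\<rho> \<in> Iso" "\<rho> \<noteq> ?\<rho>"
      have "gmul G \<zeta> (ginv G \<rho>) \<noteq> \<eta>"
      proof
        assume "gmul G \<zeta> (ginv G \<rho>) = \<eta>"
        then have "\<zeta> = gmul G \<eta> \<rho>" using r \<zeta>' by (auto simp: isotropy_iff)
        then have "?\<rho> = \<rho>" using r \<eta>' by (auto simp: isotropy_iff)
        with r show False by simp
      qed
      then show "conv_term ?s (coord \<eta> l) \<zeta> \<rho> = \<zero>\<^bsub>R (gran G \<zeta>)\<^esub>" using t0 r by simp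
    qed
    also have "\<dots> = l \<zeta>"
    proof -
      have "act \<O> \<eta> (act \<O> (ginv G \<eta>) (l \<zeta>)) = l \<zeta>"
        using act_inv_cancel(2)[of \<eta> "l \<zeta>"] \<eta>' True fin_sections_value[OF l \<zeta>] by simp
      then show ?thesis
        using \<rho> inv \<eta> \<eta>' True \<zeta>' fin_sections_value[OF l \<zeta>] by (simp add: conv_term_def single_def coord_def)
    qed
    finally show ?thesis using True by (simp add: L_right_eq)
  next
    case False
    have "conv SF Iso SF ?s (coord \<eta> l) \<zeta> = \<zero>\<^bsub>R (gran G \<zeta>)\<^esub>"
    proof (rule conv_all_zero[OF tr \<zeta> ss cs])
      fix \<rho> assume r: "\<rho> \<in> Iso"
      have "gran G (gmul G \<zeta> (ginv G \<rho>)) = gran G \<zeta>" using r \<zeta>' by (auto simp: isotropy_iff)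
      then show "conv_term ?s (coord \<eta> l) \<zeta> \<rho> = \<zero>\<^bsub>R (gran G \<zeta>)\<^esub>" using t0[OF r] False by metis
    qed
    then show ?thesis using False by (simp add: L_right_eq)
  qed
qed

text \<open>Coefficients can be moved to the right of \<open>1\<^sub>\<eta>\<close>, so the elements
  \<open>1\<^sub>\<eta>\<close> generate \<open>\<L>\<^sub>x\<close> as a right module and the
  action of f is determined by its values on them.\<close>

lemma single_L_right:
  assumes "a \<in> carrier (R (gran G \<eta>))"
  shows "single SF \<eta> a = L_right G \<O> x (single SF \<eta> \<one>\<^bsub>R (gran G \<eta>)\<^esub>) (single Iso x (act \<O> (ginv G \<eta>) a))"
proof -
  have \<eta>': "\<eta> \<in> arrows G" "gdom G \<eta> = x" using \<eta> by (auto simp: source_fibre_iff)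
  have "act \<O> (ginv G \<eta>) a \<in> carrier (R x)" using act_in_carrier[of "ginv G \<eta>" a] assms \<eta>' by simp
  then show ?thesis
    using conv_single_single[OF translates_right \<eta> \<eta>'(2) unit_Iso, of "\<one>\<^bsub>R (gran G \<eta>)\<^esub>" "act \<O> (ginv G \<eta>) a"]
      act_inv_cancel(2)[of \<eta> a] assms \<eta> \<eta>' by (simp add: L_right_eq)
qed

end

text \<open>The entry in row \<eta> and column \<gamma> of the matrix of f on
  \<open>\<L>\<^sub>x\<close>. It depends on the arrows themselves and not only on their ranges,
  which is why every pair from the source fibre is allowed.\<close>

definition corner :: "('g \<Rightarrow> 'e) \<Rightarrow> 'g \<Rightarrow> 'g \<Rightarrow> 'g \<Rightarrow> 'e"
  where "corner f \<eta> \<gamma> = (\<lambda>\<delta>\<in>Iso. act \<O> (ginv G \<eta>) (f (gmul G (gmul G \<eta> \<delta>) (ginv G \<gamma>))))"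

lemma corner_eq_coord:
  assumes f: "f \<in> sections_on (arrows G)" and \<eta>: "\<eta> \<in> SF" and \<gamma>: "\<gamma> \<in> SF"
  shows "corner f \<eta> \<gamma> = coord \<eta> (L_left G \<O> x f (single SF \<gamma> \<one>\<^bsub>R (gran G \<gamma>)\<^esub>))"
proof
  fix \<delta>
  show "corner f \<eta> \<gamma> \<delta> = coord \<eta> (L_left G \<O> x f (single SF \<gamma> \<one>\<^bsub>R (gran G \<gamma>)\<^esub>)) \<delta>"
  proof (cases "\<delta> \<in> Iso")
    case True
    have *: "gmul G \<eta> \<delta> \<in> SF" "\<gamma> \<in> arrows G" "gdom G \<gamma> = x" "gmul G (gmul G \<eta> \<delta>) (ginv G \<gamma>) \<in> arrows G"
      "gdom G (gmul G (gmul G \<eta> \<delta>) (ginv G \<gamma>)) = gran G \<gamma>" "gran G (gmul G (gmul G \<eta> \<delta>) (ginv G \<gamma>)) = gran G (gmul G \<eta> \<delta>)"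
      "gmul G \<eta> \<delta> \<in> arrows G"
      using True \<eta> \<gamma> by (auto simp: isotropy_iff source_fibre_iff)
    have "f (gmul G (gmul G \<eta> \<delta>) (ginv G \<gamma>)) \<in> carrier (R (gran G (gmul G \<eta> \<delta>)))"
      using f *(4,6) by (force simp: Pi_iff)
    then show ?thesis
      using True * conv_single[OF translates_left *(1) f \<gamma>, of "\<one>\<^bsub>R (gran G \<gamma>)\<^esub>"] act_one[OF *(4)]
      by (simp add: corner_def coord_def L_left_eq)
  qed (simp_all add: corner_def coord_def)
qed

end

end

section \<open>Tensor products and the annihilator of an induced module\<close>

context left_module
begin

lemma zero_smult [simp]: "m \<in> carrier M \<Longrightarrow> \<zero>\<^bsub>R\<^esub> \<odot> m = \<zero>"
  using smult_l_distr[of "\<zero>\<^bsub>R\<^esub>" "\<zero>\<^bsub>R\<^esub>" m] smult_closed[of "\<zero>\<^bsub>R\<^esub>" m]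
    M.add.l_cancel_one'[of "\<zero>\<^bsub>R\<^esub> \<odot> m" "\<zero>\<^bsub>R\<^esub> \<odot> m"] by simp

lemma smult_zero [simp]: "a \<in> carrier R \<Longrightarrow> a \<odot> \<zero> = \<zero>"
  using smult_r_distr[of a \<zero> \<zero>] smult_closed[of a \<zero>]
    M.add.l_cancel_one'[of "a \<odot> \<zero>" "a \<odot> \<zero>"] by simp

end

text \<open>Closure under the two actions places the relators in the free group. A pure tensor is
  zero iff its generator \<open>frag_of (l, m)\<close> lies in the kernel \<open>K\<close>;
  vanishing is handled in this form, mostly without cosets.\<close>

locale tensor_factors = L?: comm_group L + M?: abelian_group M
  for B :: "('b, 'x) ring_scheme" and L :: "('l, 'y) monoid_scheme"
    and ract :: "'l \<Rightarrow> 'b \<Rightarrow> 'l" and M :: "('b, 'm, 'z) module_scheme" +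
  assumes ract_closed: "l \<in> carrier L \<Longrightarrow> b \<in> carrier B \<Longrightarrow> ract l b \<in> carrier L"
    and smult_closed: "b \<in> carrier B \<Longrightarrow> m \<in> carrier M \<Longrightarrow> b \<odot>\<^bsub>M\<^esub> m \<in> carrier M"
begin

abbreviation "F \<equiv> tensor_free L M"
abbreviation "K \<equiv> tensor_kernel B L ract M"

lemma F_comm_group: "comm_group F"
  by (simp add: tensor_free_def abelian_free_Abelian_group)

interpretation F: comm_group F by (rule F_comm_group)

lemma F_carrier: "t \<in> carrier F \<longleftrightarrow> Poly_Mapping.keys t \<subseteq> carrier L \<times> carrier M"
  and F_mult [simp]: "t \<otimes>\<^bsub>F\<^esub> u = t + u" and F_one [simp]: "\<one>\<^bsub>F\<^esub> = 0"
  by (simp_all add: tensor_free_def)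

lemma F_inv [simp]: "t \<in> carrier F \<Longrightarrow> inv\<^bsub>F\<^esub> t = - t"
  by (simp add: tensor_free_def)

lemma frag_of_F [simp]: "frag_of (l, m) \<in> carrier F \<longleftrightarrow> l \<in> carrier L \<and> m \<in> carrier M"
  by (simp add: F_carrier)

lemma F_closed [simp]:
  "t \<in> carrier F \<Longrightarrow> u \<in> carrier F \<Longrightarrow> t + u \<in> carrier F"
  "t \<in> carrier F \<Longrightarrow> - t \<in> carrier F"
  "t \<in> carrier F \<Longrightarrow> u \<in> carrier F \<Longrightarrow> t - u \<in> carrier F"
  "0 \<in> carrier F"
  using F.m_closed[of t u] F.inv_closed[of t] F.one_closed F.m_closed[of t "- u"] F.inv_closed[of u] by simp_all

lemma relators_F: "tensor_relators B L ract M \<subseteq> carrier F"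
  using ract_closed smult_closed by (auto simp: tensor_relators_def)

lemma K_subgroup: "subgroup K F"
  unfolding tensor_kernel_def by (rule F.generate_is_subgroup[OF relators_F])

lemma K_carrier: "t \<in> K \<Longrightarrow> t \<in> carrier F"
  using subgroup.subset[OF K_subgroup] by blast

lemma K_closed:
  "0 \<in> K"
  "t \<in> K \<Longrightarrow> u \<in> K \<Longrightarrow> t + u \<in> K"
  "t \<in> K \<Longrightarrow> - t \<in> K"
  "t \<in> K \<Longrightarrow> u \<in> K \<Longrightarrow> t - u \<in> K"
proof -
  show 0: "0 \<in> K" using subgroup.one_closed[OF K_subgroup] by simp
  show add: "t + u \<in> K" if "t \<in> K" "u \<in> K" for t u
    using subgroup.m_closed[OF K_subgroup that] by simp
  show neg: "- t \<in> K" if "t \<in> K" for t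
    using subgroup.m_inv_closed[OF K_subgroup that] K_carrier[OF that] by simp
  show "t - u \<in> K" if "t \<in> K" "u \<in> K" using add[OF that(1) neg[OF that(2)]] by simp
qed

lemma relator_K:
  "l \<in> carrier L \<Longrightarrow> l' \<in> carrier L \<Longrightarrow> m \<in> carrier M \<Longrightarrow>
    frag_of (l \<otimes>\<^bsub>L\<^esub> l', m) - frag_of (l, m) - frag_of (l', m) \<in> K"
  "l \<in> carrier L \<Longrightarrow> m \<in> carrier M \<Longrightarrow> m' \<in> carrier M \<Longrightarrow>
    frag_of (l, m \<oplus>\<^bsub>M\<^esub> m') - frag_of (l, m) - frag_of (l, m') \<in> K"
  "l \<in> carrier L \<Longrightarrow> b \<in> carrier B \<Longrightarrow> m \<in> carrier M \<Longrightarrow>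
    frag_of (ract l b, m) - frag_of (l, b \<odot>\<^bsub>M\<^esub> m) \<in> K"
  unfolding tensor_kernel_def by (rule generate.incl, simp add: tensor_relators_def, blast)+

lemma frag_mult_K:
  assumes "l \<in> carrier L" "l' \<in> carrier L" "m \<in> carrier M" "frag_of (l, m) \<in> K" "frag_of (l', m) \<in> K"
  shows "frag_of (l \<otimes>\<^bsub>L\<^esub> l', m) \<in> K"
proof -
  have "(frag_of (l \<otimes>\<^bsub>L\<^esub> l', m) - frag_of (l, m) - frag_of (l', m)) + (frag_of (l, m) + frag_of (l', m)) \<in> K"
    using K_closed(2)[OF relator_K(1)[OF assms(1-3)] K_closed(2)[OF assms(4,5)]] .
  then show ?thesis by simp
qed

lemma frag_ract_K:
  assumes "l \<in> carrier L" "b \<in> carrier B" "m \<in> carrier M" "frag_of (l, b \<odot>\<^bsub>M\<^esub> m) \<in> K"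
  shows "frag_of (ract l b, m) \<in> K"
proof -
  have "(frag_of (ract l b, m) - frag_of (l, b \<odot>\<^bsub>M\<^esub> m)) + frag_of (l, b \<odot>\<^bsub>M\<^esub> m) \<in> K"
    using K_closed(2)[OF relator_K(3)[OF assms(1-3)] assms(4)] .
  then show ?thesis by simp
qed

text \<open>For two neutral elements the additivity relator has the form t - t - t, so its negative
  is the generator in question.\<close>

lemma frag_one_K:
  assumes "m \<in> carrier M" shows "frag_of (\<one>\<^bsub>L\<^esub>, m) \<in> K"
proof -
  have "- (frag_of (\<one>\<^bsub>L\<^esub> \<otimes>\<^bsub>L\<^esub> \<one>\<^bsub>L\<^esub>, m) - frag_of (\<one>\<^bsub>L\<^esub>, m) - frag_of (\<one>\<^bsub>L\<^esub>, m)) \<in> K"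
    using assms by (intro K_closed(3) relator_K(1)) auto
  then show ?thesis by simp
qed

lemma frag_zero_K:
  assumes "l \<in> carrier L" shows "frag_of (l, \<zero>\<^bsub>M\<^esub>) \<in> K"
proof -
  have "- (frag_of (l, \<zero>\<^bsub>M\<^esub> \<oplus>\<^bsub>M\<^esub> \<zero>\<^bsub>M\<^esub>) - frag_of (l, \<zero>\<^bsub>M\<^esub>) - frag_of (l, \<zero>\<^bsub>M\<^esub>)) \<in> K"
    using assms by (intro K_closed(3) relator_K(2)) auto
  then show ?thesis by simp
qed

text \<open>By the universal property of the free abelian group \<psi> extends to a homomorphism;
  being balanced, it kills the relators and so all of \<open>K\<close>. Applied to a coordinate
  acting on m, this extracts equations in M from the vanishing of a tensor.\<close>

lemma balanced_map_vanishes: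
  assumes A: "comm_group A" and \<psi>: "\<And>l m. l \<in> carrier L \<Longrightarrow> m \<in> carrier M \<Longrightarrow> \<psi> l m \<in> carrier A"
    and add_l: "\<And>l l' m. l \<in> carrier L \<Longrightarrow> l' \<in> carrier L \<Longrightarrow> m \<in> carrier M \<Longrightarrow>
      \<psi> (l \<otimes>\<^bsub>L\<^esub> l') m = \<psi> l m \<otimes>\<^bsub>A\<^esub> \<psi> l' m"
    and add_r: "\<And>l m m'. l \<in> carrier L \<Longrightarrow> m \<in> carrier M \<Longrightarrow> m' \<in> carrier M \<Longrightarrow>
      \<psi> l (m \<oplus>\<^bsub>M\<^esub> m') = \<psi> l m \<otimes>\<^bsub>A\<^esub> \<psi> l m'"
    and bal: "\<And>l b m. l \<in> carrier L \<Longrightarrow> b \<in> carrier B \<Longrightarrow> m \<in> carrier M \<Longrightarrow>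
      \<psi> (ract l b) m = \<psi> l (b \<odot>\<^bsub>M\<^esub> m)"
    and K: "frag_of (l, m) \<in> K"
  shows "\<psi> l m = \<one>\<^bsub>A\<^esub>"
proof -
  interpret A: comm_group A by fact
  have "(\<lambda>(l, m). \<psi> l m) ` (carrier L \<times> carrier M) \<subseteq> carrier A" using \<psi> by auto
  from A.free_Abelian_group_universal[OF this]
  obtain h where hF: "h \<in> hom F A"
    and hf: "\<And>p. p \<in> carrier L \<times> carrier M \<Longrightarrow> h (frag_of p) = (\<lambda>(l, m). \<psi> l m) p"
    unfolding tensor_free_def by blast
  have h: "h \<in> hom F A" "\<And>l m. l \<in> carrier L \<Longrightarrow> m \<in> carrier M \<Longrightarrow> h (frag_of (l, m)) = \<psi> l m"
    using hF hf by auto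
  interpret h: group_hom F A h using h(1) by unfold_locales
  have diff: "h (t - u) = h t \<otimes>\<^bsub>A\<^esub> inv\<^bsub>A\<^esub> (h u)" if "t \<in> carrier F" "u \<in> carrier F" for t u
    using h.hom_mult[of t "- u"] h.hom_inv[of u] that by simp
  have aux: "a \<otimes>\<^bsub>A\<^esub> b \<otimes>\<^bsub>A\<^esub> inv\<^bsub>A\<^esub> a \<otimes>\<^bsub>A\<^esub> inv\<^bsub>A\<^esub> b = \<one>\<^bsub>A\<^esub>"
    if "a \<in> carrier A" "b \<in> carrier A" for a b
  proof -
    have "a \<otimes>\<^bsub>A\<^esub> b \<otimes>\<^bsub>A\<^esub> inv\<^bsub>A\<^esub> a \<otimes>\<^bsub>A\<^esub> inv\<^bsub>A\<^esub> b = (a \<otimes>\<^bsub>A\<^esub> b) \<otimes>\<^bsub>A\<^esub> inv\<^bsub>A\<^esub> (a \<otimes>\<^bsub>A\<^esub> b)"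
      using that by (simp add: A.m_assoc A.inv_mult)
    then show ?thesis using that by simp
  qed
  have rel: "h t = \<one>\<^bsub>A\<^esub>" if "t \<in> tensor_relators B L ract M" for t
    using that unfolding tensor_relators_def
    by (auto simp: diff h add_l add_r bal ract_closed smult_closed \<psi> aux)
  have "t \<in> carrier F \<and> h t = \<one>\<^bsub>A\<^esub>" if "t \<in> K" for t
    using that unfolding tensor_kernel_def
  proof (induction t rule: generate.induct)
    case one then show ?case using h.hom_one by simp
  next
    case (incl t) then show ?case using relators_F rel by auto
  next
    case (inv t) then show ?case using relators_F rel h.hom_inv[of t] by (auto simp del: F_inv)
  next
    case (eng t u) then show ?case using h.hom_mult[of t u] by simp
  qed
  then have "h (frag_of (l, m)) = \<one>\<^bsub>A\<^esub>" using K by blast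
  then show ?thesis using h(2)[of l m] K_carrier[OF K] by simp
qed

context
  fixes \<phi> :: "'l \<Rightarrow> 'l"
  assumes \<phi>_hom: "\<phi> \<in> hom L L"
    and \<phi>_ract: "\<And>l b. l \<in> carrier L \<Longrightarrow> b \<in> carrier B \<Longrightarrow> \<phi> (ract l b) = ract (\<phi> l) b"
begin

abbreviation (input) "E \<equiv> frag_extend (\<lambda>(l, m). frag_of (\<phi> l, m))"

lemma \<phi>_closed: "l \<in> carrier L \<Longrightarrow> \<phi> l \<in> carrier L"
  using \<phi>_hom by (auto simp: hom_def)

lemma E_F: "t \<in> carrier F \<Longrightarrow> E t \<in> carrier F"
proof -
  assume "t \<in> carrier F"
  then have "Poly_Mapping.keys t \<subseteq> carrier L \<times> carrier M" by (simp add: F_carrier)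
  then show "E t \<in> carrier F"
    by (rule free_Abelian_group_induct[where P = "\<lambda>t. E t \<in> carrier F"])
      (auto simp: frag_extend_diff \<phi>_closed)
qed

text \<open>As \<phi> is additive and commutes with the right action, relators go to
  relators.\<close>

lemma E_K: "t \<in> K \<Longrightarrow> E t \<in> K"
  unfolding tensor_kernel_def
proof (induction t rule: generate.induct)
  case one then show ?case using K_closed(1) by (simp add: tensor_kernel_def)
next
  have rel: "E t \<in> K" if "t \<in> tensor_relators B L ract M" for t
    using that relator_K \<phi>_closed \<phi>_hom \<phi>_ract unfolding tensor_relators_def
    by (auto simp: frag_extend_diff hom_def)
  case (incl t) then show ?case using rel by (simp add: tensor_kernel_def)
  case (inv t)
  then have "t \<in> carrier F" using relators_F by auto
  with rel[OF inv] show ?case using K_closed(3)[of "E t"] by (simp add: tensor_kernel_def frag_extend_minus)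
next
  case (eng t u) then show ?case using K_closed(2)[of "E t" "E u"] by (simp add: tensor_kernel_def frag_extend_add)
qed

text \<open>Any two representatives differ by an element of \<open>K\<close>, which \<open>E\<close>
  preserves. The image in the definition of \<open>tensor_map\<close> is therefore a singleton, and
  \<open>the_elem\<close> is well defined.\<close>

lemma tensor_map_coset:
  assumes "t \<in> carrier F"
  shows "tensor_map B L ract M \<phi> (K #>\<^bsub>F\<^esub> t) = K #>\<^bsub>F\<^esub> E t"
proof -
  have eq: "K #>\<^bsub>F\<^esub> E u = K #>\<^bsub>F\<^esub> E t" if u: "u \<in> K #>\<^bsub>F\<^esub> t" for u
  proof -
    obtain k where k: "k \<in> K" "u = k + t" using u by (auto simp: r_coset_def)
    then have Eu: "E u = E k \<otimes>\<^bsub>F\<^esub> E t" by (simp add: frag_extend_add)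
    have "E k \<otimes>\<^bsub>F\<^esub> E t \<in> K #>\<^bsub>F\<^esub> E t"
      using F.rcosI[OF E_K[OF k(1)] subgroup.subset[OF K_subgroup] E_F[OF assms]] .
    then show ?thesis
      using F.repr_independence[OF _ E_F[OF assms] K_subgroup] Eu by simp
  qed
  have "t \<in> K #>\<^bsub>F\<^esub> t" using F.rcos_self[OF assms K_subgroup] .
  then have "(\<lambda>u. K #>\<^bsub>F\<^esub> E u) ` (K #>\<^bsub>F\<^esub> t) = {K #>\<^bsub>F\<^esub> E t}"
    using eq by blast
  then show ?thesis by (simp add: tensor_map_def)
qed

text \<open>The induced endomorphism is additive and pure tensors generate, so its vanishing is
  tested on pure tensors.\<close>

lemma tensor_map_zero_iff:
  "(\<forall>X \<in> carrier (tensor_product B L ract M).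
      tensor_map B L ract M \<phi> X = \<one>\<^bsub>tensor_product B L ract M\<^esub>) \<longleftrightarrow>
   (\<forall>l \<in> carrier L. \<forall>m \<in> carrier M. frag_of (\<phi> l, m) \<in> K)"
proof -
  have "(\<forall>X \<in> carrier (tensor_product B L ract M).
      tensor_map B L ract M \<phi> X = \<one>\<^bsub>tensor_product B L ract M\<^esub>) \<longleftrightarrow>
    (\<forall>t \<in> carrier F. K #>\<^bsub>F\<^esub> E t = K)"
    by (auto simp: tensor_product_def FactGroup_def RCOSETS_def tensor_map_coset)
  also have "\<dots> \<longleftrightarrow> (\<forall>t \<in> carrier F. E t \<in> K)"
    using F.coset_join1[OF _ _ K_subgroup] F.coset_join2[OF _ K_subgroup] E_F by blast
  also have "\<dots> \<longleftrightarrow> (\<forall>l \<in> carrier L. \<forall>m \<in> carrier M. frag_of (\<phi> l, m) \<in> K)" (is "_ \<longleftrightarrow> ?R")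
  proof
    assume "\<forall>t \<in> carrier F. E t \<in> K"
    then show ?R using frag_of_F by (metis (no_types, lifting) case_prod_conv frag_extend_of)
  next
    assume R: ?R
    show "\<forall>t \<in> carrier F. E t \<in> K"
    proof
      fix t assume "t \<in> carrier F"
      then have "Poly_Mapping.keys t \<subseteq> carrier L \<times> carrier M" by (simp add: F_carrier)
      then show "E t \<in> K"
        by (rule free_Abelian_group_induct[where P = "\<lambda>t. E t \<in> K"])
          (auto simp: frag_extend_diff R K_closed)
    qed
  qed
  finally show ?thesis .
qed

end

end

section \<open>Annihilation of induced modules by matrix entries\<close>

context ring_sheaf
begin

context
  fixes x and M :: "('g \<Rightarrow> 'e, 'm) module"
  assumes x: "x \<in> units G" and M: "left_module (skew_group_ring G \<O> x) M"
begin

interpretation M: left_module "skew_group_ring G \<O> x" M by (rule M)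

lemma tensor_factors_L: "tensor_factors (skew_group_ring G \<O> x) (L_group G \<O> x) (L_right G \<O> x) M"
proof -
  interpret L: comm_group "L_group G \<O> x" by (rule L_group_comm[OF x])
  show ?thesis
  proof unfold_locales
    show "L_right G \<O> x l b \<in> carrier (L_group G \<O> x)"
      if "l \<in> carrier (L_group G \<O> x)" "b \<in> carrier (skew_group_ring G \<O> x)" for l b
      using that conv_fin_fin[OF translates_right]
      by (simp add: L_group_simps[OF x] Bx_simps[OF x] L_right_eq[OF x])
  qed (rule M.smult_closed)
qed

interpretation T: tensor_factors "skew_group_ring G \<O> x" "L_group G \<O> x" "L_right G \<O> x" M
  by (rule tensor_factors_L)

text \<open>The family l splits into finitely many parts according to the ranges of its arrows. The
  part over the range of \<eta> is \<open>1\<^sub>\<eta>\<close> times the coordinate c at \<eta>,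
  and its tensor with m equals that of \<open>1\<^sub>\<eta>\<close> with cm = 0. The induction
  removes one range at a time.\<close>

lemma frag_K_of_coord_zero:
  assumes l: "l \<in> fin_sections (source_fibre G x)"
    and m: "m \<in> carrier M" and zero: "\<And>\<eta>. \<eta> \<in> source_fibre G x \<Longrightarrow> coord x \<eta> l \<odot>\<^bsub>M\<^esub> m = \<zero>\<^bsub>M\<^esub>"
  shows "frag_of (l, m) \<in> T.K"
proof -
  have "frag_of (l, m) \<in> T.K"
    if "finite Z" "l \<in> fin_sections (source_fibre G x)"
      "\<And>\<gamma>. \<gamma> \<in> source_fibre G x \<Longrightarrow> l \<gamma> \<noteq> \<zero>\<^bsub>R (gran G \<gamma>)\<^esub> \<Longrightarrow> gran G \<gamma> \<in> Z"
      "\<And>\<eta>. \<eta> \<in> source_fibre G x \<Longrightarrow> coord x \<eta> l \<odot>\<^bsub>M\<^esub> m = \<zero>\<^bsub>M\<^esub>" for Z l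
    using that
  proof (induction Z arbitrary: l)
    case empty
    then have "l = sec_zero (source_fibre G x)"
      using sec_zero_fin[OF SF_arrows[OF x]] by (intro fin_sections_ext) (auto simp: sec_zero_def)
    then show ?case using T.frag_one_K[OF m] by (simp add: L_group_simps[OF x])
  next
    case (insert z Z)
    note l = insert.prems(1)
    show ?case
    proof (cases "\<exists>\<eta> \<in> source_fibre G x. gran G \<eta> = z")
      case False
      then show ?thesis using insert by (metis insertE)
    next
      case True
      then obtain \<eta> where \<eta>: "\<eta> \<in> source_fibre G x" "gran G \<eta> = z" by blast
      then have \<eta>': "\<eta> \<in> arrows G" "gdom G \<eta> = x" by (auto simp: source_fibre_iff)
      define e where "e = single (source_fibre G x) \<eta> \<one>\<^bsub>R (gran G \<eta>)\<^esub>"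
      \<comment> \<open>The part of l over z, written through its coordinate so that the coordinate
        can be moved onto m.\<close>
      define l1 where "l1 = L_right G \<O> x e (coord x \<eta> l)"
      define l2 where "l2 = (\<lambda>\<zeta>\<in>source_fibre G x. if gran G \<zeta> = gran G \<eta> then \<zero>\<^bsub>R (gran G \<zeta>)\<^esub> else l \<zeta>)"
      have e: "e \<in> fin_sections (source_fibre G x)"
        unfolding e_def using \<eta> \<eta>' by (intro single_fin[OF SF_arrows[OF x]]) auto
      have c: "coord x \<eta> l \<in> fin_sections (isotropy G x)" using coord_fin[OF x \<eta>(1) l] .
      have l1: "l1 \<in> fin_sections (source_fibre G x)"
        unfolding l1_def L_right_eq[OF x] using conv_fin_fin[OF translates_right e c] .
      have "{\<zeta> \<in> source_fibre G x. l2 \<zeta> \<noteq> \<zero>\<^bsub>R (gran G \<zeta>)\<^esub>} \<subseteq> {\<zeta> \<in> source_fibre G x. l \<zeta> \<noteq> \<zero>\<^bsub>R (gran G \<zeta>)\<^esub>}"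
        by (auto simp: l2_def)
      then have "finite {\<zeta> \<in> source_fibre G x. l2 \<zeta> \<noteq> \<zero>\<^bsub>R (gran G \<zeta>)\<^esub>}"
        using fin_sections_finite[OF l] finite_subset by blast
      moreover have "l2 \<in> (\<Pi>\<^sub>E \<zeta>\<in>source_fibre G x. carrier (R (gran G \<zeta>)))"
        using l SF_arrows[OF x] \<eta>' by (auto simp: l2_def)
      ultimately have l2: "l2 \<in> fin_sections (source_fibre G x)" by (simp add: fin_sections_def)
      have eq: "l = sec_add (source_fibre G x) l1 l2"
      proof (rule fin_sections_ext[OF l sec_add_fin[OF SF_arrows[OF x] l1 l2]])
        fix \<zeta> assume \<zeta>: "\<zeta> \<in> source_fibre G x"
        then have "\<zeta> \<in> arrows G" by (simp add: source_fibre_iff)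
        then show "l \<zeta> = sec_add (source_fibre G x) l1 l2 \<zeta>"
          using \<zeta> \<eta>' L_right_coord[OF x \<eta>(1) l \<zeta>] fin_sections_value[OF l \<zeta>]
            by (cases "gran G \<zeta> = gran G \<eta>") (simp_all add: sec_add_def l1_def l2_def e_def)
      qed
      have "frag_of (l1, m) \<in> T.K"
        unfolding l1_def
        using insert.prems(3)[OF \<eta>(1)] T.frag_zero_K[of e] e c m
        by (intro T.frag_ract_K) (auto simp: L_group_simps[OF x] Bx_simps[OF x])
      moreover have "frag_of (l2, m) \<in> T.K"
      proof (rule insert.IH[OF l2])
        show "gran G \<gamma> \<in> Z" if "\<gamma> \<in> source_fibre G x" "l2 \<gamma> \<noteq> \<zero>\<^bsub>R (gran G \<gamma>)\<^esub>" for \<gamma>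
          using that insert.prems(2)[of \<gamma>] \<eta> by (auto simp: l2_def split: if_splits)
        fix \<theta> assume \<theta>: "\<theta> \<in> source_fibre G x"
        then have \<theta>': "\<theta> \<in> arrows G" "gdom G \<theta> = x" by (auto simp: source_fibre_iff)
        have val: "gmul G \<theta> \<delta> \<in> source_fibre G x" "gran G (gmul G \<theta> \<delta>) = gran G \<theta>" "gran G \<delta> = x"
          if "\<delta> \<in> isotropy G x" for \<delta>
          using \<theta>' that by (auto simp: isotropy_iff source_fibre_iff)
        \<comment> \<open>All arrows \<theta>\<delta> have the range of \<theta>, so passing from l
          to \<open>l2\<close> either erases the whole coordinate at \<theta> or leaves it as it
          was.\<close>
        show "coord x \<theta> l2 \<odot>\<^bsub>M\<^esub> m = \<zero>\<^bsub>M\<^esub>"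
        proof (cases "gran G \<theta> = gran G \<eta>")
          case True
          have "coord x \<theta> l2 = \<zero>\<^bsub>skew_group_ring G \<O> x\<^esub>"
            using val True \<theta>' act_zero[of "ginv G \<theta>"]
            by (auto simp: Bx_simps[OF x] coord_def[OF x] sec_zero_def l2_def fun_eq_iff restrict_def)
          then show ?thesis using M.zero_smult[OF m] by simp
        next
          case False
          have "coord x \<theta> l2 = coord x \<theta> l"
            using val False by (auto simp: coord_def[OF x] l2_def fun_eq_iff restrict_def)
          then show ?thesis using insert.prems(3)[OF \<theta>] by simp
        qed
      qed
      ultimately show ?thesis
        using T.frag_mult_K[of l1 l2 m] l1 l2 m eq by (simp add: L_group_simps[OF x])
    qed
  qed
  from this[of "gran G ` {\<gamma> \<in> source_fibre G x. l \<gamma> \<noteq> \<zero>\<^bsub>R (gran G \<gamma>)\<^esub>}" l]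
  show ?thesis using fin_sections_finite[OF l] l zero by auto
qed

text \<open>From left to right, the coordinate at \<eta> acting on M is a balanced map and is
  evaluated at f applied to \<open>1\<^sub>\<gamma>\<close>. Conversely,
  \<open>a 1\<^sub>\<gamma>\<close> is \<open>1\<^sub>\<gamma>\<close> times some b, so its image
  tensored with m equals the image of \<open>1\<^sub>\<gamma>\<close> tensored with bm, and the
  coordinates of the latter image are corners, which kill bm too.\<close>

theorem Ind_annihilated_iff:
  assumes f: "f \<in> sections_on (arrows G)"
    and fin: "\<And>y. y \<in> units G \<Longrightarrow> finite {\<beta> \<in> arrows G. gdom G \<beta> = y \<and> f \<beta> \<noteq> \<zero>\<^bsub>R (gran G \<beta>)\<^esub>}"
  shows "(\<forall>X \<in> carrier (Ind G \<O> x M). f \<odot>\<^bsub>Ind G \<O> x M\<^esub> X = \<zero>\<^bsub>Ind G \<O> x M\<^esub>) \<longleftrightarrow>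
    (\<forall>\<eta> \<in> source_fibre G x. \<forall>\<gamma> \<in> source_fibre G x. \<forall>m \<in> carrier M. corner x f \<eta> \<gamma> \<odot>\<^bsub>M\<^esub> m = \<zero>\<^bsub>M\<^esub>)"
    (is "?L \<longleftrightarrow> ?R")
proof -
  let ?\<phi> = "L_left G \<O> x f" and ?SF = "source_fibre G x"
  note tl = translates_left[of x]
  note simps = L_group_simps[OF x] Bx_simps[OF x] L_left_eq[OF x]
  have \<phi>_fin: "?\<phi> l \<in> fin_sections ?SF" if "l \<in> fin_sections ?SF" for l
    unfolding L_left_eq[OF x] using conv_fin[OF tl f that fin] .
  have hom: "?\<phi> \<in> hom (L_group G \<O> x) (L_group G \<O> x)"
    using \<phi>_fin conv_add_right[OF tl f] by (auto simp: hom_def simps)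
  have comm: "?\<phi> (L_right G \<O> x l b) = L_right G \<O> x (?\<phi> l) b"
    if "l \<in> carrier (L_group G \<O> x)" "b \<in> carrier (skew_group_ring G \<O> x)" for l b
    using that L_left_L_right[OF x f] by (simp add: L_group_simps[OF x] Bx_simps[OF x])
  have "?L \<longleftrightarrow> (\<forall>l \<in> fin_sections ?SF. \<forall>m \<in> carrier M. frag_of (?\<phi> l, m) \<in> T.K)"
    using T.tensor_map_zero_iff[OF hom comm] by (simp add: Ind_def Let_def L_group_simps[OF x])
  also have "\<dots> \<longleftrightarrow> ?R"
  proof (intro iffI ballI)
    fix \<eta> \<gamma> m
    assume K: "\<forall>l \<in> fin_sections ?SF. \<forall>m \<in> carrier M. frag_of (?\<phi> l, m) \<in> T.K"
      and \<eta>: "\<eta> \<in> ?SF" and \<gamma>: "\<gamma> \<in> ?SF" and m: "m \<in> carrier M"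
    let ?e = "single ?SF \<gamma> \<one>\<^bsub>R (gran G \<gamma>)\<^esub>"
    have e: "?e \<in> fin_sections ?SF"
      using \<gamma> by (intro single_fin[OF SF_arrows[OF x]]) (auto simp: source_fibre_iff)
    have "coord x \<eta> (?\<phi> ?e) \<odot>\<^bsub>M\<^esub> m = \<one>\<^bsub>add_monoid M\<^esub>"
    proof (rule T.balanced_map_vanishes[where \<psi> = "\<lambda>l m. coord x \<eta> l \<odot>\<^bsub>M\<^esub> m"])
      show "comm_group (add_monoid M)" by (rule M.M.a_comm_group)
      show "frag_of (?\<phi> ?e, m) \<in> T.K" using K e m by blast
    qed (use coord_fin[OF x \<eta>] coord_add[OF x \<eta>] coord_L_right[OF x \<eta>] M.smult_closed M.smult_l_distr
        M.smult_r_distr M.smult_assoc in \<open>auto simp: simps\<close>)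
    then show "corner x f \<eta> \<gamma> \<odot>\<^bsub>M\<^esub> m = \<zero>\<^bsub>M\<^esub>" using corner_eq_coord[OF x f \<eta> \<gamma>] by simp
  next
    fix l m assume R: ?R and l: "l \<in> fin_sections ?SF" and m: "m \<in> carrier M"
    show "frag_of (?\<phi> l, m) \<in> T.K"
      using SF_arrows[OF x] l
    proof (induction rule: fin_sections_induct)
      case zero
      then show ?case
        using T.frag_one_K[OF m] conv_zero_right[OF tl f] by (simp add: simps)
    next
      case (single \<gamma> a)
      let ?e = "single ?SF \<gamma> \<one>\<^bsub>R (gran G \<gamma>)\<^esub>" and ?b = "single (isotropy G x) x (act \<O> (ginv G \<gamma>) a)"
      have \<gamma>: "\<gamma> \<in> arrows G" "gdom G \<gamma> = x" using single by (auto simp: source_fibre_iff)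
      have e: "?e \<in> fin_sections ?SF"
        using single \<gamma> by (intro single_fin[OF SF_arrows[OF x]]) auto
      have b: "?b \<in> fin_sections (isotropy G x)"
        using act_in_carrier[of "ginv G \<gamma>" a] single \<gamma> x
        by (intro single_fin[OF Iso_arrows[OF x] unit_Iso[OF x]]) auto
      have "frag_of (?\<phi> ?e, ?b \<odot>\<^bsub>M\<^esub> m) \<in> T.K"
        using R single(1) M.smult_closed[of ?b m] b m
        by (intro frag_K_of_coord_zero \<phi>_fin e)
          (auto simp: Bx_simps[OF x] corner_eq_coord[OF x f _ single(1), symmetric])
      then have "frag_of (L_right G \<O> x (?\<phi> ?e) ?b, m) \<in> T.K"
        using \<phi>_fin[OF e] b m by (intro T.frag_ract_K) (auto simp: L_group_simps[OF x] Bx_simps[OF x])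
      then show ?case
        using single_L_right[OF x single] comm[of ?e ?b] e b by (simp add: L_group_simps[OF x] Bx_simps[OF x])
    next
      case (add l l')
      then show ?case
        using T.frag_mult_K[of "?\<phi> l" "?\<phi> l'" m] \<phi>_fin m conv_add_right[OF tl f] by (simp add: simps)
    qed
  qed
  finally show ?thesis .
qed

end

end

section \<open>Local homeomorphisms and compact open bisections\<close>

lemma continuous_map_locally:
  assumes "\<And>x. x \<in> topspace X \<Longrightarrow> \<exists>U. openin X U \<and> x \<in> U \<and> continuous_map (subtopology X U) Y f"
  shows "continuous_map X Y f"
proof -
  obtain U where U: "\<And>x. x \<in> topspace X \<Longrightarrow> openin X (U x) \<and> x \<in> U x \<and> continuous_map (subtopology X (U x)) Y f"
    using assms by metis
  show ?thesis
    by (rule pasting_lemma[where I = "topspace X" and T = U and f = "\<lambda>_. f"]) (use U in auto)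
qed

lemma local_homeomorphism_continuous:
  assumes "local_homeomorphism X Y f" shows "continuous_map X Y f"
proof (rule continuous_map_locally)
  fix x assume "x \<in> topspace X"
  then obtain U where "openin X U" "x \<in> U" "homeomorphic_map (subtopology X U) (subtopology Y (f ` U)) f"
    using assms unfolding local_homeomorphism_def by blast
  then show "\<exists>U. openin X U \<and> x \<in> U \<and> continuous_map (subtopology X U) Y f"
    by (meson continuous_map_in_subtopology homeomorphic_imp_continuous_map)
qed

lemma local_homeomorphism_open_map:
  assumes "local_homeomorphism X Y f" shows "open_map X Y f"
  unfolding open_map_def
proof (intro allI impI)
  fix W assume W: "openin X W"
  show "openin Y (f ` W)"
  proof (subst openin_subopen, safe)
    fix x assume x: "x \<in> W"
    then have "x \<in> topspace X" using W openin_subset by blast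
    then obtain U where U: "openin X U" "x \<in> U" "openin Y (f ` U)"
        "homeomorphic_map (subtopology X U) (subtopology Y (f ` U)) f"
      using assms unfolding local_homeomorphism_def by blast
    have "openin (subtopology X U) (U \<inter> W)" using W by (simp add: openin_subtopology_Int2)
    then have "openin (subtopology Y (f ` U)) (f ` (U \<inter> W))"
      using homeomorphic_imp_open_map[OF U(4)] by (simp add: open_map_def)
    then have "openin Y (f ` (U \<inter> W))" using U(3) openin_open_subtopology by blast
    then show "\<exists>T. openin Y T \<and> f x \<in> T \<and> T \<subseteq> f ` W" using x U(2) by blast
  qed
qed

lemma local_homeomorphism_inj:
  assumes "local_homeomorphism X Y f" "x \<in> topspace X"
  obtains U where "openin X U" "x \<in> U" "inj_on f U"
proof -
  obtain U where U: "openin X U" "x \<in> U" "homeomorphic_map (subtopology X U) (subtopology Y (f ` U)) f"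
    using assms unfolding local_homeomorphism_def by blast
  have "inj_on f U"
    using homeomorphic_imp_injective_map[OF U(3)] openin_subset[OF U(1)] by (simp add: inf.absorb2)
  with U that show ?thesis by blast
qed

lemma local_homeomorphism_section:
  assumes "local_homeomorphism X Y f" "x \<in> topspace X"
  obtains N \<sigma> where "openin Y N" "f x \<in> N" "continuous_map (subtopology Y N) X \<sigma>" "\<sigma> (f x) = x"
    "\<And>y. y \<in> N \<Longrightarrow> f (\<sigma> y) = y"
proof -
  obtain U where U: "openin X U" "x \<in> U" "openin Y (f ` U)"
      "homeomorphic_map (subtopology X U) (subtopology Y (f ` U)) f"
    using assms unfolding local_homeomorphism_def by blast
  have top: "topspace (subtopology X U) = U" "topspace (subtopology Y (f ` U)) = f ` U"
    using openin_subset[OF U(1)] openin_subset[OF U(3)] by auto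
  obtain \<sigma> where \<sigma>: "homeomorphic_maps (subtopology X U) (subtopology Y (f ` U)) f \<sigma>"
    using U(4) homeomorphic_map_maps by blast
  have "continuous_map (subtopology Y (f ` U)) X \<sigma>"
    using \<sigma> unfolding homeomorphic_maps_def by (simp add: continuous_map_in_subtopology)
  then show ?thesis
    using \<sigma> U top unfolding homeomorphic_maps_def by (intro that[of "f ` U" \<sigma>]) auto
qed

text \<open>Near z both lifts stay in an open set on which f is injective, and their images under f
  coincide. The argument works in sheaf spaces and arrow spaces that are not Hausdorff.\<close>

lemma local_homeomorphism_lifts_agree:
  assumes f: "local_homeomorphism X Y f" and u: "continuous_map Z X u" and v: "continuous_map Z X v"
    and eq: "\<And>z. z \<in> topspace Z \<Longrightarrow> f (u z) = f (v z)" and z: "z \<in> topspace Z" "u z = v z"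
  obtains W where "openin Z W" "z \<in> W" "\<And>w. w \<in> W \<Longrightarrow> u w = v w"
proof -
  have "u z \<in> topspace X" using continuous_map_image_subset_topspace[OF u] z by blast
  then obtain U where U: "openin X U" "u z \<in> U" "inj_on f U"
    using local_homeomorphism_inj[OF f] by blast
  let ?W = "{w \<in> topspace Z. u w \<in> U} \<inter> {w \<in> topspace Z. v w \<in> U}"
  show ?thesis
  proof
    show "openin Z ?W" using openin_continuous_map_preimage[OF u U(1)] openin_continuous_map_preimage[OF v U(1)] by blast
    show "z \<in> ?W" using z U by auto
    show "u w = v w" if "w \<in> ?W" for w using that eq U(3) by (auto simp: inj_on_def)
  qed
qed

section \<open>Topology of an ample groupoid\<close>

context ample_groupoid
begin

lemma units_arrows: "units G \<subseteq> arrows G"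
  using unit_in_arrows by blast

lemma topspace_unit_space [simp]: "topspace (unit_space G) = units G"
  using units_arrows by (auto simp: unit_space_def arrows_def)

lemma topspace_gtop [simp]: "topspace (gtop G) = arrows G"
  by (simp add: arrows_def)

lemma continuous_ran: "continuous_map (gtop G) (unit_space G) (gran G)"
  by (rule local_homeomorphism_continuous[OF local_homeomorphism_ran])

lemma open_ran: "openin (gtop G) W \<Longrightarrow> openin (unit_space G) (gran G ` W)"
  using local_homeomorphism_open_map[OF local_homeomorphism_ran] by (simp add: open_map_def)

lemma continuous_dom: "continuous_map (gtop G) (unit_space G) (gdom G)"
proof -
  have "continuous_map (gtop G) (unit_space G) (gran G \<circ> ginv G)"
    using continuous_map_compose[OF continuous_inv continuous_ran] .
  then show ?thesis by (rule continuous_map_eq) simp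
qed

text \<open>Near a unit x, both \<gamma> and its range lie in a neighbourhood of x on which the
  range map is injective. They have the same range, hence coincide, so \<gamma> is a unit.\<close>

lemma units_open: "openin (gtop G) (units G)"
proof (subst openin_subopen, safe)
  fix x assume x: "x \<in> units G"
  then obtain U where U: "openin (gtop G) U" "x \<in> U" "inj_on (gran G) U"
    using local_homeomorphism_inj[OF local_homeomorphism_ran, of x] unit_in_arrows by auto
  have cr: "continuous_map (gtop G) (gtop G) (gran G)"
    using continuous_ran unfolding unit_space_def by (simp add: continuous_map_in_subtopology)
  let ?V = "U \<inter> {\<gamma> \<in> topspace (gtop G). gran G \<gamma> \<in> U}"
  have "openin (gtop G) ?V" using U openin_continuous_map_preimage[OF cr U(1)] by blast
  moreover have "x \<in> ?V" using x U unit_in_arrows by auto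
  moreover have "?V \<subseteq> units G"
  proof
    fix \<gamma> assume "\<gamma> \<in> ?V"
    then have "\<gamma> \<in> arrows G" "\<gamma> \<in> U" "gran G \<gamma> \<in> U" by auto
    then have "gran G \<gamma> = \<gamma>" using U(3) by (auto simp: inj_on_def)
    with \<open>\<gamma> \<in> arrows G\<close> show "\<gamma> \<in> units G" by (metis ran_in_units)
  qed
  ultimately show "\<exists>T. openin (gtop G) T \<and> x \<in> T \<and> T \<subseteq> units G" by blast
qed

lemma openin_unit_space: "openin (unit_space G) W \<longleftrightarrow> openin (gtop G) W \<and> W \<subseteq> units G"
  unfolding unit_space_def by (rule openin_open_subtopology[OF units_open])

text \<open>As the unit space is Hausdorff, these sets are also closed and form a ring of sets. They
  index the elements \<open>unit_on K\<close> by which sections are cut down.\<close>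

definition compact_opens :: "'g set set"
  where "compact_opens = {K. openin (unit_space G) K \<and> compactin (unit_space G) K}"

lemma compact_open_closed: "K \<in> compact_opens \<Longrightarrow> closedin (unit_space G) K"
  using compactin_imp_closedin[OF Hausdorff_units] by (auto simp: compact_opens_def)

lemma compact_open_units: "K \<in> compact_opens \<Longrightarrow> K \<subseteq> units G"
  by (auto simp: compact_opens_def openin_unit_space)

lemma compact_open_Int: "K \<in> compact_opens \<Longrightarrow> K' \<in> compact_opens \<Longrightarrow> K \<inter> K' \<in> compact_opens"
  using compact_Int_closedin[of "unit_space G" K K'] compact_open_closed[of K']
  by (auto simp: compact_opens_def)

lemma compact_open_Un: "K \<in> compact_opens \<Longrightarrow> K' \<in> compact_opens \<Longrightarrow> K \<union> K' \<in> compact_opens"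
  by (auto simp: compact_opens_def compactin_Un)

lemma compact_open_Diff:
  assumes "K \<in> compact_opens" "K' \<in> compact_opens" shows "K - K' \<in> compact_opens"
proof -
  have "compactin (unit_space G) (K \<inter> (topspace (unit_space G) - K'))"
    using assms closedin_topspace[of "unit_space G"]
    by (intro compact_Int_closedin closedin_diff) (auto simp: compact_opens_def)
  moreover have "K \<inter> (topspace (unit_space G) - K') = K - K'" using compact_open_units[OF assms(1)] by auto
  moreover have "openin (unit_space G) (K - K')"
    using assms compact_open_closed[OF assms(2)] by (auto simp: compact_opens_def openin_diff)
  ultimately show ?thesis by (simp add: compact_opens_def)
qed

lemma compact_open_empty: "{} \<in> compact_opens"
  by (simp add: compact_opens_def)

lemma compact_open_basis:
  assumes "openin (unit_space G) W" "x \<in> W"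
  obtains K where "K \<in> compact_opens" "x \<in> K" "K \<subseteq> W"
proof -
  obtain \<B> where \<B>: "\<forall>K \<in> \<B>. openin (unit_space G) K \<and> compact_Hausdorffin (unit_space G) K"
    "\<forall>U. openin (unit_space G) U \<longrightarrow> (\<exists>\<C> \<subseteq> \<B>. U = \<Union>\<C>)"
    using compact_open_basis_units unfolding compact_open_basis_def by blast
  then obtain \<C> where "\<C> \<subseteq> \<B>" "W = \<Union>\<C>" using assms by blast
  then obtain K where "K \<in> \<B>" "x \<in> K" "K \<subseteq> W" using assms(2) by blast
  moreover from this have "K \<in> compact_opens"
    using \<B>(1) by (simp add: compact_opens_def compact_Hausdorffin_def)
  ultimately show ?thesis using that by blast
qed

text \<open>Compactness in the form of an induction: finitely many good sets cover K, differences
  make them disjoint, and K is a subset of their union. The union case asks only for disjoint sets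
  because only cuts by disjoint sets add up.\<close>

lemma compact_open_induct [consumes 1, case_names local subset union empty]:
  assumes K: "K \<in> compact_opens"
    and loc: "\<And>x. x \<in> K \<Longrightarrow> \<exists>A \<in> compact_opens. x \<in> A \<and> P A"
    and sub: "\<And>A A'. A \<in> compact_opens \<Longrightarrow> A' \<in> compact_opens \<Longrightarrow> A' \<subseteq> A \<Longrightarrow> P A \<Longrightarrow> P A'"
    and un: "\<And>A A'. A \<in> compact_opens \<Longrightarrow> A' \<in> compact_opens \<Longrightarrow> A \<inter> A' = {} \<Longrightarrow> P A \<Longrightarrow> P A' \<Longrightarrow> P (A \<union> A')"
    and empty: "P {}"
  shows "P K"
proof -
  obtain \<U> where \<U>: "finite \<U>" "\<U> \<subseteq> {A \<in> compact_opens. P A}" "K \<subseteq> \<Union>\<U>"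
  proof -
    have "openin (unit_space G) U" if "U \<in> {A \<in> compact_opens. P A}" for U
      using that by (simp add: compact_opens_def)
    moreover have "K \<subseteq> \<Union>{A \<in> compact_opens. P A}" using loc by blast
    moreover have "compactin (unit_space G) K" using K by (simp add: compact_opens_def)
    ultimately have "\<exists>\<U>. finite \<U> \<and> \<U> \<subseteq> {A \<in> compact_opens. P A} \<and> K \<subseteq> \<Union>\<U>"
      by (intro compactinD) blast+
    then show ?thesis using that by blast
  qed
  have "\<Union>\<U> \<in> compact_opens \<and> P (\<Union>\<U>)" using \<U>(1,2)
  proof (induction \<U>)
    case empty then show ?case using assms(5) compact_open_empty by simp
  next
    case (insert A \<U>)
    then have A: "A \<in> compact_opens" "P A" and U: "\<Union>\<U> \<in> compact_opens" "P (\<Union>\<U>)" by auto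
    \<comment> \<open>The earlier union is reduced by the new set, which makes the two pieces
      disjoint without changing what they cover.\<close>
    have d: "\<Union>\<U> - A \<in> compact_opens" using compact_open_Diff A U by blast
    have "P (A \<union> (\<Union>\<U> - A))" by (rule un[OF A(1) d _ A(2) sub[OF U(1) d _ U(2)]]) auto
    then show ?case using compact_open_Un[OF A(1) U(1)] by simp
  qed
  then show ?thesis using sub[OF _ K] \<U>(3) by blast
qed

lemma compact_open_gtop:
  assumes "K \<in> compact_opens"
  shows "openin (gtop G) K" "compact_Hausdorffin (gtop G) K" "bisection G K"
proof -
  have K: "K \<subseteq> units G" using compact_open_units[OF assms] .
  show "openin (gtop G) K" using assms by (simp add: compact_opens_def openin_unit_space)
  have "compactin (gtop G) K" using assms unfolding compact_opens_def unit_space_def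
    by (simp add: compactin_subtopology)
  moreover have "Hausdorff_space (subtopology (gtop G) K)"
    using Hausdorff_space_subtopology[OF Hausdorff_units, of K] K
    by (simp add: unit_space_def subtopology_subtopology inf.absorb2)
  ultimately show "compact_Hausdorffin (gtop G) K" by (simp add: compact_Hausdorffin_def)
  show "bisection G K" using K units_arrows by (auto simp: bisection_def inj_on_def subset_iff)
qed

text \<open>The neighbourhood is shrunk until the range and domain maps are injective and then cut
  to the arrows with range in a compact open K. The range map is a homeomorphism from the result
  onto K, which transfers compactness and the Hausdorff property.\<close>

lemma compact_open_bisection_basis:
  assumes W: "openin (gtop G) W" "\<gamma> \<in> W"
  obtains U where "openin (gtop G) U" "\<gamma> \<in> U" "U \<subseteq> W" "bisection G U" "compact_Hausdorffin (gtop G) U"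
proof -
  have \<gamma>: "\<gamma> \<in> arrows G" using W openin_subset by fastforce
  obtain U where U: "openin (gtop G) U" "\<gamma> \<in> U" "openin (unit_space G) (gran G ` U)"
      "homeomorphic_map (subtopology (gtop G) U) (subtopology (unit_space G) (gran G ` U)) (gran G)"
    using local_homeomorphism_ran \<gamma> unfolding local_homeomorphism_def by (metis topspace_gtop)
  obtain V' where V': "openin (gtop G) V'" "ginv G \<gamma> \<in> V'" "inj_on (gran G) V'"
    using local_homeomorphism_inj[OF local_homeomorphism_ran, of "ginv G \<gamma>"] \<gamma> by auto
  \<comment> \<open>The domain map is inversion followed by the range map, so it is injective on the
    preimage under inversion of a set where the range map is.\<close>
  define V where "V = {\<beta> \<in> topspace (gtop G). ginv G \<beta> \<in> V'}"
  have V: "openin (gtop G) V" "\<gamma> \<in> V"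
    using openin_continuous_map_preimage[OF continuous_inv V'(1)] \<gamma> V'(2) by (auto simp: V_def)
  have Vinj: "inj_on (gdom G) V"
  proof (rule inj_onI)
    fix \<alpha> \<beta> assume *: "\<alpha> \<in> V" "\<beta> \<in> V" "gdom G \<alpha> = gdom G \<beta>"
    then have "gran G (ginv G \<alpha>) = gran G (ginv G \<beta>)" by (simp add: V_def)
    with V'(3) * have "ginv G \<alpha> = ginv G \<beta>" by (auto simp: V_def inj_on_def)
    with * show "\<alpha> = \<beta>" by (metis (no_types, lifting) V_def inv_inv mem_Collect_eq topspace_gtop)
  qed
  have "openin (gtop G) (U \<inter> V \<inter> W)" "\<gamma> \<in> U \<inter> V \<inter> W" using U V W by auto
  then obtain K where K: "K \<in> compact_opens" "gran G \<gamma> \<in> K" "K \<subseteq> gran G ` (U \<inter> V \<inter> W)"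
    using compact_open_basis[OF open_ran] by blast
  define Z where "Z = {\<beta> \<in> U. gran G \<beta> \<in> K}"
  have rinj: "inj_on (gran G) U"
    using homeomorphic_imp_injective_map[OF U(4)] openin_subset[OF U(1)] by (simp add: inf.absorb2)
  have Usub: "U \<subseteq> arrows G" using openin_subset[OF U(1)] by simp
  \<comment> \<open>Membership in V and in W is recovered from the range alone: K consists of ranges
    of arrows in the intersection, and the range map is injective on U.\<close>
  have ZW: "Z \<subseteq> U \<inter> V \<inter> W"
  proof
    fix \<beta> assume "\<beta> \<in> Z"
    then obtain \<beta>' where "\<beta>' \<in> U \<inter> V \<inter> W" "gran G \<beta> = gran G \<beta>'" using K(3) by (auto simp: Z_def)
    moreover have "\<beta> \<in> U" using \<open>\<beta> \<in> Z\<close> by (simp add: Z_def)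
    ultimately show "\<beta> \<in> U \<inter> V \<inter> W" using rinj by (metis IntD1 inj_onD)
  qed
  have rZ: "gran G ` Z = K" using K(3) by (auto simp: Z_def)
  have Zeq: "Z = U \<inter> {\<beta> \<in> topspace (gtop G). gran G \<beta> \<in> K}" using Usub by (auto simp: Z_def)
  have "openin (gtop G) Z"
    unfolding Zeq using U(1) openin_continuous_map_preimage[OF continuous_ran, of K] K(1)
    by (auto simp: compact_opens_def)
  moreover have "\<gamma> \<in> Z" using U(2) K(2) by (simp add: Z_def)
  moreover have "Z \<subseteq> W" using ZW by blast
  moreover have "bisection G Z"
    unfolding bisection_def
  proof (intro conjI)
    show "Z \<subseteq> arrows G" using Usub by (auto simp: Z_def)
    show "inj_on (gdom G) Z" "inj_on (gran G) Z"
      using Vinj rinj ZW inj_on_subset by blast+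
  qed
  moreover have "compact_Hausdorffin (gtop G) Z"
  proof -
    have hZ: "homeomorphic_map (subtopology (gtop G) Z) (subtopology (unit_space G) K) (gran G)"
    proof -
      have "homeomorphic_map (subtopology (subtopology (gtop G) U) Z)
          (subtopology (subtopology (unit_space G) (gran G ` U)) K) (gran G)"
        using Usub by (intro homeomorphic_map_subtopologies_alt[OF U(4)]) (auto simp: Z_def)
      moreover have "U \<inter> Z = Z" "gran G ` U \<inter> K = K" using ZW K(3) by auto
      ultimately show ?thesis by (simp add: subtopology_subtopology)
    qed
    have "Hausdorff_space (subtopology (unit_space G) K)"
      by (rule Hausdorff_space_subtopology[OF Hausdorff_units])
    then have "Hausdorff_space (subtopology (gtop G) Z)"
      using hZ homeomorphic_Hausdorff_space homeomorphic_map_imp_homeomorphic_space by blast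
    moreover have "compact_space (subtopology (unit_space G) K)"
      using K(1) by (simp add: compact_opens_def compact_space_subtopology)
    then have "compact_space (subtopology (gtop G) Z)"
      using hZ homeomorphic_compact_space homeomorphic_map_imp_homeomorphic_space by blast
    then have "compactin (gtop G) Z"
      using Usub ZW by (auto simp: compactin_subspace)
    ultimately show ?thesis by (simp add: compact_Hausdorffin_def)
  qed
  ultimately show ?thesis by (rule that)
qed

text \<open>Domains are ranges of inverses and inversion is a homeomorphism, so openness of the
  range map yields openness of the set of domains.\<close>

lemma bisection_image_compact_open:
  assumes "openin (gtop G) U" "compact_Hausdorffin (gtop G) U"
  shows "gran G ` U \<in> compact_opens" and "gdom G ` U \<in> compact_opens"
proof -
  have c: "compactin (gtop G) U" and U: "U \<subseteq> arrows G"
    using assms openin_subset by (fastforce simp: compact_Hausdorffin_def)+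
  show "gran G ` U \<in> compact_opens"
    using image_compactin[OF c continuous_ran] open_ran[OF assms(1)] by (simp add: compact_opens_def)
  have hom: "homeomorphic_map (gtop G) (gtop G) (ginv G)"
    unfolding homeomorphic_map_maps homeomorphic_maps_def using continuous_inv by (intro exI[of _ "ginv G"]) auto
  then have "openin (gtop G) (ginv G ` U)"
    using assms(1) homeomorphic_map_openness_eq by blast
  then have "openin (unit_space G) (gran G ` ginv G ` U)" by (rule open_ran)
  moreover have "gran G ` ginv G ` U = gdom G ` U" using U by (force simp: image_iff)
  ultimately show "gdom G ` U \<in> compact_opens"
    using image_compactin[OF c continuous_dom] by (simp add: compact_opens_def)
qed

lemma compact_open_separate:
  assumes "x \<in> units G" "finite F"
  obtains K where "K \<in> compact_opens" "x \<in> K" "K \<inter> (F - {x}) = {}"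
proof -
  have "finite (F \<inter> units G - {x})" "F \<inter> units G - {x} \<subseteq> units G" using assms(2) by auto
  then have "closedin (unit_space G) (F \<inter> units G - {x})"
    using Hausdorff_imp_t1_space[OF Hausdorff_units] by (simp add: t1_space_closedin_finite)
  then have "openin (unit_space G) (units G - (F \<inter> units G - {x}))"
    using openin_diff[OF openin_topspace, of "unit_space G"] by simp
  then obtain K where "K \<in> compact_opens" "x \<in> K" "K \<subseteq> units G - (F \<inter> units G - {x})"
    using compact_open_basis[of _ x] assms(1) by blast
  then show ?thesis by (intro that[of K]) auto
qed

end

section \<open>Sections of sheaves and the ring \<open>\<Gamma>\<^sub>c\<close>\<close>

context gsheaf
begin

lemma continuous_proj: "continuous_map (etop S) (unit_space G) (proj S)"
  by (rule local_homeomorphism_continuous[OF local_homeomorphism_proj])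

lemma stalkD: "e \<in> stalk S x \<Longrightarrow> e \<in> topspace (etop S)" "e \<in> stalk S x \<Longrightarrow> proj S e = x"
  by (auto simp: stalk_def)

lemma proj_units: "e \<in> topspace (etop S) \<Longrightarrow> proj S e \<in> units G"
  using continuous_map_image_subset_topspace[OF continuous_proj] by auto

lemma local_section:
  assumes "e \<in> stalk S x"
  obtains N \<sigma> where "openin (unit_space G) N" "x \<in> N" "continuous_map (subtopology (unit_space G) N) (etop S) \<sigma>"
    "\<sigma> x = e" "\<And>y. y \<in> N \<Longrightarrow> \<sigma> y \<in> stalk S y"
proof -
  have e: "e \<in> topspace (etop S)" "proj S e = x" using stalkD[OF assms] by auto
  obtain N \<sigma> where N: "openin (unit_space G) N" "x \<in> N" "continuous_map (subtopology (unit_space G) N) (etop S) \<sigma>"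
      "\<sigma> x = e" "\<And>y. y \<in> N \<Longrightarrow> proj S (\<sigma> y) = y"
    using local_homeomorphism_section[OF local_homeomorphism_proj e(1)] e(2) by metis
  have "\<sigma> y \<in> stalk S y" if "y \<in> N" for y
  proof -
    have "y \<in> topspace (subtopology (unit_space G) N)" using that openin_subset[OF N(1)] by auto
    then have "\<sigma> y \<in> topspace (etop S)"
      using continuous_map_image_subset_topspace[OF N(3)] by blast
    then show ?thesis using N(5)[OF that] by (simp add: stalk_def)
  qed
  with N that show ?thesis by blast
qed

lemma lifts_agree:
  assumes "continuous_map Z (etop S) u" "continuous_map Z (etop S) v"
    and "\<And>z. z \<in> topspace Z \<Longrightarrow> proj S (u z) = proj S (v z)" and "z \<in> topspace Z" "u z = v z"
  obtains W where "openin Z W" "z \<in> W" "\<And>w. w \<in> W \<Longrightarrow> u w = v w"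
  by (rule local_homeomorphism_lifts_agree[OF local_homeomorphism_proj assms]) (blast intro: that)+

lemma sections_agree:
  assumes N: "openin (unit_space G) N" and u: "continuous_map (subtopology (unit_space G) N) (etop S) u"
    and v: "continuous_map (subtopology (unit_space G) N) (etop S) v"
    and "\<And>y. y \<in> N \<Longrightarrow> u y \<in> stalk S y" "\<And>y. y \<in> N \<Longrightarrow> v y \<in> stalk S y"
    and x: "x \<in> N" "u x = v x"
  obtains K where "K \<in> compact_opens" "x \<in> K" "K \<subseteq> N" "\<And>y. y \<in> K \<Longrightarrow> u y = v y"
proof -
  have top: "topspace (subtopology (unit_space G) N) = N" using openin_subset[OF N] by auto
  obtain W where W: "openin (subtopology (unit_space G) N) W" "x \<in> W" "\<And>w. w \<in> W \<Longrightarrow> u w = v w"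
    using lifts_agree[OF u v, of x] assms(4-) top stalkD(2) by metis
  have "openin (unit_space G) W" "W \<subseteq> N"
    using W(1) N openin_open_subtopology by blast+
  with W that show ?thesis using compact_open_basis[of W x] by (metis subset_iff)
qed

lemma fibre_product_paired:
  fixes T :: "('g, 'f, 'w) gsheaf_scheme"
  assumes "continuous_map Z (etop S) u" "continuous_map Z (etop T) v"
    and "\<And>z. z \<in> topspace Z \<Longrightarrow> proj S (u z) = proj T (v z)"
  shows "continuous_map Z (fibre_product S T) (\<lambda>z. (u z, v z))"
  using assms unfolding fibre_product_def
  by (auto simp: continuous_map_in_subtopology continuous_map_pairedI)

text \<open>A local section \<sigma> through the zero at z and its double \<sigma> + \<sigma> agree
  at z, hence near z, and an element equal to its own double is zero. So the zero section is locally
  such a \<sigma>. The abstract addition lets rings and modules share the argument.\<close>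

lemma zero_section_continuous:
  fixes fadd :: "'g \<Rightarrow> 'e \<Rightarrow> 'e \<Rightarrow> 'e" and fzero :: "'g \<Rightarrow> 'e"
  assumes add: "continuous_map (fibre_product S S) (etop S) (\<lambda>(a, b). fadd (proj S a) a b)"
    and add_closed: "\<And>z e. z \<in> units G \<Longrightarrow> e \<in> stalk S z \<Longrightarrow> fadd z e e \<in> stalk S z"
    and zero: "\<And>z. z \<in> units G \<Longrightarrow> fzero z \<in> stalk S z" "\<And>z. z \<in> units G \<Longrightarrow> fadd z (fzero z) (fzero z) = fzero z"
    and idem: "\<And>z e. z \<in> units G \<Longrightarrow> e \<in> stalk S z \<Longrightarrow> fadd z e e = e \<Longrightarrow> e = fzero z"
  shows "continuous_map (unit_space G) (etop S) fzero"
proof (rule continuous_map_locally)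
  fix z assume "z \<in> topspace (unit_space G)"
  then have z: "z \<in> units G" by simp
  obtain N \<sigma> where N: "openin (unit_space G) N" "z \<in> N" "continuous_map (subtopology (unit_space G) N) (etop S) \<sigma>"
      "\<sigma> z = fzero z" "\<And>y. y \<in> N \<Longrightarrow> \<sigma> y \<in> stalk S y"
    using local_section[OF zero(1)[OF z]] by metis
  have NU: "N \<subseteq> units G" using openin_subset[OF N(1)] by simp
  have "continuous_map (subtopology (unit_space G) N) (etop S) ((\<lambda>(a, b). fadd (proj S a) a b) \<circ> (\<lambda>y. (\<sigma> y, \<sigma> y)))"
    by (rule continuous_map_compose[OF fibre_product_paired add]) (use N in auto)
  then have "continuous_map (subtopology (unit_space G) N) (etop S) (\<lambda>y. fadd y (\<sigma> y) (\<sigma> y))"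
    by (rule continuous_map_eq) (use NU N(5)[THEN stalkD(2)] in auto)
  note sum = this
  have "fadd y (\<sigma> y) (\<sigma> y) \<in> stalk S y" if "y \<in> N" for y
    using add_closed[OF _ N(5)[OF that]] NU that by blast
  moreover have "fadd z (\<sigma> z) (\<sigma> z) = \<sigma> z" using N(4) zero(2)[OF z] by simp
  ultimately obtain K where K: "K \<in> compact_opens" "z \<in> K" "K \<subseteq> N"
      "\<And>y. y \<in> K \<Longrightarrow> fadd y (\<sigma> y) (\<sigma> y) = \<sigma> y"
    using sections_agree[OF N(1) sum N(3) _ N(5) N(2)] by blast
  have "continuous_map (subtopology (unit_space G) K) (etop S) \<sigma>"
    using N(3) K(3) continuous_map_from_subtopology_mono by blast
  then have "continuous_map (subtopology (unit_space G) K) (etop S) fzero"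
    by (rule continuous_map_eq) (use K NU N(5) idem in auto)
  then show "\<exists>U. openin (unit_space G) U \<and> z \<in> U \<and> continuous_map (subtopology (unit_space G) U) (etop S) fzero"
    using K by (auto simp: compact_opens_def)
qed

text \<open>K is closed as well as open, so the two branches live on complementary open
  sets.\<close>

lemma section_extended_by_zero:
  assumes K: "K \<in> compact_opens" and s: "continuous_map (subtopology (unit_space G) K) (etop S) s"
    and zero: "continuous_map (unit_space G) (etop S) fzero"
  shows "continuous_map (unit_space G) (etop S) (\<lambda>y\<in>units G. if y \<in> K then s y else fzero y)" (is "continuous_map _ _ ?t")
proof (rule continuous_map_locally)
  fix y assume y: "y \<in> topspace (unit_space G)"
  have KU: "K \<subseteq> units G" using compact_open_units[OF K] .
  show "\<exists>U. openin (unit_space G) U \<and> y \<in> U \<and> continuous_map (subtopology (unit_space G) U) (etop S) ?t"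
  proof (cases "y \<in> K")
    case True
    have "continuous_map (subtopology (unit_space G) K) (etop S) ?t"
      using s by (rule continuous_map_eq) (use KU in auto)
    with True K show ?thesis by (auto simp: compact_opens_def)
  next
    case False
    have "openin (unit_space G) (units G - K)" using compact_open_closed[OF K] by (simp add: closedin_def)
    moreover have "continuous_map (subtopology (unit_space G) (units G - K)) (etop S) ?t"
      using continuous_map_from_subtopology[OF zero] by (rule continuous_map_eq) auto
    ultimately show ?thesis using False y by auto
  qed
qed

end

context ring_sheaf
begin

lemma zero_continuous: "continuous_map (unit_space G) (etop \<O>) (\<lambda>x. \<zero>\<^bsub>R x\<^esub>)"
proof (rule zero_section_continuous[where fadd = "\<lambda>x a b. a \<oplus>\<^bsub>R x\<^esub> b", OF continuous_add])
  fix z e assume z: "z \<in> units G" and e: "e \<in> stalk \<O> z" "e \<oplus>\<^bsub>R z\<^esub> e = e"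
  interpret ring "R z" by (rule stalk_ring[OF z])
  show "e = \<zero>\<^bsub>R z\<^esub>" using e z add.l_cancel_one'[of e e] by (simp add: carrier_ring_stalk[symmetric])
qed (simp_all add: carrier_ring_stalk[symmetric])

lemma continuous_fibre_sum:
  assumes "continuous_map Z (etop \<O>) u" "continuous_map Z (etop \<O>) v"
    and p: "\<And>z. z \<in> topspace Z \<Longrightarrow> u z \<in> stalk \<O> (w z)" "\<And>z. z \<in> topspace Z \<Longrightarrow> v z \<in> stalk \<O> (w z)"
  shows "continuous_map Z (etop \<O>) (\<lambda>z. u z \<oplus>\<^bsub>R (w z)\<^esub> v z)"
proof -
  have pw: "proj \<O> (u z) = w z" "proj \<O> (v z) = w z" if "z \<in> topspace Z" for z
    using stalkD(2)[OF p(1)[OF that]] stalkD(2)[OF p(2)[OF that]] by auto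
  have "continuous_map Z (etop \<O>) ((\<lambda>(a, b). a \<oplus>\<^bsub>R (proj \<O> a)\<^esub> b) \<circ> (\<lambda>z. (u z, v z)))"
    by (rule continuous_map_compose[OF fibre_product_paired continuous_add]) (use assms pw in auto)
  then show ?thesis by (rule continuous_map_eq) (use pw in auto)
qed

section \<open>Elements of the convolution ring\<close>

abbreviation \<Gamma> :: "('g \<Rightarrow> 'e) set" where "\<Gamma> \<equiv> carrier (Gamma_ring G \<O>)"

lemma arrows_group: "group (section_group G \<O>)"
  unfolding section_group_def using R_group by (intro product_group) auto

lemma section_group_simps:
  "carrier (section_group G \<O>) = (\<Pi>\<^sub>E \<gamma>\<in>arrows G. carrier (R (gran G \<gamma>)))"
  "\<one>\<^bsub>section_group G \<O>\<^esub> = sec_zero (arrows G)" "f \<otimes>\<^bsub>section_group G \<O>\<^esub> g = sec_add (arrows G) f g"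
  by (simp_all add: section_group_def sec_zero_def sec_add_def)

lemma Gamma_simps:
  "\<Gamma> = generate (section_group G \<O>) (Gamma_generators G \<O>)"
  "\<zero>\<^bsub>Gamma_ring G \<O>\<^esub> = sec_zero (arrows G)" "f \<oplus>\<^bsub>Gamma_ring G \<O>\<^esub> g = sec_add (arrows G) f g"
  "f \<otimes>\<^bsub>Gamma_ring G \<O>\<^esub> g = (\<lambda>\<gamma>\<in>arrows G. convolution G \<O> (arrows G) (arrows G) f g \<gamma>)"
  by (simp_all add: Gamma_ring_def section_group_simps)

lemma generators_carrier: "Gamma_generators G \<O> \<subseteq> carrier (section_group G \<O>)"
  by (auto simp: Gamma_generators_def)

lemma Gamma_subgroup: "subgroup \<Gamma> (section_group G \<O>)"
  unfolding Gamma_simps by (rule group.generate_is_subgroup[OF arrows_group generators_carrier])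

lemma Gamma_carrier: "f \<in> \<Gamma> \<Longrightarrow> f \<in> (\<Pi>\<^sub>E \<gamma>\<in>arrows G. carrier (R (gran G \<gamma>)))"
  using subgroup.subset[OF Gamma_subgroup] section_group_simps by blast

lemma Gamma_sections: "f \<in> \<Gamma> \<Longrightarrow> f \<in> sections_on (arrows G)"
  using Gamma_carrier by (auto simp: PiE_iff)

lemma Gamma_value: "f \<in> \<Gamma> \<Longrightarrow> \<gamma> \<in> arrows G \<Longrightarrow> f \<gamma> \<in> carrier (R (gran G \<gamma>))"
  using Gamma_carrier by auto

lemma generators_Gamma: "s \<in> Gamma_generators G \<O> \<Longrightarrow> s \<in> \<Gamma>"
  unfolding Gamma_simps by (rule generate.incl)

text \<open>The group is generated with inverses, hence the negation case. It is phrased as g + f =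
  0, an equation that can be read arrow by arrow.\<close>

lemma Gamma_induct [consumes 1, case_names zero gen neg add]:
  assumes f: "f \<in> \<Gamma>" and zero: "P (sec_zero (arrows G))"
    and gen: "\<And>s. s \<in> Gamma_generators G \<O> \<Longrightarrow> P s"
    and neg: "\<And>f g. f \<in> \<Gamma> \<Longrightarrow> g \<in> \<Gamma> \<Longrightarrow> P f \<Longrightarrow> sec_add (arrows G) g f = sec_zero (arrows G) \<Longrightarrow> P g"
    and add: "\<And>f g. f \<in> \<Gamma> \<Longrightarrow> g \<in> \<Gamma> \<Longrightarrow> P f \<Longrightarrow> P g \<Longrightarrow> P (sec_add (arrows G) f g)"
  shows "P f"
  using f unfolding Gamma_simps
proof (induction f rule: generate.induct)
  case one then show ?case using zero by (simp add: section_group_simps)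
next
  case (incl s) then show ?case by (rule gen)
next
  case (inv s)
  interpret group "section_group G \<O>" by (rule arrows_group)
  have s: "s \<in> carrier (section_group G \<O>)" using inv generators_carrier by blast
  show ?case
  proof (rule neg[OF generators_Gamma[OF inv] _ gen[OF inv]])
    show "inv\<^bsub>section_group G \<O>\<^esub> s \<in> \<Gamma>" unfolding Gamma_simps by (rule generate.inv[OF inv])
    show "sec_add (arrows G) (inv\<^bsub>section_group G \<O>\<^esub> s) s = sec_zero (arrows G)"
      using l_inv[OF s] by (simp add: section_group_simps)
  qed
next
  case (eng f g) then show ?case using add by (simp add: section_group_simps Gamma_simps)
qed

lemma generatorE:
  assumes "s \<in> Gamma_generators G \<O>"
  obtains U where "bisection G U" "openin (gtop G) U" "compact_Hausdorffin (gtop G) U"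
    "continuous_map (subtopology (gtop G) U) (etop \<O>) s"
    "\<And>\<gamma>. \<gamma> \<in> arrows G \<Longrightarrow> \<gamma> \<notin> U \<Longrightarrow> s \<gamma> = \<zero>\<^bsub>R (gran G \<gamma>)\<^esub>"
  using assms unfolding Gamma_generators_def by blast

lemma zero_of_neg:
  assumes "f \<in> \<Gamma>" "g \<in> \<Gamma>" "sec_add (arrows G) g f = sec_zero (arrows G)" "\<gamma> \<in> arrows G" "f \<gamma> = \<zero>\<^bsub>R (gran G \<gamma>)\<^esub>"
  shows "g \<gamma> = \<zero>\<^bsub>R (gran G \<gamma>)\<^esub>"
  using fun_cong[OF assms(3), of \<gamma>] assms Gamma_value[of g \<gamma>] by (simp add: sec_add_def sec_zero_def)

lemma zero_of_add:
  assumes "\<gamma> \<in> arrows G" "f \<gamma> = \<zero>\<^bsub>R (gran G \<gamma>)\<^esub>" "g \<gamma> = \<zero>\<^bsub>R (gran G \<gamma>)\<^esub>"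
  shows "sec_add (arrows G) f g \<gamma> = \<zero>\<^bsub>R (gran G \<gamma>)\<^esub>"
  using assms by (simp add: sec_add_def)

text \<open>A bisection meets each fibre of the domain and of the range map in at most one arrow,
  and the property passes to negatives and sums. All sums over fibres below are finite for this
  reason.\<close>

lemma Gamma_finite_fibre:
  assumes "f \<in> \<Gamma>" and q: "q = gdom G \<or> q = gran G"
  shows "finite {\<beta> \<in> arrows G. q \<beta> = y \<and> f \<beta> \<noteq> \<zero>\<^bsub>R (gran G \<beta>)\<^esub>}"
  using assms(1)
proof (induction rule: Gamma_induct)
  case zero
  have "{\<beta> \<in> arrows G. q \<beta> = y \<and> sec_zero (arrows G) \<beta> \<noteq> \<zero>\<^bsub>R (gran G \<beta>)\<^esub>} = {}" by (auto simp: sec_zero_def)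
  then show ?case by (simp only: finite.emptyI)
next
  case (gen s)
  obtain U where U: "bisection G U" "\<And>\<gamma>. \<gamma> \<in> arrows G \<Longrightarrow> \<gamma> \<notin> U \<Longrightarrow> s \<gamma> = \<zero>\<^bsub>R (gran G \<gamma>)\<^esub>"
    using generatorE[OF gen] by metis
  have "inj_on q U" using U(1) q by (auto simp: bisection_def)
  moreover have "finite (q ` {\<beta> \<in> U. q \<beta> = y})" by (rule finite_subset[of _ "{y}"]) auto
  ultimately have "finite {\<beta> \<in> U. q \<beta> = y}" by (metis (no_types, lifting) finite_imageD inj_on_subset mem_Collect_eq subsetI)
  then show ?case by (rule rev_finite_subset) (use U(2) in auto)
next
  case (neg f g)
  then show ?case by (elim rev_finite_subset) (use zero_of_neg neg in auto)
next
  case (add f g)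
  show ?case
    by (rule finite_subset[OF _ finite_UnI[OF add(3,4)]]) (use zero_of_add in auto)
qed

text \<open>One set K serves both ends of the arrows, so that cutting by K on either side leaves f
  unchanged.\<close>

lemma Gamma_support:
  assumes "f \<in> \<Gamma>"
  shows "\<exists>K \<in> compact_opens. \<forall>\<gamma> \<in> arrows G. f \<gamma> \<noteq> \<zero>\<^bsub>R (gran G \<gamma>)\<^esub> \<longrightarrow> gran G \<gamma> \<in> K \<and> gdom G \<gamma> \<in> K"
  using assms
proof (induction rule: Gamma_induct)
  case zero then show ?case using compact_open_empty by (auto simp: sec_zero_def)
next
  case (gen s)
  obtain U where U: "openin (gtop G) U" "compact_Hausdorffin (gtop G) U" 
    "\<And>\<gamma>. \<gamma> \<in> arrows G \<Longrightarrow> \<gamma> \<notin> U \<Longrightarrow> s \<gamma> = \<zero>\<^bsub>R (gran G \<gamma>)\<^esub>"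
    using generatorE[OF gen] by metis
  have "gran G ` U \<union> gdom G ` U \<in> compact_opens"
    using bisection_image_compact_open[OF U(1,2)] compact_open_Un by blast
  then show ?case using U(3) by (intro bexI[of _ "gran G ` U \<union> gdom G ` U"]) auto
next
  case (neg f g)
  then show ?case using zero_of_neg by metis
next
  case (add f g)
  then obtain K K' where
    "K \<in> compact_opens" "\<forall>\<gamma> \<in> arrows G. f \<gamma> \<noteq> \<zero>\<^bsub>R (gran G \<gamma>)\<^esub> \<longrightarrow> gran G \<gamma> \<in> K \<and> gdom G \<gamma> \<in> K"
    "K' \<in> compact_opens" "\<forall>\<gamma> \<in> arrows G. g \<gamma> \<noteq> \<zero>\<^bsub>R (gran G \<gamma>)\<^esub> \<longrightarrow> gran G \<gamma> \<in> K' \<and> gdom G \<gamma> \<in> K'"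
    by blast
  then show ?case using compact_open_Un zero_of_add by (intro bexI[of _ "K \<union> K'"]) (blast, blast)
qed

text \<open>A local section through a is pulled back along the range map and restricted to a small
  compact open bisection. The result meets each range or domain fibre in at most one nonzero value,
  so multiplication by it has only one term at each arrow.\<close>

lemma generator_through:
  assumes \<gamma>: "\<gamma> \<in> arrows G" and a: "a \<in> carrier (R (gran G \<gamma>))"
  obtains s U where "s \<in> Gamma_generators G \<O>" "bisection G U" "\<gamma> \<in> U" "s \<gamma> = a"
    "\<And>\<beta>. \<beta> \<in> arrows G \<Longrightarrow> \<beta> \<notin> U \<Longrightarrow> s \<beta> = \<zero>\<^bsub>R (gran G \<beta>)\<^esub>"
proof -
  have "a \<in> stalk \<O> (gran G \<gamma>)" using a \<gamma> by (simp add: carrier_ring_stalk)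
  from local_section[OF this] obtain N \<sigma> where N: "openin (unit_space G) N" "gran G \<gamma> \<in> N"
    "continuous_map (subtopology (unit_space G) N) (etop \<O>) \<sigma>" "\<sigma> (gran G \<gamma>) = a" "\<And>y. y \<in> N \<Longrightarrow> \<sigma> y \<in> stalk \<O> y"
    by metis
  have "openin (gtop G) {\<beta> \<in> topspace (gtop G). gran G \<beta> \<in> N}"
    by (rule openin_continuous_map_preimage[OF continuous_ran N(1)])
  then obtain U where U: "openin (gtop G) U" "\<gamma> \<in> U" "U \<subseteq> {\<beta> \<in> topspace (gtop G). gran G \<beta> \<in> N}"
      "bisection G U" "compact_Hausdorffin (gtop G) U"
    using compact_open_bisection_basis[of _ \<gamma>] \<gamma> N(2) by (metis (mono_tags, lifting) mem_Collect_eq topspace_gtop)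
  define s where "s = (\<lambda>\<beta>\<in>arrows G. if \<beta> \<in> U then \<sigma> (gran G \<beta>) else \<zero>\<^bsub>R (gran G \<beta>)\<^esub>)"
  have "continuous_map (subtopology (gtop G) U) (subtopology (unit_space G) N) (gran G)"
    using U(3) continuous_map_from_subtopology[OF continuous_ran, of U]
    by (auto simp: continuous_map_in_subtopology)
  then have "continuous_map (subtopology (gtop G) U) (etop \<O>) (\<sigma> \<circ> gran G)"
    using N(3) continuous_map_compose by blast
  then have "continuous_map (subtopology (gtop G) U) (etop \<O>) s"
    by (rule continuous_map_eq) (auto simp: s_def)
  moreover have "\<sigma> (gran G \<beta>) \<in> carrier (R (gran G \<beta>))" if "\<beta> \<in> U" for \<beta>
    using that U(3) N(5) by (subst carrier_ring_stalk) auto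
  then have "s \<in> carrier (section_group G \<O>)"
    by (auto simp: s_def section_group_simps)
  ultimately have "s \<in> Gamma_generators G \<O>"
    using U by (auto simp: Gamma_generators_def s_def)
  then show ?thesis using U \<gamma> N(4) by (intro that[of s U]) (auto simp: s_def)
qed

text \<open>The characteristic function of K with values in the sheaf. These idempotents are the
  substitute for an identity in \<open>\<Gamma>\<^sub>c\<close>.\<close>

definition unit_on :: "'g set \<Rightarrow> 'g \<Rightarrow> 'e"
  where "unit_on K = (\<lambda>\<gamma>\<in>arrows G. if \<gamma> \<in> K then \<one>\<^bsub>R (gran G \<gamma>)\<^esub> else \<zero>\<^bsub>R (gran G \<gamma>)\<^esub>)"

lemma unit_on_generator:
  assumes "K \<in> compact_opens"
  shows "unit_on K \<in> Gamma_generators G \<O>"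
proof -
  note K = compact_open_gtop[OF assms]
  have KU: "K \<subseteq> units G" by (rule compact_open_units[OF assms])
  have "continuous_map (subtopology (unit_space G) K) (etop \<O>) (\<lambda>x. \<one>\<^bsub>R x\<^esub>)"
    by (rule continuous_map_from_subtopology[OF continuous_one])
  then have "continuous_map (subtopology (gtop G) K) (etop \<O>) (\<lambda>x. \<one>\<^bsub>R x\<^esub>)"
    using KU by (simp add: unit_space_def subtopology_subtopology inf.absorb2)
  then have "continuous_map (subtopology (gtop G) K) (etop \<O>) (unit_on K)"
    by (rule continuous_map_eq) (use KU in \<open>auto simp: unit_on_def subset_iff\<close>)
  moreover have "unit_on K \<in> carrier (section_group G \<O>)"
    by (auto simp: unit_on_def section_group_simps)
  ultimately show ?thesis
    using K by (auto simp: Gamma_generators_def unit_on_def)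
qed

text \<open>The left factors of \<zeta> run through the range fibre of \<zeta>, which is that of
  \<beta>. There s is nonzero at \<beta> at most, so one term survives.\<close>

lemma Gamma_mult_left:
  assumes s: "s \<in> sections_on (arrows G)" and g: "g \<in> sections_on (arrows G)"
    and \<beta>: "\<beta> \<in> arrows G" and \<zeta>: "\<zeta> \<in> arrows G" "gran G \<zeta> = gran G \<beta>"
    and zero: "\<And>\<beta>'. \<beta>' \<in> arrows G \<Longrightarrow> gran G \<beta>' = gran G \<beta> \<Longrightarrow> \<beta>' \<noteq> \<beta> \<Longrightarrow> s \<beta>' = \<zero>\<^bsub>R (gran G \<beta>)\<^esub>"
  shows "(s \<otimes>\<^bsub>Gamma_ring G \<O>\<^esub> g) \<zeta> = s \<beta> \<otimes>\<^bsub>R (gran G \<zeta>)\<^esub> act \<O> \<beta> (g (gmul G (ginv G \<beta>) \<zeta>))"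
proof -
  interpret C: comm_monoid "add_monoid (R (gran G \<zeta>))" using R_comm_monoid[OF ran_in_units[OF \<zeta>(1)]] .
  let ?S = "{\<rho> \<in> arrows G. gdom G \<rho> = gdom G \<zeta>}" and ?\<rho> = "gmul G (ginv G \<beta>) \<zeta>"
  have \<rho>: "?\<rho> \<in> ?S" "gmul G \<zeta> (ginv G ?\<rho>) = \<beta>"
    using \<beta> \<zeta> by (simp_all add: inv_gmul)
  have cl: "conv_term s g \<zeta> \<rho> \<in> carrier (R (gran G \<zeta>))" if "\<rho> \<in> ?S" for \<rho>
    using that \<zeta> s g by (intro conv_term_closed[where A = "arrows G"]) auto
  have "convolution G \<O> (arrows G) (arrows G) s g \<zeta> = gfinsum (R (gran G \<zeta>)) (conv_term s g \<zeta>) ?S"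
    using \<zeta> s g by (intro convolution_eq) auto
  also have "\<dots> = conv_term s g \<zeta> ?\<rho>"
  proof (rule C.gfinprod_singleton[OF \<rho>(1)])
    show "conv_term s g \<zeta> ?\<rho> \<in> carrier (add_monoid (R (gran G \<zeta>)))" using cl[OF \<rho>(1)] by simp
    fix \<rho> assume r: "\<rho> \<in> ?S" "\<rho> \<noteq> ?\<rho>"
    then have r': "gmul G \<zeta> (ginv G \<rho>) \<in> arrows G" "gran G (gmul G \<zeta> (ginv G \<rho>)) = gran G \<beta>"
      "gdom G (gmul G \<zeta> (ginv G \<rho>)) = gran G \<rho>" using \<zeta> by auto
    have "gmul G \<zeta> (ginv G \<rho>) \<noteq> \<beta>"
    proof
      assume eq: "gmul G \<zeta> (ginv G \<rho>) = \<beta>"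
      have "gmul G \<beta> \<rho> = \<zeta>" using cancel(4)[of \<rho> \<zeta>] r(1) \<zeta> unfolding eq by auto
      moreover have "gdom G \<beta> = gran G \<rho>" using r'(3) unfolding eq .
      ultimately show False using cancel(1)[of \<beta> \<rho>] \<beta> r by auto
    qed
    then have "s (gmul G \<zeta> (ginv G \<rho>)) = \<zero>\<^bsub>R (gran G \<zeta>)\<^esub>" using zero[OF r'(1,2)] \<zeta> by simp
    moreover have "act \<O> (gmul G \<zeta> (ginv G \<rho>)) (g \<rho>) \<in> carrier (R (gran G \<zeta>))"
      using act_in_carrier[OF r'(1), of "g \<rho>"] r' r g \<zeta> by auto
    ultimately show "conv_term s g \<zeta> \<rho> = \<one>\<^bsub>add_monoid (R (gran G \<zeta>))\<^esub>"
      using \<zeta> \<beta> by (simp add: conv_term_def)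
  qed
  finally show ?thesis using \<rho>(2) \<zeta> by (simp add: Gamma_simps conv_term_def)
qed

lemma Gamma_mult_right:
  assumes s: "s \<in> sections_on (arrows G)" and f: "f \<in> sections_on (arrows G)"
    and \<rho>: "\<rho> \<in> arrows G" and \<zeta>: "\<zeta> \<in> arrows G" "gdom G \<zeta> = gdom G \<rho>"
    and zero: "\<And>\<rho>'. \<rho>' \<in> arrows G \<Longrightarrow> gdom G \<rho>' = gdom G \<rho> \<Longrightarrow> \<rho>' \<noteq> \<rho> \<Longrightarrow> s \<rho>' = \<zero>\<^bsub>R (gran G \<rho>')\<^esub>"
  shows "(f \<otimes>\<^bsub>Gamma_ring G \<O>\<^esub> s) \<zeta> =
    f (gmul G \<zeta> (ginv G \<rho>)) \<otimes>\<^bsub>R (gran G \<zeta>)\<^esub> act \<O> (gmul G \<zeta> (ginv G \<rho>)) (s \<rho>)"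
proof -
  interpret C: comm_monoid "add_monoid (R (gran G \<zeta>))" using R_comm_monoid[OF ran_in_units[OF \<zeta>(1)]] .
  let ?S = "{\<rho> \<in> arrows G. gdom G \<rho> = gdom G \<zeta>}"
  have cl: "conv_term f s \<zeta> \<rho> \<in> carrier (R (gran G \<zeta>))" if "\<rho> \<in> ?S" for \<rho>
    using that \<zeta> s f by (intro conv_term_closed[where A = "arrows G"]) auto
  have "convolution G \<O> (arrows G) (arrows G) f s \<zeta> = gfinsum (R (gran G \<zeta>)) (conv_term f s \<zeta>) ?S"
    using \<zeta> s f by (intro convolution_eq) auto
  also have "\<dots> = conv_term f s \<zeta> \<rho>"
  proof (rule C.gfinprod_singleton)
    show "\<rho> \<in> ?S" using \<rho> \<zeta> by simp
    then show "conv_term f s \<zeta> \<rho> \<in> carrier (add_monoid (R (gran G \<zeta>)))" using cl by simp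
    fix \<rho>' assume r: "\<rho>' \<in> ?S" "\<rho>' \<noteq> \<rho>"
    then have r': "gmul G \<zeta> (ginv G \<rho>') \<in> arrows G" "gran G (gmul G \<zeta> (ginv G \<rho>')) = gran G \<zeta>"
      "gdom G (gmul G \<zeta> (ginv G \<rho>')) = gran G \<rho>'" using \<zeta> by auto
    have "s \<rho>' = \<zero>\<^bsub>R (gran G \<rho>')\<^esub>" using zero[of \<rho>'] r \<zeta> by simp
    moreover have "f (gmul G \<zeta> (ginv G \<rho>')) \<in> carrier (R (gran G \<zeta>))" using f r' by (force simp: Pi_iff)
    ultimately show "conv_term f s \<zeta> \<rho>' = \<one>\<^bsub>add_monoid (R (gran G \<zeta>))\<^esub>"
      using \<zeta> act_zero[OF r'(1)] r' by (simp add: conv_term_def)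
  qed
  finally show ?thesis using \<zeta> by (simp add: Gamma_simps conv_term_def)
qed

definition cut :: "'g set \<Rightarrow> 'g set \<Rightarrow> ('g \<Rightarrow> 'e) \<Rightarrow> 'g \<Rightarrow> 'e"
  where "cut A B f = (\<lambda>\<zeta>\<in>arrows G. if gran G \<zeta> \<in> A \<and> gdom G \<zeta> \<in> B then f \<zeta> else \<zero>\<^bsub>R (gran G \<zeta>)\<^esub>)"

text \<open>The only unit in the range fibre of \<zeta> is its range, and the only one in its domain
  fibre is its domain, so each product has one term. With A and B compact open, a two-sided ideal
  containing f therefore contains its cuts.\<close>

lemma cut_eq:
  assumes A: "A \<subseteq> units G" and B: "B \<subseteq> units G" and f: "f \<in> sections_on (arrows G)"
  shows "cut A B f = unit_on A \<otimes>\<^bsub>Gamma_ring G \<O>\<^esub> (f \<otimes>\<^bsub>Gamma_ring G \<O>\<^esub> unit_on B)"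
proof
  fix \<zeta>
  have u: "unit_on K \<in> sections_on (arrows G)" for K by (auto simp: unit_on_def)
  have z: "unit_on K \<beta> = \<zero>\<^bsub>R (gran G \<beta>)\<^esub>"
    if "K \<subseteq> units G" "\<beta> \<in> arrows G" "\<beta> \<noteq> gran G \<beta> \<or> \<beta> \<noteq> gdom G \<beta>" for K \<beta>
    using that by (auto simp: unit_on_def subset_iff)
  have r: "(f \<otimes>\<^bsub>Gamma_ring G \<O>\<^esub> unit_on B) \<zeta> = (if gdom G \<zeta> \<in> B then f \<zeta> else \<zero>\<^bsub>R (gran G \<zeta>)\<^esub>)"
    if \<zeta>: "\<zeta> \<in> arrows G" for \<zeta>
  proof -
    have x: "gdom G \<zeta> \<in> arrows G" using \<zeta> unit_in_arrows by simp
    have f\<zeta>: "f \<zeta> \<in> carrier (R (gran G \<zeta>))" using f \<zeta> by auto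
    have "(f \<otimes>\<^bsub>Gamma_ring G \<O>\<^esub> unit_on B) \<zeta> = f \<zeta> \<otimes>\<^bsub>R (gran G \<zeta>)\<^esub> act \<O> \<zeta> (unit_on B (gdom G \<zeta>))"
      using Gamma_mult_right[OF u f x \<zeta>, of B] z[OF B] \<zeta> by (metis dom_in_units dom_unit inv_unit mul_dom)
    then show ?thesis using \<zeta> x f\<zeta> by (simp add: unit_on_def)
  qed
  have fs: "f \<otimes>\<^bsub>Gamma_ring G \<O>\<^esub> unit_on B \<in> sections_on (arrows G)" using r f by auto
  show "cut A B f \<zeta> = (unit_on A \<otimes>\<^bsub>Gamma_ring G \<O>\<^esub> (f \<otimes>\<^bsub>Gamma_ring G \<O>\<^esub> unit_on B)) \<zeta>"
  proof (cases "\<zeta> \<in> arrows G")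
    case \<zeta>: True
    have x: "gran G \<zeta> \<in> arrows G" using \<zeta> unit_in_arrows by simp
    have c: "(f \<otimes>\<^bsub>Gamma_ring G \<O>\<^esub> unit_on B) \<zeta> \<in> carrier (R (gran G \<zeta>))" using fs \<zeta> by auto
    have "(unit_on A \<otimes>\<^bsub>Gamma_ring G \<O>\<^esub> (f \<otimes>\<^bsub>Gamma_ring G \<O>\<^esub> unit_on B)) \<zeta> =
      unit_on A (gran G \<zeta>) \<otimes>\<^bsub>R (gran G \<zeta>)\<^esub> act \<O> (gran G \<zeta>)
        ((f \<otimes>\<^bsub>Gamma_ring G \<O>\<^esub> unit_on B) (gmul G (ginv G (gran G \<zeta>)) \<zeta>))"
      by (rule Gamma_mult_left[OF u fs x \<zeta>]) (use z[OF A] \<zeta> in auto)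
    moreover have "unit_on A (gran G \<zeta>) = (if gran G \<zeta> \<in> A then \<one>\<^bsub>R (gran G \<zeta>)\<^esub> else \<zero>\<^bsub>R (gran G \<zeta>)\<^esub>)"
      using x \<zeta> by (simp add: unit_on_def)
    moreover have "f \<zeta> \<in> carrier (R (gran G \<zeta>))" using f \<zeta> by auto
    ultimately show ?thesis using \<zeta> r[OF \<zeta>] by (simp add: cut_def)
  qed (simp add: cut_def Gamma_simps)
qed

end

section \<open>Germs\<close>

context ring_sheaf
begin

text \<open>The neighbourhoods are taken around the two ends and not around arrows, since these are
  the sets of arrows to which \<open>cut\<close> restricts. A property holding near (y, z) thus also
  constrains arrows far from every arrow y \<rightarrow> z, and is meaningful when there is
  none.\<close>

definition near :: "'g \<Rightarrow> 'g \<Rightarrow> ('g \<Rightarrow> bool) \<Rightarrow> bool"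
  where "near y z P \<longleftrightarrow> (\<exists>A \<in> compact_opens. \<exists>B \<in> compact_opens. z \<in> A \<and> y \<in> B \<and>
    (\<forall>\<zeta> \<in> arrows G. gran G \<zeta> \<in> A \<longrightarrow> gdom G \<zeta> \<in> B \<longrightarrow> P \<zeta>))"

lemma near_mono: "near y z P \<Longrightarrow> (\<And>\<zeta>. \<zeta> \<in> arrows G \<Longrightarrow> P \<zeta> \<Longrightarrow> Q \<zeta>) \<Longrightarrow> near y z Q"
  unfolding near_def by meson

lemma near_conj:
  assumes "near y z P" "near y z Q" shows "near y z (\<lambda>\<zeta>. P \<zeta> \<and> Q \<zeta>)"
proof -
  obtain A B A' B' where "A \<in> compact_opens" "B \<in> compact_opens" "z \<in> A" "y \<in> B"
      "\<forall>\<zeta> \<in> arrows G. gran G \<zeta> \<in> A \<longrightarrow> gdom G \<zeta> \<in> B \<longrightarrow> P \<zeta>"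
      "A' \<in> compact_opens" "B' \<in> compact_opens" "z \<in> A'" "y \<in> B'"
      "\<forall>\<zeta> \<in> arrows G. gran G \<zeta> \<in> A' \<longrightarrow> gdom G \<zeta> \<in> B' \<longrightarrow> Q \<zeta>"
    using assms unfolding near_def by (elim bexE conjE) (rule that)
  then show ?thesis
    unfolding near_def using compact_open_Int
    by (intro bexI[of _ "A \<inter> A'"] bexI[of _ "B \<inter> B'"]) auto
qed

context
  fixes y z assumes y: "y \<in> units G" and z: "z \<in> units G"
begin

lemma near_ran:
  assumes "openin (unit_space G) W" "z \<in> W" "\<And>\<zeta>. \<zeta> \<in> arrows G \<Longrightarrow> gran G \<zeta> \<in> W \<Longrightarrow> P \<zeta>"
  shows "near y z P"
proof -
  obtain A where A: "A \<in> compact_opens" "z \<in> A" "A \<subseteq> W" using compact_open_basis[OF assms(1,2)] .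
  obtain B where B: "B \<in> compact_opens" "y \<in> B" "B \<subseteq> units G"
    using compact_open_basis[of "units G" y] y by (metis openin_topspace topspace_unit_space)
  show ?thesis unfolding near_def
    by (intro bexI[OF _ A(1)] bexI[OF _ B(1)]) (use A B assms(3) in auto)
qed

lemma near_finite:
  assumes "finite F" "\<And>\<beta>. \<beta> \<in> F \<Longrightarrow> near y z (P \<beta>)"
  shows "near y z (\<lambda>\<zeta>. \<forall>\<beta>\<in>F. P \<beta> \<zeta>)"
  using assms
proof (induction F)
  case empty
  show ?case by (rule near_ran[OF openin_topspace]) (use z in auto)
next
  case (insert \<beta> F)
  then have "near y z (\<lambda>\<zeta>. P \<beta> \<zeta> \<and> (\<forall>\<beta>\<in>F. P \<beta> \<zeta>))" by (intro near_conj) auto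
  then show ?case by (rule near_mono) auto
qed

text \<open>If z is not a range of U, neither are nearby points, as the set of ranges is closed.
  Otherwise the arrow of U over z has a domain other than y; separating the two points, the arrows
  of U with range near z have domains away from y.\<close>

lemma near_bisection_avoids:
  assumes U: "bisection G U" "openin (gtop G) U" "compact_Hausdorffin (gtop G) U"
    and no: "\<And>\<beta>. \<beta> \<in> U \<Longrightarrow> gdom G \<beta> = y \<Longrightarrow> gran G \<beta> = z \<Longrightarrow> False"
  shows "near y z (\<lambda>\<zeta>. \<zeta> \<notin> U)"
proof (cases "z \<in> gran G ` U")
  case False
  have K: "gran G ` U \<in> compact_opens" by (rule bisection_image_compact_open[OF U(2,3)])
  have "openin (unit_space G) (units G - gran G ` U)"
    using compact_open_closed[OF K] by (simp add: closedin_def)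
  then show ?thesis by (rule near_ran) (use z False in auto)
next
  case True
  then obtain \<beta> where \<beta>: "\<beta> \<in> U" "gran G \<beta> = z" by auto
  have ne: "gdom G \<beta> \<noteq> y" using no \<beta> by blast
  have "\<beta> \<in> arrows G" using U(1) \<beta> by (auto simp: bisection_def)
  then obtain V V' where V: "openin (unit_space G) V" "openin (unit_space G) V'" "gdom G \<beta> \<in> V" "y \<in> V'" "disjnt V V'"
    using Hausdorff_units ne y unfolding Hausdorff_space_def by (metis dom_in_units topspace_unit_space)
  have "openin (gtop G) (U \<inter> {\<gamma> \<in> topspace (gtop G). gdom G \<gamma> \<in> V})"
    using openin_Int[OF U(2) openin_continuous_map_preimage[OF continuous_dom V(1)]] .
  then have "openin (unit_space G) (gran G ` (U \<inter> {\<gamma> \<in> topspace (gtop G). gdom G \<gamma> \<in> V}))"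
    by (rule open_ran)
  moreover have "z \<in> gran G ` (U \<inter> {\<gamma> \<in> topspace (gtop G). gdom G \<gamma> \<in> V})"
    using \<beta> V(3) \<open>\<beta> \<in> arrows G\<close> by auto
  ultimately obtain A where A: "A \<in> compact_opens" "z \<in> A" "A \<subseteq> gran G ` (U \<inter> {\<gamma> \<in> topspace (gtop G). gdom G \<gamma> \<in> V})"
    by (rule compact_open_basis)
  obtain B where B: "B \<in> compact_opens" "y \<in> B" "B \<subseteq> V'" by (rule compact_open_basis[OF V(2,4)])
  have "\<zeta> \<notin> U" if \<zeta>: "\<zeta> \<in> arrows G" "gran G \<zeta> \<in> A" "gdom G \<zeta> \<in> B" for \<zeta>
  proof
    assume "\<zeta> \<in> U"
    obtain \<gamma> where "\<gamma> \<in> U" "gdom G \<gamma> \<in> V" "gran G \<gamma> = gran G \<zeta>" using A(3) \<zeta>(2) by auto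
    moreover from this \<open>\<zeta> \<in> U\<close> have "\<gamma> = \<zeta>" using U(1) by (auto simp: bisection_def inj_on_def)
    ultimately show False using \<zeta>(3) B(3) V(5) by (auto simp: disjnt_def)
  qed
  then show ?thesis unfolding near_def
    by (intro bexI[OF _ A(1)] bexI[OF _ B(1)]) (use A B in auto)
qed

end

text \<open>This prepares a choice of one germ for each element, as a function on all units that is
  continuous near the base point. Choosing the zero section for a zero element keeps sums of germs
  over infinitely many arrows finitely supported.\<close>

lemma germ_section:
  assumes e: "e \<in> topspace (etop \<O>)"
  shows "\<exists>t. (\<forall>w \<in> units G. t w \<in> carrier (R w)) \<and> t (proj \<O> e) = e \<and>
    (\<exists>N. openin (unit_space G) N \<and> proj \<O> e \<in> N \<and> continuous_map (subtopology (unit_space G) N) (etop \<O>) t) \<and>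
    (e = \<zero>\<^bsub>R (proj \<O> e)\<^esub> \<longrightarrow> t = (\<lambda>w. \<zero>\<^bsub>R w\<^esub>))"
proof (cases "e = \<zero>\<^bsub>R (proj \<O> e)\<^esub>")
  case True
  then show ?thesis
    using proj_units[OF e] continuous_map_from_subtopology[OF zero_continuous]
    by (intro exI[of _ "\<lambda>w. \<zero>\<^bsub>R w\<^esub>"] conjI exI[of _ "units G"]) (auto intro: openin_topspace[of "unit_space G", simplified])
next
  case False
  have "e \<in> stalk \<O> (proj \<O> e)" using e by (simp add: stalk_def)
  from local_section[OF this] obtain N \<sigma> where N: "openin (unit_space G) N" "proj \<O> e \<in> N"
    "continuous_map (subtopology (unit_space G) N) (etop \<O>) \<sigma>" "\<sigma> (proj \<O> e) = e" "\<And>y. y \<in> N \<Longrightarrow> \<sigma> y \<in> stalk \<O> y"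
    by metis
  let ?t = "\<lambda>w. if w \<in> N then \<sigma> w else \<zero>\<^bsub>R w\<^esub>"
  have "continuous_map (subtopology (unit_space G) N) (etop \<O>) ?t"
    using N(3) by (rule continuous_map_eq) auto
  moreover have "?t w \<in> carrier (R w)" if "w \<in> units G" for w
    using that N(5)[of w] carrier_ring_stalk[OF that] R_simps(1)[OF that] by (cases "w \<in> N") simp_all
  ultimately show ?thesis using N False by (intro exI[of _ ?t]) auto
qed

text \<open>Near the arrows \<open>y \<rightarrow> z\<close>, an element of \<open>\<Gamma>\<^sub>c\<close> is the sum of the germs of its values on them.
  This is shown for generators and extended additively, as the elements of \<open>\<Gamma>\<^sub>c\<close> need not be
  continuous when the arrow space is not Hausdorff.\<close>

theorem Gamma_vanishes_near:
  assumes f: "f \<in> \<Gamma>" and y: "y \<in> units G" and z: "z \<in> units G"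
    and vanish: "\<And>\<beta>. \<beta> \<in> arrows G \<Longrightarrow> gdom G \<beta> = y \<Longrightarrow> gran G \<beta> = z \<Longrightarrow> f \<beta> = \<zero>\<^bsub>R z\<^esub>"
  shows "near y z (\<lambda>\<zeta>. f \<zeta> = \<zero>\<^bsub>R (gran G \<zeta>)\<^esub>)"
proof -
  have "\<exists>\<tau>. \<forall>e \<in> topspace (etop \<O>). (\<forall>w \<in> units G. \<tau> e w \<in> carrier (R w)) \<and> \<tau> e (proj \<O> e) = e \<and>
    (\<exists>N. openin (unit_space G) N \<and> proj \<O> e \<in> N \<and> continuous_map (subtopology (unit_space G) N) (etop \<O>) (\<tau> e)) \<and>
    (e = \<zero>\<^bsub>R (proj \<O> e)\<^esub> \<longrightarrow> \<tau> e = (\<lambda>w. \<zero>\<^bsub>R w\<^esub>))"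
    using germ_section by (rule bchoice[OF ballI])
  then obtain \<tau> where \<tau>: "\<And>e. e \<in> topspace (etop \<O>) \<Longrightarrow> (\<forall>w \<in> units G. \<tau> e w \<in> carrier (R w)) \<and> \<tau> e (proj \<O> e) = e \<and>
    (\<exists>N. openin (unit_space G) N \<and> proj \<O> e \<in> N \<and> continuous_map (subtopology (unit_space G) N) (etop \<O>) (\<tau> e)) \<and>
    (e = \<zero>\<^bsub>R (proj \<O> e)\<^esub> \<longrightarrow> \<tau> e = (\<lambda>w. \<zero>\<^bsub>R w\<^esub>))" by blast
  have et: "e \<in> topspace (etop \<O>)" "proj \<O> e = z" if "e \<in> carrier (R z)" for e
    using that carrier_ring_stalk[OF z] stalkD by blast+
  have \<tau>_val: "\<tau> e w \<in> carrier (R w)" if "e \<in> carrier (R z)" "w \<in> units G" for e w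
    using \<tau>[OF et(1)[OF that(1)]] that by blast
  have \<tau>_z: "\<tau> e z = e" if "e \<in> carrier (R z)" for e
    using \<tau>[OF et(1)[OF that]] et(2)[OF that] by simp
  have \<tau>_cont: "\<exists>N. openin (unit_space G) N \<and> z \<in> N \<and> continuous_map (subtopology (unit_space G) N) (etop \<O>) (\<tau> e)"
    if "e \<in> carrier (R z)" for e
    using \<tau>[OF et(1)[OF that]] et(2)[OF that] by simp
  have \<tau>_zero: "\<tau> \<zero>\<^bsub>R z\<^esub> = (\<lambda>w. \<zero>\<^bsub>R w\<^esub>)"
    using \<tau>[OF et(1)[of "\<zero>\<^bsub>R z\<^esub>"]] et(2)[of "\<zero>\<^bsub>R z\<^esub>"] z by simp
  have \<tau>_stalk: "\<tau> e w \<in> stalk \<O> w" if "e \<in> carrier (R z)" "w \<in> units G" for e w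
    using \<tau>_val[OF that] carrier_ring_stalk[OF that(2)] by simp
  \<comment> \<open>Both sides are continuous sections with the same value at z. The neighbourhood
    depends on a and b, so only finitely many such identities can be used together.\<close>
  have \<tau>_add: "near y z (\<lambda>\<zeta>. \<tau> (a \<oplus>\<^bsub>R z\<^esub> b) (gran G \<zeta>) = \<tau> a (gran G \<zeta>) \<oplus>\<^bsub>R (gran G \<zeta>)\<^esub> \<tau> b (gran G \<zeta>))"
    if ab: "a \<in> carrier (R z)" "b \<in> carrier (R z)" for a b
  proof -
    have c: "a \<oplus>\<^bsub>R z\<^esub> b \<in> carrier (R z)" using ab z by simp
    obtain N1 N2 N3 where N: "openin (unit_space G) N1" "z \<in> N1" "continuous_map (subtopology (unit_space G) N1) (etop \<O>) (\<tau> a)"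
      "openin (unit_space G) N2" "z \<in> N2" "continuous_map (subtopology (unit_space G) N2) (etop \<O>) (\<tau> b)"
      "openin (unit_space G) N3" "z \<in> N3" "continuous_map (subtopology (unit_space G) N3) (etop \<O>) (\<tau> (a \<oplus>\<^bsub>R z\<^esub> b))"
      using \<tau>_cont[OF ab(1)] \<tau>_cont[OF ab(2)] \<tau>_cont[OF c] by blast
    let ?N = "N1 \<inter> N2 \<inter> N3"
    have oN: "openin (unit_space G) ?N" and zN: "z \<in> ?N" using N by auto
    have NU: "?N \<subseteq> units G" using openin_subset[OF oN] by simp
    have cont: "continuous_map (subtopology (unit_space G) ?N) (etop \<O>) (\<tau> a)"
      "continuous_map (subtopology (unit_space G) ?N) (etop \<O>) (\<tau> b)"
      "continuous_map (subtopology (unit_space G) ?N) (etop \<O>) (\<tau> (a \<oplus>\<^bsub>R z\<^esub> b))"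
      using N(3,6,9) by (auto elim: continuous_map_from_subtopology_mono)
    have cs: "continuous_map (subtopology (unit_space G) ?N) (etop \<O>) (\<lambda>w. \<tau> a w \<oplus>\<^bsub>R w\<^esub> \<tau> b w)"
      by (rule continuous_fibre_sum[OF cont(1,2)]) (use NU \<tau>_stalk ab in auto)
    have st: "\<tau> a w \<oplus>\<^bsub>R w\<^esub> \<tau> b w \<in> stalk \<O> w" if "w \<in> ?N" for w
    proof -
      have w: "w \<in> units G" using that NU by blast
      show ?thesis using \<tau>_val[OF ab(1) w] \<tau>_val[OF ab(2) w] w by (simp flip: carrier_ring_stalk)
    qed
    have st': "\<tau> (a \<oplus>\<^bsub>R z\<^esub> b) w \<in> stalk \<O> w" if "w \<in> ?N" for w using \<tau>_stalk[OF c] that NU by blast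
    have eq: "\<tau> (a \<oplus>\<^bsub>R z\<^esub> b) z = \<tau> a z \<oplus>\<^bsub>R z\<^esub> \<tau> b z" using \<tau>_z ab c by simp
    obtain K where K: "K \<in> compact_opens" "z \<in> K" "K \<subseteq> ?N"
      "\<And>w. w \<in> K \<Longrightarrow> \<tau> (a \<oplus>\<^bsub>R z\<^esub> b) w = \<tau> a w \<oplus>\<^bsub>R w\<^esub> \<tau> b w"
      using sections_agree[OF oN cont(3) cs st' st zN eq] by blast
    show ?thesis by (rule near_ran[OF y z, of K]) (use K in \<open>auto simp: compact_opens_def\<close>)
  qed
  have "\<exists>U. \<forall>\<beta> \<in> arrows G. openin (gtop G) (U \<beta>) \<and> \<beta> \<in> U \<beta> \<and> bisection G (U \<beta>)"
  proof (rule bchoice, rule ballI)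
    fix \<beta> assume "\<beta> \<in> arrows G"
    then obtain U where "openin (gtop G) U" "\<beta> \<in> U" "bisection G U"
      using compact_open_bisection_basis[of "arrows G" \<beta>] openin_topspace[of "gtop G"] by (metis topspace_gtop)
    then show "\<exists>U. openin (gtop G) U \<and> \<beta> \<in> U \<and> bisection G U" by blast
  qed
  then obtain U where U: "\<And>\<beta>. \<beta> \<in> arrows G \<Longrightarrow> openin (gtop G) (U \<beta>)" "\<And>\<beta>. \<beta> \<in> arrows G \<Longrightarrow> \<beta> \<in> U \<beta>"
    "\<And>\<beta>. \<beta> \<in> arrows G \<Longrightarrow> bisection G (U \<beta>)" by blast
  define H where "H = {\<beta> \<in> arrows G. gdom G \<beta> = y \<and> gran G \<beta> = z}"
  \<comment> \<open>The germ of f at \<beta>, spread over the bisection \<open>U \<beta>\<close>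
    along the range map; \<open>\<Theta>\<close> adds these up. Without a Hausdorff arrow space the
    bisections of different arrows cannot always be made disjoint, so several germs may contribute
    at one \<zeta>.\<close>
  define \<theta> where "\<theta> f \<zeta> \<beta> = (if \<zeta> \<in> U \<beta> then \<tau> (f \<beta>) (gran G \<zeta>) else \<zero>\<^bsub>R (gran G \<zeta>)\<^esub>)" for f \<zeta> \<beta>
  define \<Theta> where "\<Theta> f \<zeta> = gfinsum (R (gran G \<zeta>)) (\<theta> f \<zeta>) H" for f \<zeta>
  have HA: "\<beta> \<in> arrows G" "gdom G \<beta> = y" "gran G \<beta> = z" if "\<beta> \<in> H" for \<beta> using that by (auto simp: H_def)
  have fH: "f \<beta> \<in> carrier (R z)" if "f \<in> \<Gamma>" "\<beta> \<in> H" for f \<beta>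
    using Gamma_value[OF that(1) HA(1)[OF that(2)]] HA(3)[OF that(2)] by simp
  have fin: "finite {\<beta> \<in> H. f \<beta> \<noteq> \<zero>\<^bsub>R z\<^esub>}" if "f \<in> \<Gamma>" for f
    by (rule finite_subset[OF _ Gamma_finite_fibre[OF that, of "gdom G" y]]) (auto simp: H_def)
  have \<theta>_val: "\<theta> f \<zeta> \<in> H \<rightarrow> carrier (R (gran G \<zeta>))" if "f \<in> \<Gamma>" "\<zeta> \<in> arrows G" for f \<zeta>
    using fH[OF that(1)] \<tau>_val that by (auto simp: \<theta>_def)
  have \<theta>_zero: "\<theta> f \<zeta> \<beta> = \<zero>\<^bsub>R (gran G \<zeta>)\<^esub>" if "f \<beta> = \<zero>\<^bsub>R z\<^esub>" for f \<zeta> \<beta>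
    using that \<tau>_zero by (simp add: \<theta>_def)
  have \<theta>_fin: "finite {\<beta> \<in> H. \<theta> f \<zeta> \<beta> \<noteq> \<zero>\<^bsub>R (gran G \<zeta>)\<^esub>}" if "f \<in> \<Gamma>" for f \<zeta>
    by (rule finite_subset[OF _ fin[OF that]]) (use \<theta>_zero in auto)
  have \<Theta>_zero: "\<Theta> f \<zeta> = \<zero>\<^bsub>R (gran G \<zeta>)\<^esub>" if "\<zeta> \<in> arrows G" "\<And>\<beta>. \<beta> \<in> H \<Longrightarrow> f \<beta> = \<zero>\<^bsub>R z\<^esub>" for f \<zeta>
  proof -
    interpret C: comm_monoid "add_monoid (R (gran G \<zeta>))" using R_comm_monoid[OF ran_in_units[OF that(1)]] .
    show ?thesis using C.gfinprod_one[of H "\<theta> f \<zeta>"] \<theta>_zero that(2) by (simp add: \<Theta>_def)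
  qed
  have \<Theta>_add: "near y z (\<lambda>\<zeta>. \<Theta> (sec_add (arrows G) f g) \<zeta> = \<Theta> f \<zeta> \<oplus>\<^bsub>R (gran G \<zeta>)\<^esub> \<Theta> g \<zeta>)"
    if f: "f \<in> \<Gamma>" and g: "g \<in> \<Gamma>" for f g
  proof -
    \<comment> \<open>Off this finite set f, g and f + g all vanish on \<open>H\<close> and so do
      their germs, leaving finitely many additivity conditions.\<close>
    let ?F = "{\<beta> \<in> H. f \<beta> \<noteq> \<zero>\<^bsub>R z\<^esub>} \<union> {\<beta> \<in> H. g \<beta> \<noteq> \<zero>\<^bsub>R z\<^esub>}"
    have "near y z (\<lambda>\<zeta>. \<forall>\<beta>\<in>?F. \<tau> (f \<beta> \<oplus>\<^bsub>R z\<^esub> g \<beta>) (gran G \<zeta>) = \<tau> (f \<beta>) (gran G \<zeta>) \<oplus>\<^bsub>R (gran G \<zeta>)\<^esub> \<tau> (g \<beta>) (gran G \<zeta>))"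
      by (rule near_finite[OF y z], use fin f g in simp, rule \<tau>_add) (use fH f g in auto)
    then show ?thesis
    proof (rule near_mono)
      fix \<zeta> assume \<zeta>: "\<zeta> \<in> arrows G"
        and F: "\<forall>\<beta>\<in>?F. \<tau> (f \<beta> \<oplus>\<^bsub>R z\<^esub> g \<beta>) (gran G \<zeta>) = \<tau> (f \<beta>) (gran G \<zeta>) \<oplus>\<^bsub>R (gran G \<zeta>)\<^esub> \<tau> (g \<beta>) (gran G \<zeta>)"
      interpret C: comm_monoid "add_monoid (R (gran G \<zeta>))" using R_comm_monoid[OF ran_in_units[OF \<zeta>]] .
      have t: "\<theta> (sec_add (arrows G) f g) \<zeta> \<beta> = \<theta> f \<zeta> \<beta> \<oplus>\<^bsub>R (gran G \<zeta>)\<^esub> \<theta> g \<zeta> \<beta>" if \<beta>: "\<beta> \<in> H" for \<beta>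
      proof (cases "\<beta> \<in> ?F")
        case True
        then show ?thesis using F HA[OF \<beta>] \<zeta> by (simp add: \<theta>_def sec_add_def)
      next
        case False
        then have "f \<beta> = \<zero>\<^bsub>R z\<^esub>" "g \<beta> = \<zero>\<^bsub>R z\<^esub>" using \<beta> by auto
        moreover from this have "sec_add (arrows G) f g \<beta> = \<zero>\<^bsub>R z\<^esub>" using HA[OF \<beta>] z by (simp add: sec_add_def)
        ultimately show ?thesis using \<theta>_zero \<zeta> by simp
      qed
      have "\<Theta> (sec_add (arrows G) f g) \<zeta> =
        gfinsum (R (gran G \<zeta>)) (\<lambda>\<beta>. \<theta> f \<zeta> \<beta> \<oplus>\<^bsub>R (gran G \<zeta>)\<^esub> \<theta> g \<zeta> \<beta>) H"
        unfolding \<Theta>_def using t \<theta>_val[OF f \<zeta>] \<theta>_val[OF g \<zeta>] \<zeta>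
        by (intro C.gfinprod_cong) (auto simp: Pi_iff)
      also have "\<dots> = \<Theta> f \<zeta> \<oplus>\<^bsub>R (gran G \<zeta>)\<^esub> \<Theta> g \<zeta>"
        unfolding \<Theta>_def using C.gfinprod_distrib[of H "\<theta> f \<zeta>" "\<theta> g \<zeta>"]
          \<theta>_val[OF f \<zeta>] \<theta>_val[OF g \<zeta>] \<theta>_fin f g by simp
      finally show "\<Theta> (sec_add (arrows G) f g) \<zeta> = \<Theta> f \<zeta> \<oplus>\<^bsub>R (gran G \<zeta>)\<^esub> \<Theta> g \<zeta>" .
    qed
  qed
  have "near y z (\<lambda>\<zeta>. f \<zeta> = \<Theta> f \<zeta>)" using f
  proof (induction rule: Gamma_induct)
    case zero
    have "sec_zero (arrows G) \<zeta> = \<Theta> (sec_zero (arrows G)) \<zeta>" if "\<zeta> \<in> arrows G" for \<zeta>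
      using \<Theta>_zero[OF that, of "sec_zero (arrows G)"] HA that by (auto simp: sec_zero_def)
    then show ?case by (intro near_ran[OF y z openin_topspace]) (use z in auto)
  next
    case (gen s)
    obtain V where V: "bisection G V" "openin (gtop G) V" "compact_Hausdorffin (gtop G) V"
      "continuous_map (subtopology (gtop G) V) (etop \<O>) s"
      "\<And>\<gamma>. \<gamma> \<in> arrows G \<Longrightarrow> \<gamma> \<notin> V \<Longrightarrow> s \<gamma> = \<zero>\<^bsub>R (gran G \<gamma>)\<^esub>"
      using generatorE[OF gen] by metis
    have s: "s \<in> \<Gamma>" by (rule generators_Gamma[OF gen])
    show ?case
    proof (cases "V \<inter> H = {}")
      case True
      have "near y z (\<lambda>\<zeta>. \<zeta> \<notin> V)"
        using V(1) True by (intro near_bisection_avoids[OF y z V(1-3)]) (auto simp: H_def bisection_def)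
      moreover have "s \<beta> = \<zero>\<^bsub>R z\<^esub>" if "\<beta> \<in> H" for \<beta> using V(5) True that HA[OF that] by fastforce
      ultimately show ?thesis by (elim near_mono) (use \<Theta>_zero V(5) in simp)
    next
      case False
      then obtain \<beta> where \<beta>: "\<beta> \<in> V" "\<beta> \<in> H" by blast
      note \<beta>' = HA[OF \<beta>(2)]
      have sz: "s \<gamma> = \<zero>\<^bsub>R z\<^esub>" if "\<gamma> \<in> H" "\<gamma> \<noteq> \<beta>" for \<gamma>
      proof -
        have "\<gamma> \<notin> V" using that \<beta> \<beta>' HA[OF that(1)] V(1) by (auto simp: bisection_def inj_on_def)
        then show ?thesis using V(5) HA[OF that(1)] by simp
      qed
      \<comment> \<open>A bisection contains at most one arrow y \<rightarrow> z, so the sum of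
        germs of a generator has a single term.\<close>
      have \<Theta>s: "\<Theta> s \<zeta> = \<theta> s \<zeta> \<beta>" if \<zeta>: "\<zeta> \<in> arrows G" for \<zeta>
      proof -
        interpret C: comm_monoid "add_monoid (R (gran G \<zeta>))" using R_comm_monoid[OF ran_in_units[OF \<zeta>]] .
        show ?thesis unfolding \<Theta>_def
          by (rule C.gfinprod_singleton[OF \<beta>(2)]) (use \<theta>_val[OF s \<zeta>] \<beta>(2) \<theta>_zero sz in auto)
      qed
      have sb: "s \<beta> \<in> carrier (R z)" by (rule fH[OF s \<beta>(2)])
      obtain N where N: "openin (unit_space G) N" "z \<in> N" "continuous_map (subtopology (unit_space G) N) (etop \<O>) (\<tau> (s \<beta>))"
        using \<tau>_cont[OF sb] by blast
      \<comment> \<open>On this set both s and the germ composed with the range map are continuous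
        lifts of the range map. They agree at \<beta>, hence on some W around it.\<close>
      define Z where "Z = V \<inter> U \<beta> \<inter> {\<gamma> \<in> topspace (gtop G). gran G \<gamma> \<in> N}"
      have oZ: "openin (gtop G) Z"
        unfolding Z_def using V(2) U(1)[OF \<beta>'(1)] openin_continuous_map_preimage[OF continuous_ran N(1)] by blast
      have \<beta>Z: "\<beta> \<in> Z" using \<beta> \<beta>' U(2) N(2) by (auto simp: Z_def)
      have ZA: "Z \<subseteq> arrows G" using openin_subset[OF oZ] by simp
      have topZ: "topspace (subtopology (gtop G) Z) = Z" using ZA by auto
      have c1: "continuous_map (subtopology (gtop G) Z) (etop \<O>) s"
        using V(4) by (rule continuous_map_from_subtopology_mono) (auto simp: Z_def)
      have "continuous_map (subtopology (gtop G) Z) (subtopology (unit_space G) N) (gran G)"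
        using continuous_map_from_subtopology[OF continuous_ran, of Z]
        by (auto simp: continuous_map_in_subtopology Z_def)
      from continuous_map_compose[OF this N(3)]
      have c2: "continuous_map (subtopology (gtop G) Z) (etop \<O>) (\<tau> (s \<beta>) \<circ> gran G)" .
      have pr: "proj \<O> (s \<gamma>) = proj \<O> ((\<tau> (s \<beta>) \<circ> gran G) \<gamma>)" if "\<gamma> \<in> topspace (subtopology (gtop G) Z)" for \<gamma>
      proof -
        have \<gamma>: "\<gamma> \<in> arrows G" using that ZA topZ by auto
        have "s \<gamma> \<in> stalk \<O> (gran G \<gamma>)" using Gamma_value[OF s \<gamma>] \<gamma> by (simp add: carrier_ring_stalk)
        moreover have "\<tau> (s \<beta>) (gran G \<gamma>) \<in> stalk \<O> (gran G \<gamma>)" using \<tau>_stalk[OF sb] \<gamma> by simp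
        ultimately show ?thesis using stalkD(2) by fastforce
      qed
      have "s \<beta> = (\<tau> (s \<beta>) \<circ> gran G) \<beta>" using \<tau>_z[OF sb] \<beta>' by simp
      then obtain W where W: "openin (subtopology (gtop G) Z) W" "\<beta> \<in> W" "\<And>\<gamma>. \<gamma> \<in> W \<Longrightarrow> s \<gamma> = \<tau> (s \<beta>) (gran G \<gamma>)"
        using lifts_agree[OF c1 c2 pr] \<beta>Z topZ by (metis comp_apply)
      have oW: "openin (gtop G) W" "W \<subseteq> Z" using W(1) oZ openin_open_subtopology by blast+
      show ?thesis
      \<comment> \<open>A range close to z suffices: an arrow whose range is that of some \<omega>
        in W either equals \<omega>, or lies outside both bisections, where both sides
        vanish.\<close>
      proof (rule near_ran[OF y z open_ran[OF oW(1)]])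
        show "z \<in> gran G ` W" using W(2) \<beta>' by blast
        fix \<zeta> assume \<zeta>: "\<zeta> \<in> arrows G" "gran G \<zeta> \<in> gran G ` W"
        then obtain \<omega> where \<omega>: "\<omega> \<in> W" "gran G \<zeta> = gran G \<omega>" by blast
        have "\<omega> \<in> V" "\<omega> \<in> U \<beta>" using \<omega> oW(2) by (auto simp: Z_def)
        then have "\<zeta> = \<omega>" if "\<zeta> \<in> V \<or> \<zeta> \<in> U \<beta>"
          using that \<omega>(2) V(1) U(3)[OF \<beta>'(1)] by (auto simp: bisection_def inj_on_def)
        then show "s \<zeta> = \<Theta> s \<zeta>"
          using \<Theta>s[OF \<zeta>(1)] V(5)[OF \<zeta>(1)] W(3)[OF \<omega>(1)] \<open>\<omega> \<in> U \<beta>\<close> by (auto simp: \<theta>_def)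
      qed
    qed
  next
    case (neg f g)
    \<comment> \<open>Near (y, z) both g and its sum of germs are additive inverses of the same
      element, so they coincide.\<close>
    have "near y z (\<lambda>\<zeta>. f \<zeta> = \<Theta> f \<zeta> \<and> \<Theta> (sec_add (arrows G) g f) \<zeta> = \<Theta> g \<zeta> \<oplus>\<^bsub>R (gran G \<zeta>)\<^esub> \<Theta> f \<zeta>)"
      using near_conj[OF neg(4) \<Theta>_add[OF neg(2,1)]] .
    then show ?case
    proof (rule near_mono)
      fix \<zeta> assume \<zeta>: "\<zeta> \<in> arrows G"
        and e: "f \<zeta> = \<Theta> f \<zeta> \<and> \<Theta> (sec_add (arrows G) g f) \<zeta> = \<Theta> g \<zeta> \<oplus>\<^bsub>R (gran G \<zeta>)\<^esub> \<Theta> f \<zeta>"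
      interpret C: comm_monoid "add_monoid (R (gran G \<zeta>))" using R_comm_monoid[OF ran_in_units[OF \<zeta>]] .
      have "\<Theta> (sec_add (arrows G) g f) \<zeta> = \<zero>\<^bsub>R (gran G \<zeta>)\<^esub>"
        unfolding neg(3) using \<zeta> HA by (intro \<Theta>_zero) (auto simp: sec_zero_def)
      moreover have "g \<zeta> \<oplus>\<^bsub>R (gran G \<zeta>)\<^esub> f \<zeta> = \<zero>\<^bsub>R (gran G \<zeta>)\<^esub>"
        using fun_cong[OF neg(3), of \<zeta>] \<zeta> by (simp add: sec_add_def sec_zero_def)
      moreover have "\<Theta> g \<zeta> \<in> carrier (R (gran G \<zeta>))"
        using C.gfinprod_closed[of "\<theta> g \<zeta>" H] \<theta>_val[OF neg(2) \<zeta>] by (simp add: \<Theta>_def)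
      ultimately show "g \<zeta> = \<Theta> g \<zeta>"
        using e Gamma_value[OF neg(1) \<zeta>] Gamma_value[OF neg(2) \<zeta>]
          group.right_cancel[OF R_group[OF ran_in_units[OF \<zeta>]], of "f \<zeta>" "g \<zeta>" "\<Theta> g \<zeta>"] by simp
    qed
  next
    case (add f g)
    have "near y z (\<lambda>\<zeta>. (f \<zeta> = \<Theta> f \<zeta> \<and> g \<zeta> = \<Theta> g \<zeta>) \<and>
        \<Theta> (sec_add (arrows G) f g) \<zeta> = \<Theta> f \<zeta> \<oplus>\<^bsub>R (gran G \<zeta>)\<^esub> \<Theta> g \<zeta>)"
      using near_conj[OF near_conj[OF add(3,4)] \<Theta>_add[OF add(1,2)]] .
    moreover have "sec_add (arrows G) f g \<zeta> = f \<zeta> \<oplus>\<^bsub>R (gran G \<zeta>)\<^esub> g \<zeta>" if "\<zeta> \<in> arrows G" for \<zeta>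
      using that by (simp add: sec_add_def)
    ultimately show ?case by (elim near_mono) simp
  qed
  then show ?thesis by (rule near_mono) (use \<Theta>_zero vanish HA in simp)
qed

end

section \<open>Sheaves of modules\<close>

lemma mem_annihilator_iff:
  "f \<in> carrier A \<Longrightarrow> f \<in> annihilator A N \<longleftrightarrow> (\<forall>m \<in> carrier N. f \<odot>\<^bsub>N\<^esub> m = \<zero>\<^bsub>N\<^esub>)"
  by (simp add: annihilator_def)

lemma (in ring_sheaf) Ind_Gamma_annihilated_iff:
  assumes x: "x \<in> units G" and M: "left_module (skew_group_ring G \<O> x) M" and f: "f \<in> \<Gamma>"
  shows "f \<in> annihilator (Gamma_ring G \<O>) (Ind G \<O> x M) \<longleftrightarrow>
    (\<forall>\<eta> \<in> source_fibre G x. \<forall>\<gamma> \<in> source_fibre G x. \<forall>m \<in> carrier M. corner x f \<eta> \<gamma> \<odot>\<^bsub>M\<^esub> m = \<zero>\<^bsub>M\<^esub>)"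
  unfolding mem_annihilator_iff[OF f]
  by (rule Ind_annihilated_iff[OF x M Gamma_sections[OF f]], rule Gamma_finite_fibre[OF f], simp)

context module_sheaf
begin

abbreviation Mst :: "'g \<Rightarrow> ('e, 'f) module" where "Mst \<equiv> module_stalk \<M>"

lemma Mod_comm_group: "x \<in> units G \<Longrightarrow> comm_group (add_monoid (Mst x))"
  using stalk_module abelian_group.a_comm_group by (fastforce simp: left_module_def)

lemma Mod_carrier: "x \<in> units G \<Longrightarrow> m \<in> carrier (Mst x) \<longleftrightarrow> m \<in> stalk \<M> x"
  by (simp add: carrier_module_stalk)

context
  fixes x assumes x: "x \<in> units G"
begin

interpretation left_module "\<O>.R x" "Mst x" by (rule stalk_module[OF x])

lemmas Mod_simps [simp] =
  M.zero_closed M.a_closed M.l_zero M.r_zero smult_closed zero_smult smult_zero smult_one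
lemmas Mod_laws = smult_l_distr smult_r_distr smult_assoc

end

lemma
  assumes "\<gamma> \<in> arrows G"
  shows mact_closed [simp]: "m \<in> carrier (Mst (gdom G \<gamma>)) \<Longrightarrow> act \<M> \<gamma> m \<in> carrier (Mst (gran G \<gamma>))"
    and mact_add: "m \<in> carrier (Mst (gdom G \<gamma>)) \<Longrightarrow> n \<in> carrier (Mst (gdom G \<gamma>)) \<Longrightarrow>
      act \<M> \<gamma> (m \<oplus>\<^bsub>Mst (gdom G \<gamma>)\<^esub> n) = act \<M> \<gamma> m \<oplus>\<^bsub>Mst (gran G \<gamma>)\<^esub> act \<M> \<gamma> n"
    and mact_smult: "a \<in> carrier (\<O>.R (gdom G \<gamma>)) \<Longrightarrow> m \<in> carrier (Mst (gdom G \<gamma>)) \<Longrightarrow>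
      act \<M> \<gamma> (a \<odot>\<^bsub>Mst (gdom G \<gamma>)\<^esub> m) = act \<O> \<gamma> a \<odot>\<^bsub>Mst (gran G \<gamma>)\<^esub> act \<M> \<gamma> m"
  using assms \<M>.act_closed[OF assms] act_add[OF assms] act_smult[OF assms]
  by (simp_all add: Mod_carrier \<O>.carrier_ring_stalk)

lemma mact_hom: "\<gamma> \<in> arrows G \<Longrightarrow>
    act \<M> \<gamma> \<in> hom (add_monoid (Mst (gdom G \<gamma>))) (add_monoid (Mst (gran G \<gamma>)))"
  by (auto simp: hom_def mact_add)

lemma mact_zero [simp]: "\<gamma> \<in> arrows G \<Longrightarrow> act \<M> \<gamma> \<zero>\<^bsub>Mst (gdom G \<gamma>)\<^esub> = \<zero>\<^bsub>Mst (gran G \<gamma>)\<^esub>"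
  using hom_one[OF mact_hom, of \<gamma>] comm_group.axioms(2)[OF Mod_comm_group[of "gdom G \<gamma>"]]
    comm_group.axioms(2)[OF Mod_comm_group[of "gran G \<gamma>"]] by simp

lemma mact_mul: "\<beta> \<in> arrows G \<Longrightarrow> \<gamma> \<in> arrows G \<Longrightarrow> gdom G \<beta> = gran G \<gamma> \<Longrightarrow> m \<in> carrier (Mst (gdom G \<gamma>)) \<Longrightarrow>
    act \<M> (gmul G \<beta> \<gamma>) m = act \<M> \<beta> (act \<M> \<gamma> m)"
  by (rule \<M>.act_gmul) (simp_all add: Mod_carrier)

lemma mact_unit [simp]: "x \<in> units G \<Longrightarrow> m \<in> carrier (Mst x) \<Longrightarrow> act \<M> x m = m"
  by (simp add: Mod_carrier \<M>.act_unit_stalk)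

lemma mact_inv_cancel:
  assumes "\<gamma> \<in> arrows G"
  shows "m \<in> carrier (Mst (gran G \<gamma>)) \<Longrightarrow> act \<M> \<gamma> (act \<M> (ginv G \<gamma>) m) = m"
  using mact_mul[of \<gamma> "ginv G \<gamma>" m] assms by auto

lemma mzero_continuous: "continuous_map (unit_space G) (etop \<M>) (\<lambda>x. \<zero>\<^bsub>Mst x\<^esub>)"
proof (rule \<M>.zero_section_continuous[where fadd = "\<lambda>x a b. a \<oplus>\<^bsub>Mst x\<^esub> b", OF continuous_add])
  fix z e assume z: "z \<in> units G" and e: "e \<in> stalk \<M> z" "e \<oplus>\<^bsub>Mst z\<^esub> e = e"
  interpret left_module "\<O>.R z" "Mst z" by (rule stalk_module[OF z])
  show "e = \<zero>\<^bsub>Mst z\<^esub>" using e z M.add.l_cancel_one'[of e e] by (simp add: Mod_carrier[symmetric])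
qed (simp_all add: Mod_carrier[symmetric])

subsection \<open>The stalks as modules over the skew group rings\<close>

context
  fixes x assumes x: "x \<in> units G"
begin

abbreviation (input) "SM \<equiv> stalk_skew_module G \<M> x"
abbreviation (input) "Iso \<equiv> isotropy G x"

interpretation Mx: comm_group "add_monoid (Mst x)" by (rule Mod_comm_group[OF x])
interpretation Bx: ring "skew_group_ring G \<O> x" by (rule \<O>.Bx_ring[OF x])

lemma SM_simps:
  "carrier SM = carrier (Mst x)" "\<zero>\<^bsub>SM\<^esub> = \<zero>\<^bsub>Mst x\<^esub>" "m \<oplus>\<^bsub>SM\<^esub> n = m \<oplus>\<^bsub>Mst x\<^esub> n"
  "b \<odot>\<^bsub>SM\<^esub> m = gfinsum (Mst x) (\<lambda>\<delta>. b \<delta> \<odot>\<^bsub>Mst x\<^esub> act \<M> \<delta> m) Iso"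
  by (simp_all add: stalk_skew_module_def)

lemma IsoD: "\<delta> \<in> Iso \<Longrightarrow> \<delta> \<in> arrows G" "\<delta> \<in> Iso \<Longrightarrow> gdom G \<delta> = x" "\<delta> \<in> Iso \<Longrightarrow> gran G \<delta> = x"
  by (auto simp: \<O>.isotropy_iff)

lemma SM_term:
  assumes "b \<in> \<O>.fin_sections Iso" "m \<in> carrier (Mst x)" "\<delta> \<in> Iso"
  shows "b \<delta> \<in> carrier (\<O>.R x)" "act \<M> \<delta> m \<in> carrier (Mst x)"
    "b \<delta> \<odot>\<^bsub>Mst x\<^esub> act \<M> \<delta> m \<in> carrier (Mst x)"
proof -
  show b: "b \<delta> \<in> carrier (\<O>.R x)" using \<O>.fin_sections_value[OF assms(1,3)] IsoD[OF assms(3)] by simp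
  show "act \<M> \<delta> m \<in> carrier (Mst x)" using mact_closed[of \<delta> m] IsoD[OF assms(3)] assms(2) by simp
  with b show "b \<delta> \<odot>\<^bsub>Mst x\<^esub> act \<M> \<delta> m \<in> carrier (Mst x)" using x by simp
qed

lemma SM_finite:
  assumes "b \<in> \<O>.fin_sections Iso" "m \<in> carrier (Mst x)"
  shows "finite {\<delta> \<in> Iso. b \<delta> \<odot>\<^bsub>Mst x\<^esub> act \<M> \<delta> m \<noteq> \<zero>\<^bsub>Mst x\<^esub>}"
  by (rule finite_subset[OF _ \<O>.fin_sections_finite[OF assms(1)]])
    (use SM_term(2)[OF assms] IsoD x in auto)

lemma SM_single:
  assumes "\<delta> \<in> Iso" "a \<in> carrier (\<O>.R x)" "m \<in> carrier (Mst x)"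
  shows "\<O>.single Iso \<delta> a \<odot>\<^bsub>SM\<^esub> m = a \<odot>\<^bsub>Mst x\<^esub> act \<M> \<delta> m"
proof -
  have s: "\<O>.single Iso \<delta> a \<in> \<O>.fin_sections Iso"
    using assms IsoD by (intro \<O>.single_fin) auto
  show ?thesis
    using Mx.gfinprod_singleton[of \<delta> Iso "\<lambda>\<delta>'. \<O>.single Iso \<delta> a \<delta>' \<odot>\<^bsub>Mst x\<^esub> act \<M> \<delta>' m"]
      SM_term[OF s assms(3)] assms x IsoD by (simp add: SM_simps \<O>.single_def)
qed

lemma SM_smult_closed: "b \<in> \<O>.fin_sections Iso \<Longrightarrow> m \<in> carrier (Mst x) \<Longrightarrow> b \<odot>\<^bsub>SM\<^esub> m \<in> carrier (Mst x)"
  using Mx.gfinprod_closed[of "\<lambda>\<delta>. b \<delta> \<odot>\<^bsub>Mst x\<^esub> act \<M> \<delta> m" Iso] SM_term by (simp add: SM_simps)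

lemma SM_add_l:
  assumes b: "b \<in> \<O>.fin_sections Iso" and c: "c \<in> \<O>.fin_sections Iso" and m: "m \<in> carrier (Mst x)"
  shows "\<O>.sec_add Iso b c \<odot>\<^bsub>SM\<^esub> m = b \<odot>\<^bsub>SM\<^esub> m \<oplus>\<^bsub>Mst x\<^esub> c \<odot>\<^bsub>SM\<^esub> m"
proof -
  have "\<O>.sec_add Iso b c \<odot>\<^bsub>SM\<^esub> m =
    gfinsum (Mst x) (\<lambda>\<delta>. b \<delta> \<odot>\<^bsub>Mst x\<^esub> act \<M> \<delta> m \<oplus>\<^bsub>Mst x\<^esub> c \<delta> \<odot>\<^bsub>Mst x\<^esub> act \<M> \<delta> m) Iso"
    unfolding SM_simps
    by (rule Mx.gfinprod_cong)
      (use SM_term[OF b m] SM_term[OF c m] x IsoD in \<open>auto simp: \<O>.sec_add_def simp_implies_def Mod_laws\<close>)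
  also have "\<dots> = b \<odot>\<^bsub>SM\<^esub> m \<oplus>\<^bsub>Mst x\<^esub> c \<odot>\<^bsub>SM\<^esub> m"
    unfolding SM_simps
    using Mx.gfinprod_distrib[of Iso "\<lambda>\<delta>. b \<delta> \<odot>\<^bsub>Mst x\<^esub> act \<M> \<delta> m" "\<lambda>\<delta>. c \<delta> \<odot>\<^bsub>Mst x\<^esub> act \<M> \<delta> m"]
      SM_finite[OF b m] SM_finite[OF c m] SM_term[OF b m] SM_term[OF c m] by simp
  finally show ?thesis .
qed

lemma SM_add_r:
  assumes b: "b \<in> \<O>.fin_sections Iso" and m: "m \<in> carrier (Mst x)" and n: "n \<in> carrier (Mst x)"
  shows "b \<odot>\<^bsub>SM\<^esub> (m \<oplus>\<^bsub>Mst x\<^esub> n) = b \<odot>\<^bsub>SM\<^esub> m \<oplus>\<^bsub>Mst x\<^esub> b \<odot>\<^bsub>SM\<^esub> n"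
proof -
  have t: "b \<delta> \<odot>\<^bsub>Mst x\<^esub> act \<M> \<delta> (m \<oplus>\<^bsub>Mst x\<^esub> n) =
      b \<delta> \<odot>\<^bsub>Mst x\<^esub> act \<M> \<delta> m \<oplus>\<^bsub>Mst x\<^esub> b \<delta> \<odot>\<^bsub>Mst x\<^esub> act \<M> \<delta> n" if \<delta>: "\<delta> \<in> Iso" for \<delta>
    using SM_term[OF b m \<delta>] SM_term[OF b n \<delta>] mact_add[of \<delta> m n] IsoD[OF \<delta>] m n x
    by (simp add: Mod_laws)
  have "b \<odot>\<^bsub>SM\<^esub> (m \<oplus>\<^bsub>Mst x\<^esub> n) =
    gfinsum (Mst x) (\<lambda>\<delta>. b \<delta> \<odot>\<^bsub>Mst x\<^esub> act \<M> \<delta> m \<oplus>\<^bsub>Mst x\<^esub> b \<delta> \<odot>\<^bsub>Mst x\<^esub> act \<M> \<delta> n) Iso"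
    unfolding SM_simps
    by (rule Mx.gfinprod_cong) (use SM_term[OF b m] SM_term[OF b n] t x in \<open>auto simp: simp_implies_def\<close>)
  also have "\<dots> = b \<odot>\<^bsub>SM\<^esub> m \<oplus>\<^bsub>Mst x\<^esub> b \<odot>\<^bsub>SM\<^esub> n"
    unfolding SM_simps
    using Mx.gfinprod_distrib[of Iso "\<lambda>\<delta>. b \<delta> \<odot>\<^bsub>Mst x\<^esub> act \<M> \<delta> m" "\<lambda>\<delta>. b \<delta> \<odot>\<^bsub>Mst x\<^esub> act \<M> \<delta> n"]
      SM_finite[OF b m] SM_finite[OF b n] SM_term[OF b m] SM_term[OF b n] by simp
  finally show ?thesis .
qed

lemma SM_zero_l: "m \<in> carrier (Mst x) \<Longrightarrow> \<O>.sec_zero Iso \<odot>\<^bsub>SM\<^esub> m = \<zero>\<^bsub>Mst x\<^esub>"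
  unfolding SM_simps
  using Mx.gfinprod_one[of Iso "\<lambda>\<delta>. \<O>.sec_zero Iso \<delta> \<odot>\<^bsub>Mst x\<^esub> act \<M> \<delta> m"]
    SM_term(2)[OF \<O>.sec_zero_fin[OF \<O>.Iso_arrows[OF x]]] IsoD x by (simp add: \<O>.sec_zero_def)

lemma SM_zero_r:
  assumes b: "b \<in> \<O>.fin_sections Iso" shows "b \<odot>\<^bsub>SM\<^esub> \<zero>\<^bsub>Mst x\<^esub> = \<zero>\<^bsub>Mst x\<^esub>"
proof -
  have "b \<delta> \<odot>\<^bsub>Mst x\<^esub> act \<M> \<delta> \<zero>\<^bsub>Mst x\<^esub> = \<zero>\<^bsub>Mst x\<^esub>" if \<delta>: "\<delta> \<in> Iso" for \<delta>
    using mact_zero[of \<delta>] IsoD[OF \<delta>] SM_term(1)[OF b _ \<delta>, of "\<zero>\<^bsub>Mst x\<^esub>"] x by simp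
  then show ?thesis
    unfolding SM_simps using Mx.gfinprod_one[of Iso "\<lambda>\<delta>. b \<delta> \<odot>\<^bsub>Mst x\<^esub> act \<M> \<delta> \<zero>\<^bsub>Mst x\<^esub>"] by simp
qed

text \<open>Compatibility with products is additive in b and in c, so it reduces to single entries
  at \<delta> and \<epsilon>. There it follows from functoriality of the sheaf action and its
  semilinearity over the ring sheaf.\<close>

lemma SM_left_module: "left_module (skew_group_ring G \<O> x) SM"
proof -
  have A: "Iso \<subseteq> arrows G" by (rule \<O>.Iso_arrows[OF x])
  note t = \<O>.translates_isotropy[of x]
  have add: "abelian_group SM"
  proof -
    interpret left_module "\<O>.R x" "Mst x" by (rule stalk_module[OF x])
    show ?thesis
    proof (rule abelian_groupI)
      show "\<exists>n\<in>carrier SM. n \<oplus>\<^bsub>SM\<^esub> m = \<zero>\<^bsub>SM\<^esub>" if "m \<in> carrier SM" for m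
        using that M.l_neg[of m] M.a_inv_closed[of m] by (auto simp: SM_simps(1-3))
    qed (use x in \<open>auto simp: SM_simps(1-3) M.a_assoc intro: M.a_comm\<close>)
  qed
  have assoc: "\<O>.conv Iso Iso Iso b c \<odot>\<^bsub>SM\<^esub> m = b \<odot>\<^bsub>SM\<^esub> (c \<odot>\<^bsub>SM\<^esub> m)"
    if b: "b \<in> \<O>.fin_sections Iso" and c: "c \<in> \<O>.fin_sections Iso" and m: "m \<in> carrier (Mst x)" for b c m
    using A c
  proof (induction rule: \<O>.fin_sections_induct)
    case zero
    then show ?case
      using \<O>.conv_zero_right[OF t \<O>.fin_sections_sections[OF b]] SM_zero_l[OF m] SM_zero_r[OF b] by simp
  next
    case (single \<epsilon> a')
    note \<epsilon> = IsoD[OF single(1)]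
    have a': "a' \<in> carrier (\<O>.R x)" using single \<epsilon> by simp
    have c: "\<O>.single Iso \<epsilon> a' \<in> \<O>.fin_sections Iso" by (rule \<O>.single_fin[OF A single])
    have cm: "\<O>.single Iso \<epsilon> a' \<odot>\<^bsub>SM\<^esub> m = a' \<odot>\<^bsub>Mst x\<^esub> act \<M> \<epsilon> m"
      by (rule SM_single[OF single(1) a' m])
    have em: "act \<M> \<epsilon> m \<in> carrier (Mst x)" using mact_closed[of \<epsilon> m] \<epsilon> m by simp
    have cmc: "\<O>.single Iso \<epsilon> a' \<odot>\<^bsub>SM\<^esub> m \<in> carrier (Mst x)" by (rule SM_smult_closed[OF c m])
    show ?case using A b
    proof (induction rule: \<O>.fin_sections_induct)
      case zero
      then show ?case
        using \<O>.conv_zero_left[OF t \<O>.fin_sections_sections[OF c]] SM_zero_l[OF m] SM_zero_l[OF cmc] by simp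
    next
      case s: (single \<delta> a)
      note \<delta> = IsoD[OF s(1)]
      have a: "a \<in> carrier (\<O>.R x)" using s \<delta> by simp
      have \<delta>\<epsilon>: "gmul G \<delta> \<epsilon> \<in> Iso" using \<delta> \<epsilon> by (simp add: \<O>.isotropy_iff)
      have aa: "act \<O> \<delta> a' \<in> carrier (\<O>.R x)" using \<O>.act_in_carrier[of \<delta> a'] \<delta> a' by simp
      have dem: "act \<M> \<delta> (act \<M> \<epsilon> m) \<in> carrier (Mst x)" using mact_closed[of \<delta> "act \<M> \<epsilon> m"] \<delta> em by simp
      have "\<O>.conv Iso Iso Iso (\<O>.single Iso \<delta> a) (\<O>.single Iso \<epsilon> a') \<odot>\<^bsub>SM\<^esub> m =
        \<O>.single Iso (gmul G \<delta> \<epsilon>) (a \<otimes>\<^bsub>\<O>.R x\<^esub> act \<O> \<delta> a') \<odot>\<^bsub>SM\<^esub> m"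
        using \<O>.conv_single_single[OF x t s(1) \<delta>(2) single(1) \<delta>\<epsilon> s(2) a'] \<delta> by simp
      also have "\<dots> = (a \<otimes>\<^bsub>\<O>.R x\<^esub> act \<O> \<delta> a') \<odot>\<^bsub>Mst x\<^esub> act \<M> (gmul G \<delta> \<epsilon>) m"
        using a aa x by (intro SM_single \<delta>\<epsilon> m) simp
      also have "\<dots> = a \<odot>\<^bsub>Mst x\<^esub> (act \<O> \<delta> a' \<odot>\<^bsub>Mst x\<^esub> act \<M> \<delta> (act \<M> \<epsilon> m))"
        using mact_mul[of \<delta> \<epsilon> m] a aa x \<delta> \<epsilon> m dem by (simp add: Mod_laws)
      also have "\<dots> = a \<odot>\<^bsub>Mst x\<^esub> act \<M> \<delta> (a' \<odot>\<^bsub>Mst x\<^esub> act \<M> \<epsilon> m)"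
        using mact_smult[of \<delta> a' "act \<M> \<epsilon> m"] \<delta> a' em by simp
      also have "\<dots> = \<O>.single Iso \<delta> a \<odot>\<^bsub>SM\<^esub> (\<O>.single Iso \<epsilon> a' \<odot>\<^bsub>SM\<^esub> m)"
        using SM_single[OF s(1) a cmc] cm by simp
      finally show ?case .
    next
      case (add b b')
      then show ?case
        using \<O>.conv_add_left[OF t _ _ c, of b b'] SM_add_l[OF _ _ m] SM_add_l[OF _ _ cmc]
          \<O>.conv_fin_fin[OF t _ c] by (simp add: \<O>.fin_sections_sections)
    qed
  next
    case (add c c')
    then show ?case
      using \<O>.conv_add_right[OF t \<O>.fin_sections_sections[OF b]] SM_add_l[OF _ _ m] SM_add_r[OF b]
        SM_smult_closed[OF _ m] \<O>.conv_fin_fin[OF t b] by simp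
  qed
  have one: "\<one>\<^bsub>skew_group_ring G \<O> x\<^esub> \<odot>\<^bsub>SM\<^esub> m = m" if m: "m \<in> carrier (Mst x)" for m
    using SM_single[OF \<O>.unit_Iso[OF x] _ m, of "\<one>\<^bsub>\<O>.R x\<^esub>"] m x by (simp add: \<O>.Bx_simps[OF x])
  show ?thesis
    unfolding left_module_def left_module_axioms_def
    using \<O>.Bx_ring[OF x] add SM_smult_closed SM_add_l SM_add_r assoc one
    by (simp add: \<O>.Bx_simps[OF x] SM_simps(1-3))
qed

end

section \<open>Both annihilators as vanishing of sums over arrows with fixed ends\<close>

text \<open>The value at \<open>z\<close> of \<open>f s\<close> for a section \<open>s\<close> with value \<open>m\<close> at \<open>y\<close> that vanishes at the other
  domains of the support of \<open>f\<close> over \<open>z\<close>.\<close>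

definition transport_sum :: "('g \<Rightarrow> 'e) \<Rightarrow> 'g \<Rightarrow> 'g \<Rightarrow> 'f \<Rightarrow> 'f"
  where "transport_sum f y z m = gfinsum (Mst z) (\<lambda>\<beta>. f \<beta> \<odot>\<^bsub>Mst z\<^esub> act \<M> \<beta> m)
    {\<beta> \<in> arrows G. gdom G \<beta> = y \<and> gran G \<beta> = z}"

lemma transport_term:
  assumes "f \<in> \<O>.\<Gamma>" "\<beta> \<in> arrows G" "m \<in> carrier (Mst (gdom G \<beta>))"
  shows "f \<beta> \<odot>\<^bsub>Mst (gran G \<beta>)\<^esub> act \<M> \<beta> m \<in> carrier (Mst (gran G \<beta>))"
    "f \<beta> = \<zero>\<^bsub>\<O>.R (gran G \<beta>)\<^esub> \<Longrightarrow> f \<beta> \<odot>\<^bsub>Mst (gran G \<beta>)\<^esub> act \<M> \<beta> m = \<zero>\<^bsub>Mst (gran G \<beta>)\<^esub>"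
  using \<O>.Gamma_value[OF assms(1,2)] mact_closed[OF assms(2,3)] assms(2) by simp_all

text \<open>The substitution \<open>\<beta> = \<eta>\<delta>\<gamma>\<^sup>-\<^sup>1\<close> is a
  bijection from the isotropy group onto the arrows from the range of \<gamma> to that of \<eta>. As
  \<open>\<eta>\<^sup>-\<^sup>1\<beta>\<gamma> = \<delta>\<close>, transport along
  \<open>\<eta>\<^sup>-\<^sup>1\<close> matches the summands.\<close>

lemma corner_smult:
  assumes f: "f \<in> \<O>.\<Gamma>" and x: "x \<in> units G" and \<eta>: "\<eta> \<in> source_fibre G x" and \<gamma>: "\<gamma> \<in> source_fibre G x"
    and m: "m \<in> carrier (Mst x)"
  shows "\<O>.corner x f \<eta> \<gamma> \<odot>\<^bsub>stalk_skew_module G \<M> x\<^esub> m =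
    act \<M> (ginv G \<eta>) (transport_sum f (gran G \<gamma>) (gran G \<eta>) (act \<M> \<gamma> m))"
proof -
  let ?H = "{\<beta> \<in> arrows G. gdom G \<beta> = gran G \<gamma> \<and> gran G \<beta> = gran G \<eta>}" and ?z = "gran G \<eta>"
  let ?h = "\<lambda>\<delta>. gmul G (gmul G \<eta> \<delta>) (ginv G \<gamma>)"
  let ?t = "\<lambda>\<beta>. f \<beta> \<odot>\<^bsub>Mst ?z\<^esub> act \<M> \<beta> (act \<M> \<gamma> m)"
  have \<eta>': "\<eta> \<in> arrows G" "gdom G \<eta> = x" and \<gamma>': "\<gamma> \<in> arrows G" "gdom G \<gamma> = x"
    using \<eta> \<gamma> by (auto simp: \<O>.source_fibre_iff)
  have gm: "act \<M> \<gamma> m \<in> carrier (Mst (gran G \<gamma>))" using mact_closed[of \<gamma> m] \<gamma>' m by simp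
  interpret X: comm_group "add_monoid (Mst x)" by (rule Mod_comm_group[OF x])
  have Z: "comm_group (add_monoid (Mst ?z))" using Mod_comm_group \<eta>' by simp
  have tc: "?t \<beta> \<in> carrier (Mst ?z)" if "\<beta> \<in> ?H" for \<beta>
    using transport_term(1)[OF f, of \<beta> "act \<M> \<gamma> m"] that gm by simp
  have tf: "finite {\<beta> \<in> ?H. ?t \<beta> \<noteq> \<zero>\<^bsub>Mst ?z\<^esub>}"
  proof (rule finite_subset[OF _ \<O>.Gamma_finite_fibre[OF f, of "gran G" ?z]])
    show "{\<beta> \<in> ?H. ?t \<beta> \<noteq> \<zero>\<^bsub>Mst ?z\<^esub>} \<subseteq> {\<beta> \<in> arrows G. gran G \<beta> = ?z \<and> f \<beta> \<noteq> \<zero>\<^bsub>\<O>.R (gran G \<beta>)\<^esub>}"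
    proof
      fix \<beta> assume \<beta>: "\<beta> \<in> {\<beta> \<in> ?H. ?t \<beta> \<noteq> \<zero>\<^bsub>Mst ?z\<^esub>}"
      then have "f \<beta> \<noteq> \<zero>\<^bsub>\<O>.R (gran G \<beta>)\<^esub>"
        using transport_term(2)[OF f, of \<beta> "act \<M> \<gamma> m"] gm by auto
      with \<beta> show "\<beta> \<in> {\<beta> \<in> arrows G. gran G \<beta> = ?z \<and> f \<beta> \<noteq> \<zero>\<^bsub>\<O>.R (gran G \<beta>)\<^esub>}" by auto
    qed
  qed simp
  have hom: "act \<M> (ginv G \<eta>) \<in> hom (add_monoid (Mst ?z)) (add_monoid (Mst x))"
    using mact_hom[of "ginv G \<eta>"] \<eta>' by simp
  have hH: "?h ` isotropy G x = ?H"
  proof (intro equalityI subsetI)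
    fix \<beta> assume \<beta>: "\<beta> \<in> ?H"
    then have "gmul G \<eta> (gmul G (gmul G (ginv G \<eta>) \<beta>) \<gamma>) = gmul G \<beta> \<gamma>"
      using \<O>.gmul_assoc[of \<eta> "gmul G (ginv G \<eta>) \<beta>" \<gamma>] \<eta>' \<gamma>' by simp
    then have "?h (gmul G (gmul G (ginv G \<eta>) \<beta>) \<gamma>) = \<beta>" using \<beta> \<gamma>' by simp
    moreover have "gmul G (gmul G (ginv G \<eta>) \<beta>) \<gamma> \<in> isotropy G x"
      using \<beta> \<eta>' \<gamma>' by (auto simp: \<O>.isotropy_iff)
    ultimately show "\<beta> \<in> ?h ` isotropy G x" by (metis (no_types, lifting) imageI)
  qed (use \<eta>' \<gamma>' in \<open>auto simp: \<O>.isotropy_iff\<close>)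
  have inj: "inj_on ?h (isotropy G x)"
  proof (rule inj_on_inverseI[where g = "\<lambda>\<beta>. gmul G (ginv G \<eta>) (gmul G \<beta> \<gamma>)"])
    fix \<delta> assume "\<delta> \<in> isotropy G x"
    then show "gmul G (ginv G \<eta>) (gmul G (?h \<delta>) \<gamma>) = \<delta>"
      using \<eta>' \<gamma>' by (auto simp: \<O>.isotropy_iff)
  qed
  have term_eq: "\<O>.corner x f \<eta> \<gamma> \<delta> \<odot>\<^bsub>Mst x\<^esub> act \<M> \<delta> m = act \<M> (ginv G \<eta>) (?t (?h \<delta>))"
    if \<delta>: "\<delta> \<in> isotropy G x" for \<delta>
  proof -
    have \<delta>': "\<delta> \<in> arrows G" "gdom G \<delta> = x" "gran G \<delta> = x" using \<delta> by (auto simp: \<O>.isotropy_iff)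
    have h: "?h \<delta> \<in> arrows G" "gdom G (?h \<delta>) = gran G \<gamma>" "gran G (?h \<delta>) = gran G \<eta>"
      using \<delta>' \<eta>' \<gamma>' by auto
    have hg: "gmul G (?h \<delta>) \<gamma> = gmul G \<eta> \<delta>" using \<delta>' \<eta>' \<gamma>' by simp
    have e1: "act \<M> (ginv G \<eta>) (?t (?h \<delta>)) =
        act \<O> (ginv G \<eta>) (f (?h \<delta>)) \<odot>\<^bsub>Mst x\<^esub> act \<M> (ginv G \<eta>) (act \<M> (?h \<delta>) (act \<M> \<gamma> m))"
      using mact_smult[of "ginv G \<eta>" "f (?h \<delta>)" "act \<M> (?h \<delta>) (act \<M> \<gamma> m)"] \<eta>' h gm
        \<O>.Gamma_value[OF f h(1)] mact_closed[of "?h \<delta>" "act \<M> \<gamma> m"] by simp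
    have e2: "act \<M> (?h \<delta>) (act \<M> \<gamma> m) = act \<M> (gmul G \<eta> \<delta>) m"
      using mact_mul[of "?h \<delta>" \<gamma> m] h \<gamma>' m hg by simp
    have e3: "act \<M> (ginv G \<eta>) (act \<M> (gmul G \<eta> \<delta>) m) = act \<M> \<delta> m"
      using mact_mul[of "ginv G \<eta>" "gmul G \<eta> \<delta>" m] \<eta>' \<delta>' m by simp
    have "\<O>.corner x f \<eta> \<gamma> \<delta> \<odot>\<^bsub>Mst x\<^esub> act \<M> \<delta> m =
        act \<O> (ginv G \<eta>) (f (?h \<delta>)) \<odot>\<^bsub>Mst x\<^esub> act \<M> (ginv G \<eta>) (act \<M> (?h \<delta>) (act \<M> \<gamma> m))"
      unfolding e2 e3 using \<delta> by (simp add: \<O>.corner_def[OF x])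
    then show ?thesis using e1 by (rule trans[OF _ sym])
  qed
  have tcx: "act \<M> (ginv G \<eta>) (?t \<beta>) \<in> carrier (Mst x)" if "\<beta> \<in> ?H" for \<beta>
    using mact_closed[of "ginv G \<eta>" "?t \<beta>"] tc[OF that] \<eta>' by simp
  have "act \<M> (ginv G \<eta>) (transport_sum f (gran G \<gamma>) ?z (act \<M> \<gamma> m)) =
    gfinsum (Mst x) (\<lambda>\<beta>. act \<M> (ginv G \<eta>) (?t \<beta>)) ?H"
    unfolding transport_sum_def
    by (rule gfinprod_hom[OF Z X.comm_group_axioms hom]) (use tc tf in simp_all)
  also have "\<dots> = gfinsum (Mst x) (\<lambda>\<delta>. act \<M> (ginv G \<eta>) (?t (?h \<delta>))) (isotropy G x)"
    unfolding hH[symmetric] by (rule X.gfinprod_reindex[OF inj]) (use tcx hH in auto)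
  also have "\<dots> = gfinsum (Mst x) (\<lambda>\<delta>. \<O>.corner x f \<eta> \<gamma> \<delta> \<odot>\<^bsub>Mst x\<^esub> act \<M> \<delta> m) (isotropy G x)"
    by (rule X.gfinprod_cong) (use term_eq tcx hH in \<open>auto simp: simp_implies_def\<close>)
  finally show ?thesis by (simp add: SM_simps[OF x])
qed

text \<open>Corners at x are transports of such sums between points of the orbit of x. Conversely,
  for given y and z take x = y and the column of the unit y, and undo the transport along an arrow y
  \<rightarrow> z; if there is none, the sum is empty.\<close>

lemma Ind_stalks_annihilated_iff:
  assumes f: "f \<in> \<O>.\<Gamma>"
  shows "(\<forall>x \<in> units G. f \<in> annihilator (Gamma_ring G \<O>) (Ind G \<O> x (stalk_skew_module G \<M> x))) \<longleftrightarrow>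
    (\<forall>y \<in> units G. \<forall>z \<in> units G. \<forall>m \<in> carrier (Mst y). transport_sum f y z m = \<zero>\<^bsub>Mst z\<^esub>)" (is "?L \<longleftrightarrow> ?R")
proof -
  let ?SM = "\<lambda>x. stalk_skew_module G \<M> x"
  have Ind: "f \<in> annihilator (Gamma_ring G \<O>) (Ind G \<O> x (?SM x)) \<longleftrightarrow>
      (\<forall>\<eta> \<in> source_fibre G x. \<forall>\<gamma> \<in> source_fibre G x. \<forall>m \<in> carrier (Mst x). \<O>.corner x f \<eta> \<gamma> \<odot>\<^bsub>?SM x\<^esub> m = \<zero>\<^bsub>Mst x\<^esub>)"
    if x: "x \<in> units G" for x
    using \<O>.Ind_Gamma_annihilated_iff[OF x SM_left_module[OF x] f] unfolding SM_simps(1,2)[OF x] .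
  show ?thesis
  proof
    assume R: ?R
    show ?L
    proof
      fix x assume x: "x \<in> units G"
      have "\<O>.corner x f \<eta> \<gamma> \<odot>\<^bsub>?SM x\<^esub> m = \<zero>\<^bsub>Mst x\<^esub>"
        if "\<eta> \<in> source_fibre G x" "\<gamma> \<in> source_fibre G x" "m \<in> carrier (Mst x)" for \<eta> \<gamma> m
        using corner_smult[OF f x that] R that mact_closed[of \<gamma> m] mact_zero[of "ginv G \<eta>"]
        by (simp add: \<O>.source_fibre_iff)
      then show "f \<in> annihilator (Gamma_ring G \<O>) (Ind G \<O> x (?SM x))" using Ind[OF x] by blast
    qed
  next
    assume L: ?L
    show ?R
    proof (intro ballI)
      fix y z m assume y: "y \<in> units G" and z: "z \<in> units G" and m: "m \<in> carrier (Mst y)"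
      interpret Z: comm_group "add_monoid (Mst z)" by (rule Mod_comm_group[OF z])
      have closed: "transport_sum f y z m \<in> carrier (Mst z)"
        unfolding transport_sum_def
        using Z.gfinprod_closed[of "\<lambda>\<beta>. f \<beta> \<odot>\<^bsub>Mst z\<^esub> act \<M> \<beta> m" "{\<beta> \<in> arrows G. gdom G \<beta> = y \<and> gran G \<beta> = z}"]
          transport_term(1)[OF f] m by auto
      show "transport_sum f y z m = \<zero>\<^bsub>Mst z\<^esub>"
      proof (cases "\<exists>\<eta> \<in> arrows G. gdom G \<eta> = y \<and> gran G \<eta> = z")
        case True
        then obtain \<eta> where \<eta>: "\<eta> \<in> arrows G" "gdom G \<eta> = y" "gran G \<eta> = z" by blast
        have "act \<M> (ginv G \<eta>) (transport_sum f y z m) = \<zero>\<^bsub>Mst y\<^esub>"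
          using corner_smult[OF f y, of \<eta> y m] L Ind[OF y] \<eta> y m \<O>.unit_SF[OF y]
          by (simp add: \<O>.source_fibre_iff)
        then have "act \<M> \<eta> (act \<M> (ginv G \<eta>) (transport_sum f y z m)) = \<zero>\<^bsub>Mst z\<^esub>"
          using mact_zero[OF \<eta>(1)] \<eta> by simp
        then show ?thesis using mact_inv_cancel[OF \<eta>(1)] closed \<eta> by simp
      next
        case False
        then show ?thesis
          unfolding transport_sum_def
          using Z.gfinprod_one[of "{\<beta> \<in> arrows G. gdom G \<beta> = y \<and> gran G \<beta> = z}" "\<lambda>\<beta>. f \<beta> \<odot>\<^bsub>Mst z\<^esub> act \<M> \<beta> m"]
          by auto
      qed
    qed
  qed
qed

text \<open>A local section through m is restricted to a compact open set that avoids the other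
  points of F and is extended by zero.\<close>

lemma global_section_through:
  assumes y: "y \<in> units G" and m: "m \<in> carrier (Mst y)" and F: "finite F"
  obtains s where "s \<in> carrier (Gamma_module G \<O> \<M>)" "s y = m"
    "\<And>w. w \<in> units G \<Longrightarrow> w \<in> F \<Longrightarrow> w \<noteq> y \<Longrightarrow> s w = \<zero>\<^bsub>Mst w\<^esub>"
proof -
  have "m \<in> stalk \<M> y" using m y by (simp add: Mod_carrier)
  from \<M>.local_section[OF this] obtain N \<sigma> where N: "openin (unit_space G) N" "y \<in> N"
    "continuous_map (subtopology (unit_space G) N) (etop \<M>) \<sigma>" "\<sigma> y = m" "\<And>w. w \<in> N \<Longrightarrow> \<sigma> w \<in> stalk \<M> w"
    by metis
  obtain K1 where K1: "K1 \<in> \<O>.compact_opens" "y \<in> K1" "K1 \<subseteq> N" using \<O>.compact_open_basis[OF N(1,2)] .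
  obtain K2 where K2: "K2 \<in> \<O>.compact_opens" "y \<in> K2" "K2 \<inter> (F - {y}) = {}"
    using \<O>.compact_open_separate[OF y F] .
  define K where "K = K1 \<inter> K2"
  have K: "K \<in> \<O>.compact_opens" "y \<in> K" "K \<subseteq> N" "K \<inter> (F - {y}) = {}"
    using K1 K2 \<O>.compact_open_Int by (auto simp: K_def)
  have KU: "K \<subseteq> units G" by (rule \<O>.compact_open_units[OF K(1)])
  define s where "s = (\<lambda>w\<in>units G. if w \<in> K then \<sigma> w else \<zero>\<^bsub>Mst w\<^esub>)"
  have cont: "continuous_map (unit_space G) (etop \<M>) s"
    unfolding s_def
    by (rule \<M>.section_extended_by_zero[OF K(1) continuous_map_from_subtopology_mono[OF N(3) K(3)] mzero_continuous])
  have st: "s w \<in> stalk \<M> w" if "w \<in> units G" for w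
    using that K(3) N(5) Mod_simps(1)[OF that] Mod_carrier[OF that] by (auto simp: s_def)
  \<comment> \<open>Where s meets the zero section it agrees with it nearby. The support is
    therefore closed, and inside K it is compact.\<close>
  have "openin (unit_space G) {w \<in> units G. s w = \<zero>\<^bsub>Mst w\<^esub>}"
  proof (subst openin_subopen, safe)
    fix w assume w: "w \<in> units G" "s w = \<zero>\<^bsub>Mst w\<^esub>"
    have oU: "openin (unit_space G) (units G)" using openin_topspace[of "unit_space G"] by simp
    have zst: "\<zero>\<^bsub>Mst v\<^esub> \<in> stalk \<M> v" if "v \<in> units G" for v
      using that by (simp add: Mod_carrier[symmetric])
    obtain W where "W \<in> \<O>.compact_opens" "w \<in> W" "\<And>v. v \<in> W \<Longrightarrow> s v = \<zero>\<^bsub>Mst v\<^esub>"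
      by (rule \<M>.sections_agree[OF oU continuous_map_from_subtopology[OF cont]
          continuous_map_from_subtopology[OF mzero_continuous] st zst w]) (assumption | rule that)+
    then show "\<exists>T. openin (unit_space G) T \<and> w \<in> T \<and> T \<subseteq> {w \<in> units G. s w = \<zero>\<^bsub>Mst w\<^esub>}"
      using \<O>.compact_open_units[of W] by (intro exI[of _ W]) (auto simp: \<O>.compact_opens_def)
  qed
  then have "closedin (unit_space G) (units G - {w \<in> units G. s w = \<zero>\<^bsub>Mst w\<^esub>})"
    using openin_closedin_eq[of "unit_space G" "{w \<in> units G. s w = \<zero>\<^bsub>Mst w\<^esub>}"] by simp
  then have "compactin (unit_space G) (K \<inter> (units G - {w \<in> units G. s w = \<zero>\<^bsub>Mst w\<^esub>}))"
    using K(1) by (intro compact_Int_closedin) (auto simp: \<O>.compact_opens_def)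
  moreover have "K \<inter> (units G - {w \<in> units G. s w = \<zero>\<^bsub>Mst w\<^esub>}) = {w \<in> units G. s w \<noteq> \<zero>\<^bsub>Mst w\<^esub>}"
    using KU by (auto simp: s_def)
  ultimately have "compact_Hausdorffin (unit_space G) {w \<in> units G. s w \<noteq> \<zero>\<^bsub>Mst w\<^esub>}"
    using Hausdorff_space_subtopology[OF \<O>.Hausdorff_units] by (simp add: compact_Hausdorffin_def)
  then have "s \<in> carrier (Gamma_module G \<O> \<M>)"
    using cont \<M>.stalkD(2)[OF st] by (simp add: Gamma_module_def) (simp add: s_def)
  moreover have "s y = m" using y K(2) N(4) by (simp add: s_def)
  moreover have "s w = \<zero>\<^bsub>Mst w\<^esub>" if "w \<in> units G" "w \<in> F" "w \<noteq> y" for w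
    using that K(4) by (auto simp: s_def)
  ultimately show ?thesis by (rule that)
qed

text \<open>Grouped by domains, the value of fs at z is a finite sum of transport sums applied to
  the values of s. Conversely, a section with value m at y and zero at the remaining domains
  isolates the transport sum for y.\<close>

lemma Gamma_module_annihilated_iff:
  assumes f: "f \<in> \<O>.\<Gamma>"
  shows "f \<in> annihilator (Gamma_ring G \<O>) (Gamma_module G \<O> \<M>) \<longleftrightarrow>
    (\<forall>y \<in> units G. \<forall>z \<in> units G. \<forall>m \<in> carrier (Mst y). transport_sum f y z m = \<zero>\<^bsub>Mst z\<^esub>)" (is "?L \<longleftrightarrow> ?R")
proof -
  let ?\<Gamma>M = "Gamma_module G \<O> \<M>"
  let ?t = "\<lambda>s z \<gamma>. f \<gamma> \<odot>\<^bsub>Mst z\<^esub> act \<M> \<gamma> (s (gdom G \<gamma>))"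
  have ann: "?L \<longleftrightarrow> (\<forall>s \<in> carrier ?\<Gamma>M. \<forall>z \<in> units G. gfinsum (Mst z) (?t s z) (range_fibre G z) = \<zero>\<^bsub>Mst z\<^esub>)"
    using f by (auto simp: annihilator_def Gamma_module_def fun_eq_iff restrict_def)
  have sec: "s w \<in> carrier (Mst w)" if "s \<in> carrier ?\<Gamma>M" "w \<in> units G" for s w
  proof -
    have "continuous_map (unit_space G) (etop \<M>) s" "proj \<M> (s w) = w"
      using that by (auto simp: Gamma_module_def)
    then have "s w \<in> stalk \<M> w"
      using that(2) continuous_map_image_subset_topspace[of "unit_space G" "etop \<M>" s] by (auto simp: stalk_def)
    then show ?thesis using that by (simp add: Mod_carrier)
  qed
  have tc: "?t s z \<gamma> \<in> carrier (Mst z)" if "s \<in> carrier ?\<Gamma>M" "\<gamma> \<in> range_fibre G z" for s z \<gamma>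
    using transport_term(1)[OF f, of \<gamma> "s (gdom G \<gamma>)"] sec[OF that(1)] that by (auto simp: range_fibre_def)
  show ?thesis
    unfolding ann
  proof (intro iffI ballI)
    fix s z assume R: ?R and s: "s \<in> carrier ?\<Gamma>M" and z: "z \<in> units G"
    interpret Z: comm_group "add_monoid (Mst z)" by (rule Mod_comm_group[OF z])
    define S where "S = {\<gamma> \<in> arrows G. gran G \<gamma> = z \<and> f \<gamma> \<noteq> \<zero>\<^bsub>\<O>.R (gran G \<gamma>)\<^esub>}"
    have S: "finite S" "S \<subseteq> range_fibre G z"
      using \<O>.Gamma_finite_fibre[OF f, of "gran G" z] by (auto simp: S_def range_fibre_def)
    have off: "?t s z \<gamma> = \<zero>\<^bsub>Mst z\<^esub>" if "\<gamma> \<in> range_fibre G z - S" for \<gamma>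
      using that transport_term(2)[OF f, of \<gamma> "s (gdom G \<gamma>)"] sec[OF s] by (auto simp: S_def range_fibre_def)
    \<comment> \<open>The finitely many arrows over z that matter, sorted by their domain.\<close>
    define A where "A y = {\<gamma> \<in> S. gdom G \<gamma> = y}" for y
    have inner: "finprod (add_monoid (Mst z)) (?t s z) (A y) = \<zero>\<^bsub>Mst z\<^esub>" if y: "y \<in> gdom G ` S" for y
    proof -
      have yu: "y \<in> units G" using y by (auto simp: S_def)
      have "finprod (add_monoid (Mst z)) (?t s z) (A y) = gfinsum (Mst z) (?t s z) (A y)"
        using S tc[OF s] by (intro Z.gfinprod_eq_finprod[symmetric]) (auto simp: A_def)
      also have "\<dots> = gfinsum (Mst z) (\<lambda>\<beta>. f \<beta> \<odot>\<^bsub>Mst z\<^esub> act \<M> \<beta> (s y)) {\<beta> \<in> arrows G. gdom G \<beta> = y \<and> gran G \<beta> = z}"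
      proof (rule Z.gfinprod_mono_neutral_cong_left)
        show "A y \<subseteq> {\<beta> \<in> arrows G. gdom G \<beta> = y \<and> gran G \<beta> = z}" by (auto simp: A_def S_def)
        fix \<beta> assume \<beta>: "\<beta> \<in> {\<beta> \<in> arrows G. gdom G \<beta> = y \<and> gran G \<beta> = z} - A y"
        then have "\<beta> \<in> range_fibre G z - S" by (auto simp: A_def range_fibre_def)
        then show "f \<beta> \<odot>\<^bsub>Mst z\<^esub> act \<M> \<beta> (s y) = \<one>\<^bsub>add_monoid (Mst z)\<^esub>" using off[of \<beta>] \<beta> by simp
      next
        show "(\<lambda>\<beta>. f \<beta> \<odot>\<^bsub>Mst z\<^esub> act \<M> \<beta> (s y)) \<in> {\<beta> \<in> arrows G. gdom G \<beta> = y \<and> gran G \<beta> = z} \<rightarrow> carrier (add_monoid (Mst z))"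
          using transport_term(1)[OF f] sec[OF s yu] by auto
      qed (auto simp: A_def)
      also have "\<dots> = \<zero>\<^bsub>Mst z\<^esub>" using R yu z sec[OF s yu] by (simp add: transport_sum_def)
      finally show ?thesis .
    qed
    have "gfinsum (Mst z) (?t s z) (range_fibre G z) = gfinsum (Mst z) (?t s z) S"
      by (rule Z.gfinprod_mono_neutral_cong_right) (use S off tc[OF s] in auto)
    also have "\<dots> = finprod (add_monoid (Mst z)) (?t s z) S"
      using S tc[OF s] by (intro Z.gfinprod_eq_finprod) auto
    also have "S = \<Union>(A ` gdom G ` S)" by (auto simp: A_def)
    also have "finprod (add_monoid (Mst z)) (?t s z) (\<Union>(A ` gdom G ` S)) =
        finprod (add_monoid (Mst z)) (\<lambda>y. finprod (add_monoid (Mst z)) (?t s z) (A y)) (gdom G ` S)"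
      using S tc[OF s] by (intro Z.finprod_UN_disjoint) (auto simp: A_def pairwise_def disjnt_def)
    also have "\<dots> = \<zero>\<^bsub>Mst z\<^esub>"
      using Z.finprod_one_eqI[of "gdom G ` S" "\<lambda>y. finprod (add_monoid (Mst z)) (?t s z) (A y)"] inner by simp
    finally show "gfinsum (Mst z) (?t s z) (range_fibre G z) = \<zero>\<^bsub>Mst z\<^esub>" .
  next
    fix y z m
    assume L: "\<forall>s \<in> carrier ?\<Gamma>M. \<forall>z \<in> units G. gfinsum (Mst z) (?t s z) (range_fibre G z) = \<zero>\<^bsub>Mst z\<^esub>"
      and y: "y \<in> units G" and z: "z \<in> units G" and m: "m \<in> carrier (Mst y)"
    interpret Z: comm_group "add_monoid (Mst z)" by (rule Mod_comm_group[OF z])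
    define S where "S = {\<gamma> \<in> arrows G. gran G \<gamma> = z \<and> f \<gamma> \<noteq> \<zero>\<^bsub>\<O>.R (gran G \<gamma>)\<^esub>}"
    \<comment> \<open>Only finitely many points have to be avoided, as f has finite support over z;
      hence a suitable section exists.\<close>
    have "finite (gdom G ` S)" using \<O>.Gamma_finite_fibre[OF f, of "gran G" z] by (simp add: S_def)
    then obtain s where s: "s \<in> carrier ?\<Gamma>M" "s y = m"
      "\<And>w. w \<in> units G \<Longrightarrow> w \<in> gdom G ` S \<Longrightarrow> w \<noteq> y \<Longrightarrow> s w = \<zero>\<^bsub>Mst w\<^esub>"
      using global_section_through[OF y m] by metis
    have off: "?t s z \<gamma> = \<zero>\<^bsub>Mst z\<^esub>" if \<gamma>: "\<gamma> \<in> range_fibre G z" "gdom G \<gamma> \<noteq> y" for \<gamma>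
    proof (cases "\<gamma> \<in> S")
      case True
      then have "s (gdom G \<gamma>) = \<zero>\<^bsub>Mst (gdom G \<gamma>)\<^esub>" using s(3) \<gamma> by (auto simp: S_def)
      then show ?thesis
        using \<gamma> mact_zero[of \<gamma>] \<O>.Gamma_value[OF f, of \<gamma>] z by (auto simp: range_fibre_def)
    next
      case False
      then show ?thesis
        using \<gamma> transport_term(2)[OF f, of \<gamma> "s (gdom G \<gamma>)"] sec[OF s(1)] by (auto simp: S_def range_fibre_def)
    qed
    have "\<zero>\<^bsub>Mst z\<^esub> = gfinsum (Mst z) (?t s z) (range_fibre G z)" using L s(1) z by simp
    also have "\<dots> = transport_sum f y z m"
      unfolding transport_sum_def
      by (rule Z.gfinprod_mono_neutral_cong_right) (use off tc[OF s(1)] s(2) in \<open>auto simp: range_fibre_def\<close>)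
    finally show "transport_sum f y z m = \<zero>\<^bsub>Mst z\<^esub>" by simp
  qed
qed

theorem annihilator_Gamma_module:
  "annihilator (Gamma_ring G \<O>) (Gamma_module G \<O> \<M>) =
    {f \<in> carrier (Gamma_ring G \<O>). \<forall>x \<in> units G.
      f \<in> annihilator (Gamma_ring G \<O>) (Ind G \<O> x (stalk_skew_module G \<M> x))}"
proof -
  have "f \<in> annihilator (Gamma_ring G \<O>) (Gamma_module G \<O> \<M>) \<longleftrightarrow>
      (\<forall>x \<in> units G. f \<in> annihilator (Gamma_ring G \<O>) (Ind G \<O> x (stalk_skew_module G \<M> x)))"
    if "f \<in> \<O>.\<Gamma>" for f
    unfolding Gamma_module_annihilated_iff[OF that] Ind_stalks_annihilated_iff[OF that] ..
  moreover have "annihilator (Gamma_ring G \<O>) (Gamma_module G \<O> \<M>) \<subseteq> \<O>.\<Gamma>"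
    by (auto simp: annihilator_def)
  ultimately show ?thesis by (intro equalityI subsetI) auto
qed

end

section \<open>Ideals of the convolution ring\<close>

text \<open>For R = \<open>B\<^sub>x\<close> the elements are cosets, that is sets of functions,
  which is the type of the modules in the theorem.\<close>

definition quotient_module :: "('a, 'c) ring_scheme \<Rightarrow> 'a set \<Rightarrow> ('a, 'a set) module"
  where "quotient_module R J =
    \<lparr>carrier = carrier (R Quot J), mult = undefined, one = undefined, ring.zero = \<zero>\<^bsub>R Quot J\<^esub>,
     ring.add = (\<oplus>\<^bsub>R Quot J\<^esub>), smult = (\<lambda>a X. (J +>\<^bsub>R\<^esub> a) \<otimes>\<^bsub>R Quot J\<^esub> X)\<rparr>"

context ideal
begin

interpretation Q: ring "R Quot I" by (rule quotient_is_ring)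

lemma quotient_module_left_module: "left_module R (quotient_module R I)"
proof -
  have hom: "I +>\<^bsub>R\<^esub> a \<in> carrier (R Quot I)" "I +>\<^bsub>R\<^esub> (a \<oplus>\<^bsub>R\<^esub> b) = (I +>\<^bsub>R\<^esub> a) \<oplus>\<^bsub>R Quot I\<^esub> (I +>\<^bsub>R\<^esub> b)"
    "I +>\<^bsub>R\<^esub> (a \<otimes>\<^bsub>R\<^esub> b) = (I +>\<^bsub>R\<^esub> a) \<otimes>\<^bsub>R Quot I\<^esub> (I +>\<^bsub>R\<^esub> b)" "I +>\<^bsub>R\<^esub> \<one>\<^bsub>R\<^esub> = \<one>\<^bsub>R Quot I\<^esub>"
    if "a \<in> carrier R" "b \<in> carrier R" for a b
    using rcos_ring_hom that by (auto simp: ring_hom_def)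
  have simps: "carrier (quotient_module R I) = carrier (R Quot I)" "\<zero>\<^bsub>quotient_module R I\<^esub> = \<zero>\<^bsub>R Quot I\<^esub>"
    "X \<oplus>\<^bsub>quotient_module R I\<^esub> Y = X \<oplus>\<^bsub>R Quot I\<^esub> Y" "a \<odot>\<^bsub>quotient_module R I\<^esub> X = (I +>\<^bsub>R\<^esub> a) \<otimes>\<^bsub>R Quot I\<^esub> X"
    for X Y a by (simp_all add: quotient_module_def)
  have "abelian_group (quotient_module R I)"
  proof (rule abelian_groupI)
    show "\<exists>Y\<in>carrier (quotient_module R I). Y \<oplus>\<^bsub>quotient_module R I\<^esub> X = \<zero>\<^bsub>quotient_module R I\<^esub>"
      if "X \<in> carrier (quotient_module R I)" for X
      using that Q.l_neg[of X] Q.a_inv_closed[of X] by (auto simp: simps)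
    show "X \<oplus>\<^bsub>quotient_module R I\<^esub> Y = Y \<oplus>\<^bsub>quotient_module R I\<^esub> X"
      if "X \<in> carrier (quotient_module R I)" "Y \<in> carrier (quotient_module R I)" for X Y
      using that Q.a_comm by (simp add: simps)
  qed (simp_all add: simps Q.a_assoc)
  then show ?thesis
    unfolding left_module_def left_module_axioms_def
    using hom hom(4)[OF one_closed one_closed] ring_axioms by (simp add: simps Q.l_distr Q.r_distr Q.m_assoc)
qed

text \<open>The class of 1 detects whether a lies in I. That an element of I also kills the other
  classes rests on I being two-sided, which here is built into the quotient ring.\<close>

lemma quotient_module_annihilated_iff:
  assumes a: "a \<in> carrier R"
  shows "(\<forall>X \<in> carrier (quotient_module R I). a \<odot>\<^bsub>quotient_module R I\<^esub> X = \<zero>\<^bsub>quotient_module R I\<^esub>) \<longleftrightarrow> a \<in> I"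
proof -
  have c: "I +>\<^bsub>R\<^esub> a \<in> carrier (R Quot I)" using rcos_ring_hom a by (auto simp: ring_hom_def)
  have "(\<forall>X \<in> carrier (R Quot I). (I +>\<^bsub>R\<^esub> a) \<otimes>\<^bsub>R Quot I\<^esub> X = \<zero>\<^bsub>R Quot I\<^esub>) \<longleftrightarrow> I +>\<^bsub>R\<^esub> a = \<zero>\<^bsub>R Quot I\<^esub>"
    using Q.r_one[OF c] Q.one_closed by (auto; metis)
  also have "\<dots> \<longleftrightarrow> a \<in> I"
    using rcos_const_imp_mem[OF a] a_rcos_const[of a] by (auto simp: FactRing_def)
  finally show ?thesis by (simp add: quotient_module_def)
qed

end

section \<open>Restricting an ideal to the isotropy groups\<close>

context ring_sheaf
begin

definition restr :: "'g \<Rightarrow> ('g \<Rightarrow> 'e) \<Rightarrow> 'g \<Rightarrow> 'e"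
  where "restr x f = (\<lambda>\<delta>\<in>isotropy G x. f \<delta>)"

lemma restr_fin:
  assumes x: "x \<in> units G" and f: "f \<in> \<Gamma>"
  shows "restr x f \<in> fin_sections (isotropy G x)"
proof -
  have "{\<delta> \<in> isotropy G x. restr x f \<delta> \<noteq> \<zero>\<^bsub>R (gran G \<delta>)\<^esub>} \<subseteq> {\<beta> \<in> arrows G. gdom G \<beta> = x \<and> f \<beta> \<noteq> \<zero>\<^bsub>R (gran G \<beta>)\<^esub>}"
    by (auto simp: restr_def isotropy_iff)
  then have "finite {\<delta> \<in> isotropy G x. restr x f \<delta> \<noteq> \<zero>\<^bsub>R (gran G \<delta>)\<^esub>}"
    by (rule finite_subset) (rule Gamma_finite_fibre[OF f], simp)
  moreover have "restr x f \<in> (\<Pi>\<^sub>E \<delta>\<in>isotropy G x. carrier (R (gran G \<delta>)))"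
    using Gamma_value[OF f] Iso_arrows[OF x] by (auto simp: restr_def subset_iff)
  ultimately show ?thesis by (simp add: fin_sections_def)
qed

text \<open>The single entry a at \<beta> is usually not an element of
  \<open>\<Gamma>\<^sub>c\<close>, but a generator with this value at \<beta> multiplies in the same
  way on the range fibre of \<beta>.\<close>

lemma generator_mult_left:
  assumes "\<beta> \<in> arrows G" "a \<in> carrier (R (gran G \<beta>))"
  obtains s where "s \<in> \<Gamma>" "\<And>g \<zeta>. g \<in> sections_on (arrows G) \<Longrightarrow> \<zeta> \<in> arrows G \<Longrightarrow> gran G \<zeta> = gran G \<beta> \<Longrightarrow>
    (s \<otimes>\<^bsub>Gamma_ring G \<O>\<^esub> g) \<zeta> = a \<otimes>\<^bsub>R (gran G \<beta>)\<^esub> act \<O> \<beta> (g (gmul G (ginv G \<beta>) \<zeta>))"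
proof -
  obtain s U where s: "s \<in> Gamma_generators G \<O>" "bisection G U" "\<beta> \<in> U" "s \<beta> = a"
    "\<And>\<gamma>. \<gamma> \<in> arrows G \<Longrightarrow> \<gamma> \<notin> U \<Longrightarrow> s \<gamma> = \<zero>\<^bsub>R (gran G \<gamma>)\<^esub>"
    by (rule generator_through[OF assms]) (rule that)
  have z: "s \<gamma> = \<zero>\<^bsub>R (gran G \<beta>)\<^esub>" if "\<gamma> \<in> arrows G" "gran G \<gamma> = gran G \<beta>" "\<gamma> \<noteq> \<beta>" for \<gamma>
  proof -
    have "\<gamma> \<notin> U" using that s(2,3) by (auto simp: bisection_def inj_on_def)
    then show ?thesis using s(5) that by simp
  qed
  note \<Gamma>s = generators_Gamma[OF s(1)]
  show ?thesis
  proof (rule that[OF \<Gamma>s])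
    fix g \<zeta> assume g: "g \<in> sections_on (arrows G)" and \<zeta>: "\<zeta> \<in> arrows G" "gran G \<zeta> = gran G \<beta>"
    have "(s \<otimes>\<^bsub>Gamma_ring G \<O>\<^esub> g) \<zeta> = s \<beta> \<otimes>\<^bsub>R (gran G \<zeta>)\<^esub> act \<O> \<beta> (g (gmul G (ginv G \<beta>) \<zeta>))"
      by (rule Gamma_mult_left[OF Gamma_sections[OF \<Gamma>s] g assms(1) \<zeta> z])
    then show "(s \<otimes>\<^bsub>Gamma_ring G \<O>\<^esub> g) \<zeta> = a \<otimes>\<^bsub>R (gran G \<beta>)\<^esub> act \<O> \<beta> (g (gmul G (ginv G \<beta>) \<zeta>))"
      unfolding s(4) \<zeta>(2) .
  qed
qed

lemma generator_mult_right:
  assumes "\<rho> \<in> arrows G" "a \<in> carrier (R (gran G \<rho>))"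
  obtains s where "s \<in> \<Gamma>" "\<And>f \<zeta>. f \<in> sections_on (arrows G) \<Longrightarrow> \<zeta> \<in> arrows G \<Longrightarrow> gdom G \<zeta> = gdom G \<rho> \<Longrightarrow>
    (f \<otimes>\<^bsub>Gamma_ring G \<O>\<^esub> s) \<zeta> = f (gmul G \<zeta> (ginv G \<rho>)) \<otimes>\<^bsub>R (gran G \<zeta>)\<^esub> act \<O> (gmul G \<zeta> (ginv G \<rho>)) a"
proof -
  obtain s U where s: "s \<in> Gamma_generators G \<O>" "bisection G U" "\<rho> \<in> U" "s \<rho> = a"
    "\<And>\<gamma>. \<gamma> \<in> arrows G \<Longrightarrow> \<gamma> \<notin> U \<Longrightarrow> s \<gamma> = \<zero>\<^bsub>R (gran G \<gamma>)\<^esub>"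
    by (rule generator_through[OF assms]) (rule that)
  have z: "s \<gamma> = \<zero>\<^bsub>R (gran G \<gamma>)\<^esub>" if "\<gamma> \<in> arrows G" "gdom G \<gamma> = gdom G \<rho>" "\<gamma> \<noteq> \<rho>" for \<gamma>
  proof -
    have "\<gamma> \<notin> U" using that s(2,3) by (auto simp: bisection_def inj_on_def)
    then show ?thesis using s(5) that by simp
  qed
  note \<Gamma>s = generators_Gamma[OF s(1)]
  show ?thesis
  proof (rule that[OF \<Gamma>s])
    fix f \<zeta> assume f: "f \<in> sections_on (arrows G)" and \<zeta>: "\<zeta> \<in> arrows G" "gdom G \<zeta> = gdom G \<rho>"
    have "(f \<otimes>\<^bsub>Gamma_ring G \<O>\<^esub> s) \<zeta> =
        f (gmul G \<zeta> (ginv G \<rho>)) \<otimes>\<^bsub>R (gran G \<zeta>)\<^esub> act \<O> (gmul G \<zeta> (ginv G \<rho>)) (s \<rho>)"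
      by (rule Gamma_mult_right[OF Gamma_sections[OF \<Gamma>s] f assms(1) \<zeta> z])
    then show "(f \<otimes>\<^bsub>Gamma_ring G \<O>\<^esub> s) \<zeta> = f (gmul G \<zeta> (ginv G \<rho>)) \<otimes>\<^bsub>R (gran G \<zeta>)\<^esub> act \<O> (gmul G \<zeta> (ginv G \<rho>)) a"
      unfolding s(4) .
  qed
qed

lemma conv_single_left:
  assumes x: "x \<in> units G" and \<delta>: "\<delta> \<in> isotropy G x" and a: "a \<in> carrier (R x)"
    and g: "g \<in> fin_sections (isotropy G x)" and \<zeta>: "\<zeta> \<in> isotropy G x"
  shows "conv (isotropy G x) (isotropy G x) (isotropy G x) (single (isotropy G x) \<delta> a) g \<zeta> =
    a \<otimes>\<^bsub>R x\<^esub> act \<O> \<delta> (g (gmul G (ginv G \<delta>) \<zeta>))"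
proof -
  let ?I = "isotropy G x" and ?\<rho> = "gmul G (ginv G \<delta>) \<zeta>"
  note t = translates_isotropy[of x]
  have d: "\<delta> \<in> arrows G" "gdom G \<delta> = x" "gran G \<delta> = x" "\<zeta> \<in> arrows G" "gdom G \<zeta> = x" "gran G \<zeta> = x"
    using \<delta> \<zeta> by (auto simp: isotropy_iff)
  have s: "single ?I \<delta> a \<in> fin_sections ?I"
    using Iso_arrows[OF x] \<delta> a d by (intro single_fin) auto
  have \<rho>: "?\<rho> \<in> ?I" "gmul G \<zeta> (ginv G ?\<rho>) = \<delta>" using d by (auto simp: isotropy_iff inv_gmul)
  have "conv ?I ?I ?I (single ?I \<delta> a) g \<zeta> = conv_term (single ?I \<delta> a) g \<zeta> ?\<rho>"
  proof (rule conv_eq_term[OF t \<zeta> fin_sections_sections[OF s] fin_sections_sections[OF g] \<rho>(1)])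
    fix \<rho> assume r: "\<rho> \<in> ?I" "\<rho> \<noteq> ?\<rho>"
    then have r': "\<rho> \<in> arrows G" "gdom G \<rho> = x" "gran G \<rho> = x" by (auto simp: isotropy_iff)
    have "gmul G \<zeta> (ginv G \<rho>) \<noteq> \<delta>"
    proof
      assume eq: "gmul G \<zeta> (ginv G \<rho>) = \<delta>"
      have "gmul G \<delta> \<rho> = \<zeta>" using cancel(4)[of \<rho> \<zeta>] r' d unfolding eq by auto
      then show False using cancel(1)[of \<delta> \<rho>] r r' d by auto
    qed
    moreover have "gmul G \<zeta> (ginv G \<rho>) \<in> ?I" using r' d by (auto simp: isotropy_iff)
    moreover have "act \<O> (gmul G \<zeta> (ginv G \<rho>)) (g \<rho>) \<in> carrier (R x)"
      using act_in_carrier[of "gmul G \<zeta> (ginv G \<rho>)" "g \<rho>"] fin_sections_value[OF g r(1)] r' d by simp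
    ultimately show "conv_term (single ?I \<delta> a) g \<zeta> \<rho> = \<zero>\<^bsub>R (gran G \<zeta>)\<^esub>"
      using r' d x by (simp add: conv_term_def single_def)
  qed
  then show ?thesis using \<rho> \<delta> d by (simp add: conv_term_def single_def)
qed

lemma cut_cut: "A' \<subseteq> A \<Longrightarrow> B' \<subseteq> B \<Longrightarrow> cut A' B' (cut A B f) = cut A' B' f"
  by (auto simp: cut_def fun_eq_iff restrict_def)

text \<open>Disjointness ensures that no arrow is counted in both summands.\<close>

lemma cut_disjoint_Un:
  assumes "f \<in> sections_on (arrows G)"
  shows "B \<inter> B' = {} \<Longrightarrow> cut A (B \<union> B') f = sec_add (arrows G) (cut A B f) (cut A B' f)"
    and "A \<inter> A' = {} \<Longrightarrow> cut (A \<union> A') B f = sec_add (arrows G) (cut A B f) (cut A' B f)"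
  using assms by (auto simp: cut_def sec_add_def fun_eq_iff restrict_def Pi_iff)

context
  fixes I assumes I: "two_sided_ideal I (Gamma_ring G \<O>)"
begin

lemma I_subset: "f \<in> I \<Longrightarrow> f \<in> \<Gamma>"
  using I additive_subgroup.a_subset by (fastforce simp: two_sided_ideal_def)

lemma I_zero: "sec_zero (arrows G) \<in> I"
  using I additive_subgroup.zero_closed by (fastforce simp: two_sided_ideal_def Gamma_simps)

lemma I_add: "f \<in> I \<Longrightarrow> g \<in> I \<Longrightarrow> sec_add (arrows G) f g \<in> I"
  using I additive_subgroup.a_closed by (fastforce simp: two_sided_ideal_def Gamma_simps(3)[symmetric])

lemma I_mult: "f \<in> I \<Longrightarrow> g \<in> \<Gamma> \<Longrightarrow> g \<otimes>\<^bsub>Gamma_ring G \<O>\<^esub> f \<in> I" "f \<in> I \<Longrightarrow> g \<in> \<Gamma> \<Longrightarrow> f \<otimes>\<^bsub>Gamma_ring G \<O>\<^esub> g \<in> I"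
  using I by (auto simp: two_sided_ideal_def)

lemma I_cut:
  assumes "f \<in> I" "A \<in> compact_opens" "B \<in> compact_opens"
  shows "cut A B f \<in> I"
  unfolding cut_eq[OF compact_open_units[OF assms(2)] compact_open_units[OF assms(3)] Gamma_sections[OF I_subset[OF assms(1)]]]
  using assms unit_on_generator generators_Gamma by (intro I_mult) auto

text \<open>Restriction is not multiplicative in general, since a factorization of an isotropy
  element may pass through other units. Still, multiplying a restriction by a single entry a at
  \<delta> gives the restriction of a product with a generator through a at \<delta>, and additivity
  does the rest.\<close>

lemma restr_ideal:
  assumes x: "x \<in> units G"
  shows "ideal (restr x ` I) (skew_group_ring G \<O> x)"
proof -
  let ?B = "skew_group_ring G \<O> x" and ?Iso = "isotropy G x"
  interpret B: ring ?B by (rule Bx_ring[OF x])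
  note simps = Bx_simps[OF x] and t = translates_isotropy[of x] and A = Iso_arrows[OF x]
  have rf: "restr x f \<in> fin_sections ?Iso" if "f \<in> I" for f using restr_fin[OF x I_subset[OF that]] .
  have zero: "sec_zero ?Iso = restr x (sec_zero (arrows G))"
    using A by (auto simp: restr_def sec_zero_def fun_eq_iff restrict_def)
  have add: "sec_add ?Iso (restr x f) (restr x g) = restr x (sec_add (arrows G) f g)" for f g
    using A by (auto simp: restr_def sec_add_def fun_eq_iff restrict_def)
  have IsoD: "\<delta> \<in> arrows G" "gdom G \<delta> = x" "gran G \<delta> = x" if "\<delta> \<in> ?Iso" for \<delta>
    using that by (auto simp: isotropy_iff)
  have left: "conv ?Iso ?Iso ?Iso b (restr x f) \<in> restr x ` I" if b: "b \<in> fin_sections ?Iso" and f: "f \<in> I" for b f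
    using A b
  proof (induction rule: fin_sections_induct)
    case zero then show ?case
      using conv_zero_left[OF t fin_sections_sections[OF rf[OF f]]] \<open>sec_zero ?Iso = _\<close> I_zero by simp
  next
    case (single \<delta> a)
    note \<delta> = IsoD[OF single(1)]
    obtain s where s: "s \<in> \<Gamma>" "\<And>g \<zeta>. g \<in> sections_on (arrows G) \<Longrightarrow> \<zeta> \<in> arrows G \<Longrightarrow> gran G \<zeta> = gran G \<delta> \<Longrightarrow>
        (s \<otimes>\<^bsub>Gamma_ring G \<O>\<^esub> g) \<zeta> = a \<otimes>\<^bsub>R (gran G \<delta>)\<^esub> act \<O> \<delta> (g (gmul G (ginv G \<delta>) \<zeta>))"
      using generator_mult_left[OF \<delta>(1) single(2)] by metis
    have "conv ?Iso ?Iso ?Iso (single ?Iso \<delta> a) (restr x f) = restr x (s \<otimes>\<^bsub>Gamma_ring G \<O>\<^esub> f)"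
    proof
      fix \<zeta>
      show "conv ?Iso ?Iso ?Iso (single ?Iso \<delta> a) (restr x f) \<zeta> = restr x (s \<otimes>\<^bsub>Gamma_ring G \<O>\<^esub> f) \<zeta>"
      proof (cases "\<zeta> \<in> ?Iso")
        case True
        have "gmul G (ginv G \<delta>) \<zeta> \<in> ?Iso" using \<delta> IsoD[OF True] by (simp add: isotropy_iff)
        then show ?thesis
          using True conv_single_left[OF x single(1) _ rf[OF f] True, of a] single(2) \<delta> IsoD[OF True]
            s(2)[OF Gamma_sections[OF I_subset[OF f]], of \<zeta>] by (simp add: restr_def)
      qed (simp add: conv_def restr_def)
    qed
    then show ?case using I_mult(1)[OF f s(1)] by simp
  next
    case (add b c)
    then obtain g h where gh: "g \<in> I" "h \<in> I" "conv ?Iso ?Iso ?Iso b (restr x f) = restr x g"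
      "conv ?Iso ?Iso ?Iso c (restr x f) = restr x h" by blast
    have "conv ?Iso ?Iso ?Iso (sec_add ?Iso b c) (restr x f) = sec_add ?Iso (restr x g) (restr x h)"
      using conv_add_left[OF t fin_sections_sections[OF add(1)] fin_sections_sections[OF add(2)] rf[OF f]] gh by simp
    then show ?case using I_add[OF gh(1,2)] \<open>sec_add ?Iso (restr x g) (restr x h) = _\<close> by simp
  qed
  have right: "conv ?Iso ?Iso ?Iso (restr x f) b \<in> restr x ` I" if b: "b \<in> fin_sections ?Iso" and f: "f \<in> I" for b f
    using A b
  proof (induction rule: fin_sections_induct)
    case zero then show ?case
      using conv_zero_right[OF t fin_sections_sections[OF rf[OF f]]] \<open>sec_zero ?Iso = _\<close> I_zero by simp
  next
    case (single \<delta> a)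
    note \<delta> = IsoD[OF single(1)]
    obtain s where s: "s \<in> \<Gamma>" "\<And>f \<zeta>. f \<in> sections_on (arrows G) \<Longrightarrow> \<zeta> \<in> arrows G \<Longrightarrow> gdom G \<zeta> = gdom G \<delta> \<Longrightarrow>
        (f \<otimes>\<^bsub>Gamma_ring G \<O>\<^esub> s) \<zeta> = f (gmul G \<zeta> (ginv G \<delta>)) \<otimes>\<^bsub>R (gran G \<zeta>)\<^esub> act \<O> (gmul G \<zeta> (ginv G \<delta>)) a"
      using generator_mult_right[OF \<delta>(1) single(2)] by metis
    have "conv ?Iso ?Iso ?Iso (restr x f) (single ?Iso \<delta> a) = restr x (f \<otimes>\<^bsub>Gamma_ring G \<O>\<^esub> s)"
    proof
      fix \<zeta>
      show "conv ?Iso ?Iso ?Iso (restr x f) (single ?Iso \<delta> a) \<zeta> = restr x (f \<otimes>\<^bsub>Gamma_ring G \<O>\<^esub> s) \<zeta>"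
      proof (cases "\<zeta> \<in> ?Iso")
        case True
        have "gmul G \<zeta> (ginv G \<delta>) \<in> ?Iso" using \<delta> IsoD[OF True] by (simp add: isotropy_iff)
        then show ?thesis
          using True conv_single[OF t True fin_sections_sections[OF rf[OF f]] single] \<delta> IsoD[OF True]
            s(2)[OF Gamma_sections[OF I_subset[OF f]], of \<zeta>] by (simp add: restr_def)
      qed (simp add: conv_def restr_def)
    qed
    then show ?case using I_mult(2)[OF f s(1)] by simp
  next
    case (add b c)
    then obtain g h where gh: "g \<in> I" "h \<in> I" "conv ?Iso ?Iso ?Iso (restr x f) b = restr x g"
      "conv ?Iso ?Iso ?Iso (restr x f) c = restr x h" by blast
    have "conv ?Iso ?Iso ?Iso (restr x f) (sec_add ?Iso b c) = sec_add ?Iso (restr x g) (restr x h)"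
      using conv_add_right[OF t fin_sections_sections[OF rf[OF f]] add(1,2)] gh by simp
    then show ?case using I_add[OF gh(1,2)] \<open>sec_add ?Iso (restr x g) (restr x h) = _\<close> by simp
  qed
  show ?thesis
  proof (rule idealI[OF Bx_ring[OF x]])
    show "b \<otimes>\<^bsub>?B\<^esub> a \<in> restr x ` I" "a \<otimes>\<^bsub>?B\<^esub> b \<in> restr x ` I"
      if "a \<in> restr x ` I" "b \<in> carrier ?B" for a b
      using that left right by (auto simp: simps)
    have sub: "restr x ` I \<subseteq> carrier ?B" using rf by (auto simp: simps)
    show "subgroup (restr x ` I) (add_monoid ?B)"
    proof (rule group.subgroupI)
      show "group (add_monoid ?B)" using B.add.group_axioms .
      show "restr x ` I \<noteq> {}" using I_zero by blast
      show "inv\<^bsub>add_monoid ?B\<^esub> a \<in> restr x ` I" if a: "a \<in> restr x ` I" for a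
      proof -
        have ac: "a \<in> carrier ?B" using a sub by blast
        \<comment> \<open>Absorption is available by now, so the negative of a is obtained as -1
          times a.\<close>
        have "(\<ominus>\<^bsub>?B\<^esub> \<one>\<^bsub>?B\<^esub>) \<otimes>\<^bsub>?B\<^esub> a \<in> restr x ` I"
          using a left B.a_inv_closed[OF B.one_closed] by (auto simp: simps)
        moreover have "(\<ominus>\<^bsub>?B\<^esub> \<one>\<^bsub>?B\<^esub>) \<otimes>\<^bsub>?B\<^esub> a = \<ominus>\<^bsub>?B\<^esub> a"
          using B.l_minus[OF B.one_closed ac] ac by simp
        ultimately show ?thesis by (simp add: a_inv_def)
      qed
    qed (use sub add I_add in \<open>auto simp: simps\<close>)
  qed
qed

text \<open>The corner is the restriction of the product sft, with s and t generators of value 1 at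
  \<open>\<eta>\<^sup>-\<^sup>1\<close> and at \<gamma>.\<close>

lemma corner_in_restr:
  assumes x: "x \<in> units G" and \<eta>: "\<eta> \<in> source_fibre G x" and \<gamma>: "\<gamma> \<in> source_fibre G x" and f: "f \<in> I"
  shows "corner x f \<eta> \<gamma> \<in> restr x ` I"
proof -
  have \<eta>': "\<eta> \<in> arrows G" "gdom G \<eta> = x" and \<gamma>': "\<gamma> \<in> arrows G" "gdom G \<gamma> = x"
    using \<eta> \<gamma> by (auto simp: source_fibre_iff)
  have "ginv G \<eta> \<in> arrows G" "\<one>\<^bsub>R x\<^esub> \<in> carrier (R (gran G (ginv G \<eta>)))" using \<eta>' x by auto
  from generator_mult_left[OF this] obtain s where s: "s \<in> \<Gamma>"
    "\<And>g \<zeta>. g \<in> sections_on (arrows G) \<Longrightarrow> \<zeta> \<in> arrows G \<Longrightarrow> gran G \<zeta> = gran G (ginv G \<eta>) \<Longrightarrow>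
      (s \<otimes>\<^bsub>Gamma_ring G \<O>\<^esub> g) \<zeta> = \<one>\<^bsub>R x\<^esub> \<otimes>\<^bsub>R (gran G (ginv G \<eta>))\<^esub> act \<O> (ginv G \<eta>) (g (gmul G (ginv G (ginv G \<eta>)) \<zeta>))"
    by metis
  have "\<one>\<^bsub>R (gran G \<gamma>)\<^esub> \<in> carrier (R (gran G \<gamma>))" using \<gamma>' by simp
  from generator_mult_right[OF \<gamma>'(1) this] obtain t where t: "t \<in> \<Gamma>"
    "\<And>f \<zeta>. f \<in> sections_on (arrows G) \<Longrightarrow> \<zeta> \<in> arrows G \<Longrightarrow> gdom G \<zeta> = gdom G \<gamma> \<Longrightarrow>
      (f \<otimes>\<^bsub>Gamma_ring G \<O>\<^esub> t) \<zeta> = f (gmul G \<zeta> (ginv G \<gamma>)) \<otimes>\<^bsub>R (gran G \<zeta>)\<^esub> act \<O> (gmul G \<zeta> (ginv G \<gamma>)) \<one>\<^bsub>R (gran G \<gamma>)\<^esub>"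
    by metis
  note f\<Gamma> = I_subset[OF f]
  have ft: "f \<otimes>\<^bsub>Gamma_ring G \<O>\<^esub> t \<in> I" by (rule I_mult(2)[OF f t(1)])
  note ft\<Gamma> = I_subset[OF ft]
  have "corner x f \<eta> \<gamma> = restr x (s \<otimes>\<^bsub>Gamma_ring G \<O>\<^esub> (f \<otimes>\<^bsub>Gamma_ring G \<O>\<^esub> t))"
  proof
    fix \<delta>
    show "corner x f \<eta> \<gamma> \<delta> = restr x (s \<otimes>\<^bsub>Gamma_ring G \<O>\<^esub> (f \<otimes>\<^bsub>Gamma_ring G \<O>\<^esub> t)) \<delta>"
    proof (cases "\<delta> \<in> isotropy G x")
      case True
      then have \<delta>: "\<delta> \<in> arrows G" "gdom G \<delta> = x" "gran G \<delta> = x" by (auto simp: isotropy_iff)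
      let ?\<epsilon> = "gmul G \<eta> \<delta>" and ?\<beta> = "gmul G (gmul G \<eta> \<delta>) (ginv G \<gamma>)"
      have \<beta>: "?\<beta> \<in> arrows G" "gran G ?\<beta> = gran G \<eta>" "gdom G ?\<beta> = gran G \<gamma>" using \<delta> \<eta>' \<gamma>' by auto
      have \<epsilon>: "?\<epsilon> \<in> arrows G" "gran G ?\<epsilon> = gran G \<eta>" "gdom G ?\<epsilon> = x" using \<delta> \<eta>' by auto
      have fb: "f ?\<beta> \<in> carrier (R (gran G \<eta>))" using Gamma_value[OF f\<Gamma> \<beta>(1)] \<beta> by simp
      have "(f \<otimes>\<^bsub>Gamma_ring G \<O>\<^esub> t) ?\<epsilon> = f ?\<beta>"
        using t(2)[OF Gamma_sections[OF f\<Gamma>] \<epsilon>(1)] \<epsilon> \<gamma>' \<eta>' fb act_one[OF \<beta>(1)] \<beta> by simp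
      moreover have "(s \<otimes>\<^bsub>Gamma_ring G \<O>\<^esub> (f \<otimes>\<^bsub>Gamma_ring G \<O>\<^esub> t)) \<delta> =
          \<one>\<^bsub>R x\<^esub> \<otimes>\<^bsub>R x\<^esub> act \<O> (ginv G \<eta>) ((f \<otimes>\<^bsub>Gamma_ring G \<O>\<^esub> t) ?\<epsilon>)"
        using s(2)[OF Gamma_sections[OF ft\<Gamma>] \<delta>(1)] \<delta> \<eta>' by simp
      moreover have "act \<O> (ginv G \<eta>) (f ?\<beta>) \<in> carrier (R x)"
        using act_in_carrier[of "ginv G \<eta>" "f ?\<beta>"] fb \<eta>' by simp
      ultimately show ?thesis using True x by (simp add: restr_def corner_def[OF x])
    qed (simp add: restr_def corner_def[OF x])
  qed
  then show ?thesis using I_mult(1)[OF ft s(1)] by simp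
qed

text \<open>For the column of the unit y the corner is f on the arrows y \<rightarrow> z, translated
  by \<open>\<eta>\<^sup>-\<^sup>1\<close> to the isotropy group. An element of I with the same
  restriction is translated back by a generator with value 1 at \<eta>. Without arrows y
  \<rightarrow> z, zero serves.\<close>

lemma agrees_with_I:
  assumes f: "f \<in> \<Gamma>" and y: "y \<in> units G" and z: "z \<in> units G"
    and c: "\<And>\<eta>. \<eta> \<in> source_fibre G y \<Longrightarrow> corner y f \<eta> y \<in> restr y ` I"
  obtains g where "g \<in> I" "\<And>\<beta>. \<beta> \<in> arrows G \<Longrightarrow> gdom G \<beta> = y \<Longrightarrow> gran G \<beta> = z \<Longrightarrow> f \<beta> = g \<beta>"
proof (cases "\<exists>\<eta> \<in> arrows G. gdom G \<eta> = y \<and> gran G \<eta> = z")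
  case False
  then show ?thesis using I_zero that by blast
next
  case True
  then obtain \<eta> where \<eta>: "\<eta> \<in> arrows G" "gdom G \<eta> = y" "gran G \<eta> = z" by blast
  then have "\<eta> \<in> source_fibre G y" by (simp add: source_fibre_iff)
  then obtain g where g: "g \<in> I" "corner y f \<eta> y = restr y g" using c by blast
  have "\<one>\<^bsub>R z\<^esub> \<in> carrier (R (gran G \<eta>))" using \<eta> z by simp
  from generator_mult_left[OF \<eta>(1) this] obtain s where s: "s \<in> \<Gamma>"
    "\<And>g \<zeta>. g \<in> sections_on (arrows G) \<Longrightarrow> \<zeta> \<in> arrows G \<Longrightarrow> gran G \<zeta> = gran G \<eta> \<Longrightarrow>
      (s \<otimes>\<^bsub>Gamma_ring G \<O>\<^esub> g) \<zeta> = \<one>\<^bsub>R z\<^esub> \<otimes>\<^bsub>R (gran G \<eta>)\<^esub> act \<O> \<eta> (g (gmul G (ginv G \<eta>) \<zeta>))"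
    by metis
  show ?thesis
  proof (rule that[OF I_mult(1)[OF g(1) s(1)]])
    fix \<beta> assume \<beta>: "\<beta> \<in> arrows G" "gdom G \<beta> = y" "gran G \<beta> = z"
    let ?\<delta> = "gmul G (ginv G \<eta>) \<beta>"
    have \<delta>: "?\<delta> \<in> isotropy G y" using \<beta> \<eta> by (simp add: isotropy_iff)
    have f\<beta>: "f \<beta> \<in> carrier (R z)" using Gamma_value[OF f \<beta>(1)] \<beta> by simp
    have "g ?\<delta> = corner y f \<eta> y ?\<delta>" using g(2) \<delta> by (simp add: restr_def)
    also have "\<dots> = act \<O> (ginv G \<eta>) (f \<beta>)" using \<delta> \<beta> \<eta> y by (simp add: corner_def[OF y])
    finally have "(s \<otimes>\<^bsub>Gamma_ring G \<O>\<^esub> g) \<beta> = \<one>\<^bsub>R z\<^esub> \<otimes>\<^bsub>R z\<^esub> act \<O> \<eta> (act \<O> (ginv G \<eta>) (f \<beta>))"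
      using s(2)[OF Gamma_sections[OF I_subset[OF g(1)]] \<beta>(1)] \<beta> \<eta> by simp
    then show "f \<beta> = (s \<otimes>\<^bsub>Gamma_ring G \<O>\<^esub> g) \<beta>"
      using act_inv_cancel(2)[OF \<eta>(1), of "f \<beta>"] f\<beta> \<eta> z by simp
  qed
qed

text \<open>Each pair (y, z) has compact open neighbourhoods to which the cut of f lies in I.
  Compactness is used twice, as in the tube lemma: over the domains with z fixed, then over the
  ranges.\<close>

lemma in_I_if_corners:
  assumes f: "f \<in> \<Gamma>"
    and c: "\<And>y \<eta>. y \<in> units G \<Longrightarrow> \<eta> \<in> source_fibre G y \<Longrightarrow> corner y f \<eta> y \<in> restr y ` I"
  shows "f \<in> I"
proof -
  note fs = Gamma_sections[OF f]
  have loc: "\<exists>A \<in> compact_opens. \<exists>B \<in> compact_opens. z \<in> A \<and> y \<in> B \<and> cut A B f \<in> I"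
    if y: "y \<in> units G" and z: "z \<in> units G" for y z
  proof -
    obtain g where g: "g \<in> I" "\<And>\<beta>. \<beta> \<in> arrows G \<Longrightarrow> gdom G \<beta> = y \<Longrightarrow> gran G \<beta> = z \<Longrightarrow> f \<beta> = g \<beta>"
      using agrees_with_I[OF f y z c[OF y]] by blast
    interpret S: group "section_group G \<O>" by (rule arrows_group)
    note g\<Gamma> = I_subset[OF g(1)]
    have gc: "g \<in> carrier (section_group G \<O>)" "f \<in> carrier (section_group G \<O>)"
      using subgroup.subset[OF Gamma_subgroup] g\<Gamma> f by auto
    \<comment> \<open>The difference of f and g vanishes on the arrows y \<rightarrow> z and hence
      near (y, z). There f and g have the same cut, and the cut of g is in I.\<close>
    define h where "h = f \<otimes>\<^bsub>section_group G \<O>\<^esub> inv\<^bsub>section_group G \<O>\<^esub> g"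
    have h: "h \<in> \<Gamma>"
      unfolding h_def using subgroup.m_closed[OF Gamma_subgroup f subgroup.m_inv_closed[OF Gamma_subgroup g\<Gamma>]] .
    have "h \<otimes>\<^bsub>section_group G \<O>\<^esub> g = f" unfolding h_def using gc by (simp add: S.m_assoc)
    then have hg: "f \<beta> = h \<beta> \<oplus>\<^bsub>R (gran G \<beta>)\<^esub> g \<beta>" if "\<beta> \<in> arrows G" for \<beta>
      using that by (auto simp: section_group_simps sec_add_def)
    have "h \<beta> = \<zero>\<^bsub>R z\<^esub>" if \<beta>: "\<beta> \<in> arrows G" "gdom G \<beta> = y" "gran G \<beta> = z" for \<beta>
      using hg[OF \<beta>(1)] g(2)[OF \<beta>] Gamma_value[OF h \<beta>(1)] Gamma_value[OF g\<Gamma> \<beta>(1)] \<beta>(3)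
        group.l_cancel_one'[OF R_group[OF z], of "g \<beta>" "h \<beta>"] group.right_cancel[OF R_group[OF z], of "g \<beta>" "h \<beta>" "\<zero>\<^bsub>R z\<^esub>"] z
      by simp
    then have "near y z (\<lambda>\<zeta>. h \<zeta> = \<zero>\<^bsub>R (gran G \<zeta>)\<^esub>)" using Gamma_vanishes_near[OF h y z] by blast
    then obtain A B where AB: "A \<in> compact_opens" "B \<in> compact_opens" "z \<in> A" "y \<in> B"
      "\<And>\<zeta>. \<zeta> \<in> arrows G \<Longrightarrow> gran G \<zeta> \<in> A \<Longrightarrow> gdom G \<zeta> \<in> B \<Longrightarrow> h \<zeta> = \<zero>\<^bsub>R (gran G \<zeta>)\<^esub>"
      unfolding near_def by blast
    have "cut A B f = cut A B g"
      using AB(5) hg Gamma_value[OF g\<Gamma>] by (auto simp: cut_def fun_eq_iff restrict_def)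
    then have "cut A B f \<in> I" using I_cut[OF g(1) AB(1,2)] by simp
    then show ?thesis using AB(1-4) by blast
  qed
  have zero: "cut A {} f = sec_zero (arrows G)" "cut {} A f = sec_zero (arrows G)" for A
    by (auto simp: cut_def sec_zero_def)
  obtain K where K: "K \<in> compact_opens"
    "\<forall>\<gamma> \<in> arrows G. f \<gamma> \<noteq> \<zero>\<^bsub>R (gran G \<gamma>)\<^esub> \<longrightarrow> gran G \<gamma> \<in> K \<and> gdom G \<gamma> \<in> K"
    using Gamma_support[OF f] by blast
  have KU: "K \<subseteq> units G" by (rule compact_open_units[OF K(1)])
  \<comment> \<open>The neighbourhood of z belongs to the property being propagated, so that it may
    shrink at each of the finitely many unions.\<close>
  have inner: "\<exists>A \<in> compact_opens. z \<in> A \<and> cut A K f \<in> I" if z: "z \<in> units G" for z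
    using K(1)
  proof (induction rule: compact_open_induct)
    case (local y)
    then show ?case using loc[of y z] KU z by blast
  next
    case (subset B B')
    then obtain A where A: "A \<in> compact_opens" "z \<in> A" "cut A B f \<in> I" by blast
    then show ?case using I_cut[OF A(3,1) subset(2)] cut_cut[of A A B' B f] subset(3) by auto
  next
    case (union B B')
    then obtain A A' where A: "A \<in> compact_opens" "z \<in> A" "cut A B f \<in> I" "A' \<in> compact_opens" "z \<in> A'" "cut A' B' f \<in> I"
      by blast
    let ?A = "A \<inter> A'"
    have AA: "?A \<in> compact_opens" using A compact_open_Int by blast
    have "cut ?A B f \<in> I" "cut ?A B' f \<in> I"
      using I_cut[OF A(3) AA union(1)] I_cut[OF A(6) AA union(2)] cut_cut[of ?A A B B f] cut_cut[of ?A A' B' B' f] by auto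
    then have "cut ?A (B \<union> B') f \<in> I" using cut_disjoint_Un(1)[OF fs union(3)] I_add by simp
    then show ?case using AA A by blast
  next
    case empty
    have "openin (unit_space G) (units G)" using openin_topspace[of "unit_space G"] by simp
    then obtain A where "A \<in> compact_opens" "z \<in> A" using compact_open_basis z by metis
    then show ?case using zero I_zero by auto
  qed
  \<comment> \<open>The second pass runs over the ranges, with the domains already cut to all of
    K.\<close>
  have "cut K K f \<in> I"
    using K(1)
  proof (induction K rule: compact_open_induct[where P = "\<lambda>A. cut A K f \<in> I"])
    case (local z) then show ?case using inner KU by blast
  next
    case (subset A A')
    then show ?case using I_cut[OF subset(3,2) K(1)] subset(4) cut_cut[of A' A K K f] by simp
  next
    case (union A A')
    then show ?case using cut_disjoint_Un(2)[OF fs union(5)] union(3,4) I_add by simp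
  next
    case empty then show ?case using zero I_zero by simp
  qed
  moreover have "cut K K f = f"
    using K(2) Gamma_carrier[OF f] by (auto simp: cut_def fun_eq_iff restrict_def PiE_iff extensional_def)
  ultimately show ?thesis by simp
qed

theorem ideal_eq_annihilators:
  "I = {f \<in> \<Gamma>. \<forall>x \<in> units G. f \<in> annihilator (Gamma_ring G \<O>)
    (Ind G \<O> x (quotient_module (skew_group_ring G \<O> x) (restr x ` I)))}"
proof -
  have ann: "f \<in> annihilator (Gamma_ring G \<O>) (Ind G \<O> x (quotient_module (skew_group_ring G \<O> x) (restr x ` I))) \<longleftrightarrow>
    (\<forall>\<eta> \<in> source_fibre G x. \<forall>\<gamma> \<in> source_fibre G x. corner x f \<eta> \<gamma> \<in> restr x ` I)"
    if f: "f \<in> \<Gamma>" and x: "x \<in> units G" for f x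
  proof -
    interpret J: ideal "restr x ` I" "skew_group_ring G \<O> x" by (rule restr_ideal[OF x])
    have "corner x f \<eta> \<gamma> \<in> carrier (skew_group_ring G \<O> x)" if "\<eta> \<in> source_fibre G x" "\<gamma> \<in> source_fibre G x" for \<eta> \<gamma>
    proof -
      have "single (source_fibre G x) \<gamma> \<one>\<^bsub>R (gran G \<gamma>)\<^esub> \<in> fin_sections (source_fibre G x)"
        using that by (intro single_fin SF_arrows[OF x]) (auto simp: source_fibre_iff)
      then have "L_left G \<O> x f (single (source_fibre G x) \<gamma> \<one>\<^bsub>R (gran G \<gamma>)\<^esub>) \<in> fin_sections (source_fibre G x)"
        unfolding L_left_eq[OF x] using conv_fin[OF translates_left Gamma_sections[OF f]] Gamma_finite_fibre[OF f] by blast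
      then show ?thesis
        using coord_fin[OF x that(1)] corner_eq_coord[OF x Gamma_sections[OF f] that] by (simp add: Bx_simps[OF x])
    qed
    then show ?thesis
      unfolding Ind_Gamma_annihilated_iff[OF x J.quotient_module_left_module f]
      using J.quotient_module_annihilated_iff by simp
  qed
  show ?thesis
  proof (intro equalityI subsetI)
    fix f assume f: "f \<in> I"
    then show "f \<in> {f \<in> \<Gamma>. \<forall>x \<in> units G. f \<in> annihilator (Gamma_ring G \<O>)
        (Ind G \<O> x (quotient_module (skew_group_ring G \<O> x) (restr x ` I)))}"
      using ann[OF I_subset[OF f]] corner_in_restr[OF _ _ _ f] I_subset[OF f] by simp
  next
    fix f assume "f \<in> {f \<in> \<Gamma>. \<forall>x \<in> units G. f \<in> annihilator (Gamma_ring G \<O>)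
        (Ind G \<O> x (quotient_module (skew_group_ring G \<O> x) (restr x ` I)))}"
    \<comment> \<open>\<open>unit_SF\<close> specialises the corners to the column of the unit
      itself.\<close>
    then show "f \<in> I"
      using ann unit_SF by (intro in_I_if_corners) auto
  qed
qed

end

end

theorem theorem3p5:
  fixes G :: "'g groupoid" and \<O> :: "('g, 'e) ring_sheaf"
  assumes "ample_groupoid G" and "ring_sheaf G \<O>"
  shows
    "(\<forall>\<M> :: ('g, 'e, 'f) module_sheaf. module_sheaf G \<O> \<M> \<longrightarrow>
        annihilator (Gamma_ring G \<O>) (Gamma_module G \<O> \<M>) =
        {f \<in> carrier (Gamma_ring G \<O>). \<forall>x \<in> units G.
           f \<in> annihilator (Gamma_ring G \<O>) (Ind G \<O> x (stalk_skew_module G \<M> x))}) \<and>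
     (\<forall>I. two_sided_ideal I (Gamma_ring G \<O>) \<longrightarrow>
        (\<exists>\<F> :: ('g \<times> ('g \<Rightarrow> 'e, ('g \<Rightarrow> 'e) set) module) set.
           (\<forall>(x, M) \<in> \<F>. x \<in> units G \<and> left_module (skew_group_ring G \<O> x) M) \<and>
           I = {f \<in> carrier (Gamma_ring G \<O>). \<forall>(x, M) \<in> \<F>.
                  f \<in> annihilator (Gamma_ring G \<O>) (Ind G \<O> x M)}))"
proof (intro conjI allI impI)
  fix \<M> :: "('g, 'e, 'f) module_sheaf"
  assume "module_sheaf G \<O> \<M>"
  then show "annihilator (Gamma_ring G \<O>) (Gamma_module G \<O> \<M>) =
        {f \<in> carrier (Gamma_ring G \<O>). \<forall>x \<in> units G.
           f \<in> annihilator (Gamma_ring G \<O>) (Ind G \<O> x (stalk_skew_module G \<M> x))}"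
    by (rule module_sheaf.annihilator_Gamma_module)
next
  interpret ring_sheaf G \<O> by fact
  fix I assume I: "two_sided_ideal I (Gamma_ring G \<O>)"
  let ?M = "\<lambda>x. quotient_module (skew_group_ring G \<O> x) (restr x ` I)"
  let ?F = "(\<lambda>x. (x, ?M x)) ` units G"
  have "\<forall>(x, M) \<in> ?F. x \<in> units G \<and> left_module (skew_group_ring G \<O> x) M"
    using ideal.quotient_module_left_module[OF restr_ideal[OF I]] by auto
  moreover have "I = {f \<in> carrier (Gamma_ring G \<O>). \<forall>(x, M) \<in> ?F. f \<in> annihilator (Gamma_ring G \<O>) (Ind G \<O> x M)}"
    using ideal_eq_annihilators[OF I] by simp
  ultimately show "\<exists>\<F> :: ('g \<times> ('g \<Rightarrow> 'e, ('g \<Rightarrow> 'e) set) module) set.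
           (\<forall>(x, M) \<in> \<F>. x \<in> units G \<and> left_module (skew_group_ring G \<O> x) M) \<and>
           I = {f \<in> carrier (Gamma_ring G \<O>). \<forall>(x, M) \<in> \<F>.
                  f \<in> annihilator (Gamma_ring G \<O>) (Ind G \<O> x M)}"
    by (intro exI conjI)
qed

end
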